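(* Let $\mathbb{K}$ be a field, $\mathcal{E}$ a finite non-empty set, and $W\subseteq\mathbb{K}^{\mathcal{E}}$ a configuration whose matroid $\mathsf{M}=\mathsf{M}_W$ has rank $\mathrm{rk}\,\mathsf{M}>0$. (a) Then \[ [Y_W]=\sum_{S\subseteq\mathcal{E}=\mathrm{cl}_{\mathsf{M}}(S)}[Y^\circ_{W|_S}]\in\mathrm{K}_0(\mathrm{Var}_{\mathbb{K}}). \] (b) In particular, \[ [Y_W]\equiv\sum_{\substack{S\subseteq\mathcal{E}=\mathrm{cl}_{\mathsf{M}}(S)\\ \mathsf{M}|_S\text{ connected}}}[Y^\circ_{W|_S}]\mod\mathbb{T}. \] (c) If $\mathsf{M}$ is loopless, then \[ [Y^\circ_W]\equiv\sum_{\substack{S\subseteq\mathcal{E}=\mathrm{cl}_{\mathsf{M}}(S)\\ \mathsf{M}|_S\text{ connected}}}(-1)^{|\mathcal{E}\setminus S|}[Y_{W|_S}]\mod\mathbb{T}. \] Here the sums run over all subsets $S\subseteq\mathcal{E}$ with $\mathrm{cl}_{\mathsf{M}}(S)=\mathcal{E}$ (and, in (b) and (c), with $\mathsf{M}|_S$ connected).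
   Context: $\mathrm{K}_0(\mathrm{Var}_{\mathbb{K}})$ is the Grothendieck ring of varieties over $\mathbb{K}$, $[-]$ denotes classes in it, $\mathbb{T}:=[\mathbb{G}_m]$ is the class of the $1$-torus, and "$\mathrm{mod}\ \mathbb{T}$" means modulo the ideal generated by $\mathbb{T}$. Configurations: a configuration is a subspace $W\subseteq V:=\mathbb{K}^{\mathcal{E}}$, where $\mathcal{E}$ is identified with the standard basis of $V$; $x_e=e^\vee$, $e\in\mathcal{E}$, are the coordinates on $V$. Its matroid $\mathsf{M}_W$ on $\mathcal{E}$ is defined by the linear dependence relations of the family $(e^\vee|_W)_{e\in\mathcal{E}}$ in $W^\vee$; $\mathrm{cl}_{\mathsf{M}}$ is its closure operator. For $\emptyset\ne S\subseteq\mathcal{E}$, the restriction $W|_S\subseteq\mathbb{K}^S$ is the image of $W$ under the coordinate projection $\mathbb{K}^{\mathcal{E}}\to\mathbb{K}^S$; it has matroid $\mathsf{M}|_S$. Configuration hypersurface: $Q_W$ is the restriction to $W\times W$ of the symmetric bilinear form $V\times V\to V^\vee$, $(w,w')\mapsto\sum_{e}w_ew'_e\cdot x_e$. Its determinant with respect to a basis of $W$ is the configuration polynomial $\psi_W=\det Q_W\in\mathrm{Sym}\,V^\vee=\mathbb{K}[V]$ (well-defined up to a factor in $\mathbb{K}^*$; $\psi_W=1$ if $W=0$). Set $X_W:=V(\psi_W)\subseteq\mathbb{P}V$, $Y_W:=\mathbb{P}V\setminus X_W$, and let $O_{\mathcal{E}}\subseteq\mathbb{P}V$ be the open torus orbit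 where all coordinates $x_e$ are non-zero; $Y_W^\circ:=Y_W\cap O_{\mathcal{E}}$ is the torus part. For $W|_S$ these are formed in $\mathbb{P}\mathbb{K}^S$. *)

theory Defs
  imports
    "HOL-Algebra.Algebraic_Closure_Type"
    "HOL-Analysis.Abstract_Topology"
    "HOL-Library.Poly_Mapping"
    "HOL-Library.Function_Algebras"
    "Jordan_Normal_Form.Determinant"
begin

no_notation var (\<open>X\<index>\<close>)

section \<open>Polynomials\<close>

type_synonym ('i, 'k) mpoly = "('i \<Rightarrow>\<^sub>0 nat) \<Rightarrow>\<^sub>0 'k"

definition mpoly_eval :: "('i, 'k::field) mpoly \<Rightarrow> ('i \<Rightarrow> 'k alg_closure) \<Rightarrow> 'k alg_closure" where
  "mpoly_eval p x =
     (\<Sum>m\<in>Poly_Mapping.keys p. to_ac (Poly_Mapping.lookup p m) * (\<Prod>i\<in>Poly_Mapping.keys m. x i ^ Poly_Mapping.lookup m i))"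

definition homogeneous :: "nat \<Rightarrow> ('i, 'k::zero) mpoly \<Rightarrow> bool" where
  "homogeneous d p \<longleftrightarrow>
     (\<forall>m\<in>Poly_Mapping.keys p. (\<Sum>i\<in>Poly_Mapping.keys m. Poly_Mapping.lookup m i) = d)"


section \<open>Varieties over a field\<close>

text \<open>
  A variety over a field \<open>k\<close> (a reduced separated scheme of finite type, not necessarily
  irreducible) is described by its points over an algebraic closure of \<open>k\<close>, its topology of open
  subsets defined over \<open>k\<close>, and its sheaf of regular functions defined over \<open>k\<close>. The functions
  take values in the algebraic closure, so that reducedness is built in; conjugate points are not
  separated by the topology, and the topology with its sheaf agrees with that of the scheme.
  Only the values of a function in \<open>kreg X U\<close> at points of the open set \<open>U\<close> matter.
\<close>

record (overloaded) ('p, 'k::field) kspace =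
  ktop :: "'p topology"
  kreg :: "'p set \<Rightarrow> ('p \<Rightarrow> 'k alg_closure) set"

abbreviation kpoints :: "('p, 'k::field) kspace \<Rightarrow> 'p set" where
  "kpoints X \<equiv> topspace (ktop X)"

definition function_sheaf :: "('p, 'k::field) kspace \<Rightarrow> bool" where
  "function_sheaf X \<longleftrightarrow>
     (\<forall>U f g. openin (ktop X) U \<and> f \<in> kreg X U \<and> (\<forall>x\<in>U. g x = f x) \<longrightarrow> g \<in> kreg X U) \<and>
     (\<forall>U V f. openin (ktop X) U \<and> openin (ktop X) V \<and> V \<subseteq> U \<and> f \<in> kreg X U \<longrightarrow> f \<in> kreg X V) \<and>
     (\<forall>U f. openin (ktop X) U \<and>
        (\<forall>x\<in>U. \<exists>V. openin (ktop X) V \<and> x \<in> V \<and> V \<subseteq> U \<and> f \<in> kreg X V) \<longrightarrow> f \<in> kreg X U)"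

definition kmorphism ::
  "('p, 'k::field) kspace \<Rightarrow> ('q, 'k) kspace \<Rightarrow> ('p \<Rightarrow> 'q) \<Rightarrow> bool" where
  "kmorphism X Y \<phi> \<longleftrightarrow> continuous_map (ktop X) (ktop Y) \<phi> \<and>
     (\<forall>V f. openin (ktop Y) V \<and> f \<in> kreg Y V \<longrightarrow> f \<circ> \<phi> \<in> kreg X {x \<in> kpoints X. \<phi> x \<in> V})"

definition kisomorphic :: "('p, 'k::field) kspace \<Rightarrow> ('q, 'k) kspace \<Rightarrow> bool" where
  "kisomorphic X Y \<longleftrightarrow> (\<exists>\<phi> \<psi>. kmorphism X Y \<phi> \<and> kmorphism Y X \<psi> \<and>
     (\<forall>x\<in>kpoints X. \<psi> (\<phi> x) = x) \<and> (\<forall>y\<in>kpoints Y. \<phi> (\<psi> y) = y))"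

text \<open>
  The structure induced on a subset: regular functions are locally restrictions of regular
  functions of the ambient space. On an open subset this is the open subvariety, on a closed
  subset the reduced closed subvariety.
\<close>

definition ksub :: "('p, 'k::field) kspace \<Rightarrow> 'p set \<Rightarrow> ('p, 'k) kspace" where
  "ksub X S = \<lparr> ktop = subtopology (ktop X) S,
     kreg = (\<lambda>U. {f. \<forall>x\<in>U. \<exists>V g. openin (ktop X) V \<and> x \<in> V \<and> g \<in> kreg X V \<and>
                        (\<forall>y\<in>U \<inter> V. f y = g y)}) \<rparr>"

text \<open>
  Affine space with coordinates indexed by \<open>I\<close>; its points are the vectors supported on \<open>I\<close>.
  Polynomials may involve variables outside \<open>I\<close>, which evaluate to zero.
\<close>

definition affine_points :: "'i set \<Rightarrow> ('i \<Rightarrow> 'k::field alg_closure) set" where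
  "affine_points I = {x. \<forall>i. i \<notin> I \<longrightarrow> x i = 0}"

definition affine_top :: "'k::field itself \<Rightarrow> 'i set \<Rightarrow> ('i \<Rightarrow> 'k alg_closure) topology" where
  "affine_top _ I = topology_generated_by
     (range (\<lambda>p :: ('i, 'k) mpoly. {x \<in> affine_points I. mpoly_eval p x \<noteq> 0}))"

definition affine_space :: "'i set \<Rightarrow> ('i \<Rightarrow> 'k::field alg_closure, 'k) kspace" where
  "affine_space I = \<lparr> ktop = affine_top TYPE('k) I,
     kreg = (\<lambda>U. {f. \<forall>x\<in>U. \<exists>V (p :: ('i, 'k) mpoly) q.
        openin (affine_top TYPE('k) I) V \<and> x \<in> V \<and> V \<subseteq> U \<and>
        (\<forall>y\<in>V. mpoly_eval q y \<noteq> 0 \<and> f y = mpoly_eval p y / mpoly_eval q y)}) \<rparr>"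

definition affine_variety :: "('p, 'k::field) kspace \<Rightarrow> bool" where
  "affine_variety X \<longleftrightarrow> (\<exists>(n::nat) Z.
     closedin (ktop (affine_space {..<n} :: (nat \<Rightarrow> 'k alg_closure, 'k) kspace)) Z \<and>
     kisomorphic X (ksub (affine_space {..<n}) Z))"

definition prevariety :: "('p, 'k::field) kspace \<Rightarrow> bool" where
  "prevariety X \<longleftrightarrow> function_sheaf X \<and>
     (\<exists>\<U>. finite \<U> \<and> \<Union>\<U> = kpoints X \<and>
        (\<forall>U\<in>\<U>. openin (ktop X) U \<and> affine_variety (ksub X U)))"

text \<open>
  The universal quantifications over prevarieties below range over point type
  \<^typ>\<open>nat \<Rightarrow> 'k alg_closure\<close>. As a prevariety is covered by finitely many affine varieties,
  it is isomorphic to one with this type of points, whatever its own type of points.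
  Separatedness is Mumford's Hausdorff axiom: the locus where two morphisms agree is closed.
\<close>

definition separated :: "('p, 'k::field) kspace \<Rightarrow> bool" where
  "separated X \<longleftrightarrow> (\<forall>(T :: (nat \<Rightarrow> 'k alg_closure, 'k) kspace) \<phi> \<psi>.
     prevariety T \<and> kmorphism T X \<phi> \<and> kmorphism T X \<psi> \<longrightarrow>
     closedin (ktop T) {t \<in> kpoints T. \<phi> t = \<psi> t})"

definition is_variety :: "('p, 'k::field) kspace \<Rightarrow> bool" where
  "is_variety X \<longleftrightarrow> prevariety X \<and> separated X"

definition is_product ::
  "('p, 'k::field) kspace \<Rightarrow> ('q, 'k) kspace \<Rightarrow> ('r, 'k) kspace \<Rightarrow> bool" where
  "is_product P X Y \<longleftrightarrow> (\<exists>\<pi>\<^sub>1 \<pi>\<^sub>2. kmorphism P X \<pi>\<^sub>1 \<and> kmorphism P Y \<pi>\<^sub>2 \<and>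
     (\<forall>(T :: (nat \<Rightarrow> 'k alg_closure, 'k) kspace) \<alpha> \<beta>.
        prevariety T \<and> kmorphism T X \<alpha> \<and> kmorphism T Y \<beta> \<longrightarrow>
        (\<exists>\<phi>. kmorphism T P \<phi> \<and> (\<forall>t\<in>kpoints T. \<pi>\<^sub>1 (\<phi> t) = \<alpha> t \<and> \<pi>\<^sub>2 (\<phi> t) = \<beta> t)) \<and>
        (\<forall>\<phi> \<phi>'. kmorphism T P \<phi> \<and> kmorphism T P \<phi>' \<and>
            (\<forall>t\<in>kpoints T. \<pi>\<^sub>1 (\<phi> t) = \<alpha> t \<and> \<pi>\<^sub>2 (\<phi> t) = \<beta> t) \<and>
            (\<forall>t\<in>kpoints T. \<pi>\<^sub>1 (\<phi>' t) = \<alpha> t \<and> \<pi>\<^sub>2 (\<phi>' t) = \<beta> t) \<longrightarrow>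
            (\<forall>t\<in>kpoints T. \<phi> t = \<phi>' t))))"


section \<open>The Grothendieck ring of varieties\<close>

lemma is_variety_empty:
  "is_variety (\<lparr> ktop = discrete_topology {}, kreg = (\<lambda>_. UNIV) \<rparr> :: ('p, 'k::field) kspace)"
proof -
  let ?X = "\<lparr> ktop = discrete_topology {}, kreg = (\<lambda>_. UNIV) \<rparr> :: ('p, 'k) kspace"
  have "prevariety ?X"
    unfolding prevariety_def function_sheaf_def by (auto intro!: exI[of _ "{}"])
  moreover have "separated ?X"
    unfolding separated_def
  proof (intro allI impI, elim conjE)
    fix T :: "(nat \<Rightarrow> 'k alg_closure, 'k) kspace" and \<phi> \<psi>
    assume "kmorphism T ?X \<phi>"
    then have "\<phi> \<in> kpoints T \<rightarrow> {}"
      using continuous_map_funspace[of "ktop T" "ktop ?X" \<phi>] by (simp add: kmorphism_def)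
    then have "kpoints T = {}"
      by blast
    then have "{t \<in> kpoints T. \<phi> t = \<psi> t} = {}"
      by blast
    then show "closedin (ktop T) {t \<in> kpoints T. \<phi> t = \<psi> t}"
      by (simp only: closedin_empty)
  qed
  ultimately show ?thesis
    by (simp add: is_variety_def)
qed

typedef (overloaded) 'k::field variety =
  "{X :: (nat \<Rightarrow> 'k alg_closure, 'k) kspace. is_variety X}"
  using is_variety_empty by blast

text \<open>
  The Grothendieck ring is presented as the commutative ring generated by symbols of varieties,
  that is, as a quotient of the polynomial ring over the integers with one variable for each
  variety, by the ideal of isomorphism, scissor and product relations; its unit is the class of
  a point.
\<close>

definition variety_symbol :: "'k::field variety \<Rightarrow> ('k variety, int) mpoly" where
  "variety_symbol X = Poly_Mapping.single (Poly_Mapping.single X 1) 1"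

definition iso_relations :: "('k::field variety, int) mpoly set" where
  "iso_relations = {variety_symbol X - variety_symbol Y | X Y.
     kisomorphic (Rep_variety X) (Rep_variety Y)}"

definition scissor_relations :: "('k::field variety, int) mpoly set" where
  "scissor_relations = {variety_symbol X - (variety_symbol Z + variety_symbol U) | X Z U.
     \<exists>C. closedin (ktop (Rep_variety X)) C \<and>
         kisomorphic (Rep_variety Z) (ksub (Rep_variety X) C) \<and>
         kisomorphic (Rep_variety U) (ksub (Rep_variety X) (kpoints (Rep_variety X) - C))}"

definition product_relations :: "('k::field variety, int) mpoly set" where
  "product_relations = {variety_symbol P - variety_symbol X * variety_symbol Y | P X Y.
     is_product (Rep_variety P) (Rep_variety X) (Rep_variety Y)}"

definition unit_relations :: "('k::field variety, int) mpoly set" where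
  "unit_relations = {variety_symbol X - 1 | X.
     kisomorphic (Rep_variety X) (affine_space ({} :: nat set))}"

lemma module_mult: "Modules.module ((*) :: 'r::comm_ring_1 \<Rightarrow> 'r \<Rightarrow> 'r)"
  by standard (simp_all add: algebra_simps)

lemmas ideal_span_zero = Modules.module.span_zero[OF module_mult]
lemmas ideal_span_add = Modules.module.span_add[OF module_mult]
lemmas ideal_span_diff = Modules.module.span_diff[OF module_mult]
lemmas ideal_span_neg = Modules.module.span_neg[OF module_mult]
lemmas ideal_span_scale = Modules.module.span_scale[OF module_mult]

definition K0_ideal :: "('k::field variety, int) mpoly set" where
  "K0_ideal = Modules.module.span (*)
     (iso_relations \<union> scissor_relations \<union> product_relations \<union> unit_relations)"

definition K0_rel :: "('k::field variety, int) mpoly \<Rightarrow> ('k variety, int) mpoly \<Rightarrow> bool" where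
  "K0_rel p q \<longleftrightarrow> p - q \<in> K0_ideal"

lemma equivp_K0_rel: "equivp K0_rel"
proof (intro equivpI reflpI sympI transpI)
  fix p q r :: "('k::field variety, int) mpoly"
  show "K0_rel p p"
    by (simp add: K0_rel_def K0_ideal_def ideal_span_zero)
  show "K0_rel q p" if "K0_rel p q"
    using that ideal_span_neg[of "p - q"] by (simp add: K0_rel_def K0_ideal_def)
  show "K0_rel p r" if "K0_rel p q" "K0_rel q r"
    using that ideal_span_add[of "p - q" _ "q - r"] by (simp add: K0_rel_def K0_ideal_def)
qed

quotient_type (overloaded) 'k K0 = "('k::field variety, int) mpoly" / K0_rel
  by (rule equivp_K0_rel)

lemma K0_rel_refl: "K0_rel p p"
  by (rule equivp_reflp[OF equivp_K0_rel])

instantiation K0 :: (field) "{comm_ring, comm_monoid_mult}"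
begin

lift_definition zero_K0 :: "'a K0" is 0 .
lift_definition one_K0 :: "'a K0" is 1 .
lift_definition plus_K0 :: "'a K0 \<Rightarrow> 'a K0 \<Rightarrow> 'a K0" is "(+)"
proof -
  fix p p' q q' :: "('a variety, int) mpoly"
  assume "K0_rel p p'" "K0_rel q q'"
  moreover have "p + q - (p' + q') = (p - p') + (q - q')"
    by simp
  ultimately show "K0_rel (p + q) (p' + q')"
    by (simp only: K0_rel_def K0_ideal_def ideal_span_add)
qed
lift_definition uminus_K0 :: "'a K0 \<Rightarrow> 'a K0" is uminus
proof -
  fix p p' :: "('a variety, int) mpoly"
  assume "K0_rel p p'"
  moreover have "- p - - p' = - (p - p')"
    by simp
  ultimately show "K0_rel (- p) (- p')"
    by (simp only: K0_rel_def K0_ideal_def ideal_span_neg)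
qed
lift_definition minus_K0 :: "'a K0 \<Rightarrow> 'a K0 \<Rightarrow> 'a K0" is "(-)"
proof -
  fix p p' q q' :: "('a variety, int) mpoly"
  assume "K0_rel p p'" "K0_rel q q'"
  moreover have "p - q - (p' - q') = (p - p') - (q - q')"
    by simp
  ultimately show "K0_rel (p - q) (p' - q')"
    by (simp only: K0_rel_def K0_ideal_def ideal_span_diff)
qed
lift_definition times_K0 :: "'a K0 \<Rightarrow> 'a K0 \<Rightarrow> 'a K0" is "(*)"
proof -
  fix p p' q q' :: "('a variety, int) mpoly"
  assume "K0_rel p p'" "K0_rel q q'"
  moreover have "p * q - p' * q' = q * (p - p') + p' * (q - q')"
    by (simp add: algebra_simps)
  ultimately show "K0_rel (p * q) (p' * q')"
    by (simp only: K0_rel_def K0_ideal_def ideal_span_add ideal_span_scale)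
qed

instance
proof
  fix a b c :: "'a K0"
  show "a + b + c = a + (b + c)"
    by transfer (simp only: add.assoc K0_rel_refl)
  show "a + b = b + a"
    by transfer (subst add.commute, rule K0_rel_refl)
  show "0 + a = a"
    by transfer (simp only: add_0_left K0_rel_refl)
  show "- a + a = 0"
    by transfer (simp only: left_minus K0_rel_refl)
  show "a - b = a + - b"
    by transfer (simp only: diff_conv_add_uminus K0_rel_refl)
  show "a * b * c = a * (b * c)"
    by transfer (simp only: mult.assoc K0_rel_refl)
  show "a * b = b * a"
    by transfer (subst mult.commute, rule K0_rel_refl)
  show "(a + b) * c = a * c + b * c"
    by transfer (simp only: distrib_right K0_rel_refl)
  show "1 * a = a"
    by transfer (simp only: mult_1_left K0_rel_refl)
qed

end

lift_definition variety_class :: "'k::field variety \<Rightarrow> 'k K0" is variety_symbol .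

text \<open>
  The points of \<open>X\<close> may have any type, in contrast to those of the generators; the class of
  a structure that is not a variety is meaningless.
\<close>

definition K0_class :: "('p, 'k::field) kspace \<Rightarrow> 'k K0" where
  "K0_class X = variety_class (SOME v. kisomorphic X (Rep_variety v))"

definition G_m :: "(nat \<Rightarrow> 'k::field alg_closure, 'k) kspace" where
  "G_m = ksub (affine_space {0}) {x. x 0 \<noteq> 0}"

definition torus_class :: "'k::field K0" where
  "torus_class = K0_class G_m"

definition cong_mod_torus :: "'k::field K0 \<Rightarrow> 'k K0 \<Rightarrow> bool" where
  "cong_mod_torus a b \<longleftrightarrow> a - b \<in> {torus_class * c | c. True}"


section \<open>Projective space\<close>

text \<open>
  The projective space of lines in the vector space with basis \<open>I\<close>; a line is represented by
  the set of its non-zero vectors.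
\<close>

definition proj_points :: "'i set \<Rightarrow> ('i \<Rightarrow> 'k::field alg_closure) set set" where
  "proj_points I = {{(\<lambda>i. c * x i) | c. c \<noteq> 0} | x. x \<in> affine_points I \<and> x \<noteq> 0}"

definition proj_zeros :: "'i set \<Rightarrow> ('i, 'k::field) mpoly \<Rightarrow> ('i \<Rightarrow> 'k alg_closure) set set" where
  "proj_zeros I p = {L \<in> proj_points I. \<forall>x\<in>L. mpoly_eval p x = 0}"

definition proj_top :: "'k::field itself \<Rightarrow> 'i set \<Rightarrow> ('i \<Rightarrow> 'k alg_closure) set topology" where
  "proj_top _ I = topology_generated_by
     {proj_points I - proj_zeros I p | p :: ('i, 'k) mpoly. \<exists>d. homogeneous d p}"

definition proj_space :: "'i set \<Rightarrow> (('i \<Rightarrow> 'k::field alg_closure) set, 'k) kspace" where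
  "proj_space I = \<lparr> ktop = proj_top TYPE('k) I,
     kreg = (\<lambda>U. {f. \<forall>L\<in>U. \<exists>V (p :: ('i, 'k) mpoly) q d.
        openin (proj_top TYPE('k) I) V \<and> L \<in> V \<and> V \<subseteq> U \<and> homogeneous d p \<and> homogeneous d q \<and>
        (\<forall>M\<in>V. \<forall>y\<in>M. mpoly_eval q y \<noteq> 0 \<and> f M = mpoly_eval p y / mpoly_eval q y)}) \<rparr>"


section \<open>Matroids\<close>

text \<open>A matroid, given by its ground set and its independent sets.\<close>

type_synonym 'e matroid = "'e set \<times> ('e set \<Rightarrow> bool)"

definition mat_rank :: "'e matroid \<Rightarrow> 'e set \<Rightarrow> nat" where
  "mat_rank M S = Max (card ` {I. I \<subseteq> S \<inter> fst M \<and> snd M I})"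

definition mat_closure :: "'e matroid \<Rightarrow> 'e set \<Rightarrow> 'e set" where
  "mat_closure M S = {e \<in> fst M. mat_rank M (insert e S) = mat_rank M S}"

definition mat_restrict :: "'e matroid \<Rightarrow> 'e set \<Rightarrow> 'e matroid" where
  "mat_restrict M S = (S, \<lambda>I. I \<subseteq> S \<and> snd M I)"

definition mat_loopless :: "'e matroid \<Rightarrow> bool" where
  "mat_loopless M \<longleftrightarrow> (\<forall>e\<in>fst M. snd M {e})"

text \<open>A matroid is connected if it is not a direct sum of matroids on non-empty ground sets.\<close>

definition mat_connected :: "'e matroid \<Rightarrow> bool" where
  "mat_connected M \<longleftrightarrow> \<not> (\<exists>A B. A \<noteq> {} \<and> B \<noteq> {} \<and> A \<inter> B = {} \<and> A \<union> B = fst M \<and>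
     (\<forall>I\<subseteq>fst M. snd M I \<longleftrightarrow> snd M (I \<inter> A) \<and> snd M (I \<inter> B)))"


section \<open>Configurations\<close>

definition fun_scale :: "'k::field \<Rightarrow> ('e \<Rightarrow> 'k) \<Rightarrow> 'e \<Rightarrow> 'k" where
  "fun_scale c v = (\<lambda>e. c * v e)"

interpretation fun_space: vector_space "fun_scale :: 'k::field \<Rightarrow> ('e \<Rightarrow> 'k) \<Rightarrow> 'e \<Rightarrow> 'k"
  by unfold_locales
    (simp_all only: fun_scale_def fun_eq_iff plus_fun_def distrib_left distrib_right mult.assoc
      mult_1_left simp_thms)

text \<open>
  The space \<open>K\<^sup>S\<close> consists of the functions that vanish outside \<open>S\<close>, so that the
  coordinate projection to \<open>K\<^sup>S\<close> sets the coordinates outside \<open>S\<close> to zero.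
\<close>

definition configuration :: "'e set \<Rightarrow> ('e \<Rightarrow> 'k::field) set \<Rightarrow> bool" where
  "configuration E W \<longleftrightarrow> fun_space.subspace W \<and> W \<subseteq> {v. \<forall>e. e \<notin> E \<longrightarrow> v e = 0}"

definition config_restrict :: "('e \<Rightarrow> 'k::field) set \<Rightarrow> 'e set \<Rightarrow> ('e \<Rightarrow> 'k) set" where
  "config_restrict W S = (\<lambda>w e. if e \<in> S then w e else 0) ` W"

text \<open>A set is independent if its coordinate functions are linearly independent on \<open>W\<close>.\<close>

definition config_matroid :: "'e set \<Rightarrow> ('e \<Rightarrow> 'k::field) set \<Rightarrow> 'e matroid" where
  "config_matroid E W = (E, \<lambda>I. I \<subseteq> E \<and>
     (\<forall>c. (\<forall>w\<in>W. (\<Sum>e\<in>I. c e * w e) = 0) \<longrightarrow> (\<forall>e\<in>I. c e = 0)))"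

definition config_basis :: "('e \<Rightarrow> 'k::field) set \<Rightarrow> ('e \<Rightarrow> 'k) list \<Rightarrow> bool" where
  "config_basis W bs \<longleftrightarrow>
     distinct bs \<and> fun_space.independent (set bs) \<and> fun_space.span (set bs) = W"

text \<open>The matrix of \<open>Q\<^sub>W\<close>; the polynomial \<open>single (single e 1) a\<close> is \<open>a \<cdot> x\<^sub>e\<close>.\<close>

definition config_form :: "'e set \<Rightarrow> ('e \<Rightarrow> 'k::field) list \<Rightarrow> ('e, 'k) mpoly mat" where
  "config_form E bs = mat (length bs) (length bs) (\<lambda>(i, j).
     \<Sum>e\<in>E. Poly_Mapping.single (Poly_Mapping.single e 1) ((bs ! i) e * (bs ! j) e))"

text \<open>Another choice of basis changes the configuration polynomial by a factor in \<open>K\<^sup>*\<close>.\<close>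

definition config_poly :: "'e set \<Rightarrow> ('e \<Rightarrow> 'k::field) set \<Rightarrow> ('e, 'k) mpoly" where
  "config_poly E W = det (config_form E (SOME bs. config_basis W bs))"

definition config_hypersurface ::
  "'e set \<Rightarrow> ('e \<Rightarrow> 'k::field) set \<Rightarrow> ('e \<Rightarrow> 'k alg_closure) set set" where
  "config_hypersurface E W = proj_zeros E (config_poly E W)"

definition torus_orbit :: "'e set \<Rightarrow> ('e \<Rightarrow> 'k::field alg_closure) set set" where
  "torus_orbit E = {L \<in> proj_points E. \<forall>x\<in>L. \<forall>e\<in>E. x e \<noteq> 0}"

definition Y_compl ::
  "'e set \<Rightarrow> ('e \<Rightarrow> 'k::field) set \<Rightarrow> (('e \<Rightarrow> 'k alg_closure) set, 'k) kspace" where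
  "Y_compl E W = ksub (proj_space E) (proj_points E - config_hypersurface E W)"

definition Y_torus ::
  "'e set \<Rightarrow> ('e \<Rightarrow> 'k::field) set \<Rightarrow> (('e \<Rightarrow> 'k alg_closure) set, 'k) kspace" where
  "Y_torus E W =
     ksub (proj_space E) ((proj_points E - config_hypersurface E W) \<inter> torus_orbit E)"

end

theory Submission
  imports Defs
begin

text \<open>
  Let \<open>\<psi>\<close> be the configuration polynomial of \<open>W\<close>. The projective space of \<open>K\<^sup>E\<close> is the disjoint union of
  the torus orbits \<open>O\<^sub>S\<close> of the coordinate subspaces \<open>K\<^sup>S\<close>, and this cuts \<open>Y\<^sub>W\<close> into locally closed
  pieces. On \<open>K\<^sup>S\<close> the form \<open>Q\<^sub>W\<close> only sees the restriction of \<open>W\<close> to \<open>S\<close>. If \<open>S\<close> spans the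
  matroid, then \<open>W\<close> restricts isomorphically and \<open>\<psi>\<close> becomes the configuration polynomial of the
  restriction, so the piece is the torus part of that smaller configuration; otherwise a non-zero
  vector of \<open>W\<close> vanishes on \<open>S\<close>, the form is degenerate and the piece is empty. This gives the
  identity for \<open>[Y\<^sub>W]\<close>, with the lemmas \<open>K0_class_proj_compl_strata\<close>, \<open>config_poly_restrict_spanning\<close>,
  \<open>config_poly_restrict_nonspanning\<close> and \<open>mat_closure_spanning\<close>.

  For its reduction modulo the torus class it suffices that the torus part is a multiple of the
  class of \<open>G\<^sub>m\<close> when the matroid is disconnected. A decomposition \<open>E = A \<union> B\<close> of the matroid splits \<open>W\<close> into vectors supported on \<open>A\<close>
  and vectors supported on \<open>B\<close> (\<open>config_split_summand\<close>), so that multiplying the coordinates in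
  \<open>B\<close> by \<open>t \<noteq> 0\<close> multiplies rows of the matrix of \<open>Q\<^sub>W\<close> by \<open>t\<close> and preserves the condition \<open>\<psi> \<noteq> 0\<close>
  (\<open>config_poly_scale_summand\<close>). Normalising one coordinate in \<open>A\<close> and one in \<open>B\<close> to \<open>1\<close> then
  exhibits the torus part as a product with \<open>G\<^sub>m\<close> (\<open>K0_class_torus_factor\<close>).

  For the last congruence, Moebius inversion of the identity over the spanning sets expresses the
  torus part by the classes \<open>[Y]\<close> of all spanning restrictions with signs. The disconnected ones
  vanish modulo the torus class: in a loopless disconnected matroid both summands have positive
  rank, so every spanning set meets both and has a disconnected restriction, and the identity writes
  the class as a sum of multiples of the torus class.

  The geometric part of the file establishes that all these spaces are varieties, so that the
  relations of the Grothendieck ring apply to them. Its basic notion is \<open>regular_space\<close>: for such a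
  space, a map to affine or projective space is a morphism as soon as it is given by regular
  coordinates. Every prevariety is of this kind (\<open>prevariety_regular\<close>), which makes the universal
  property of products and separatedness accessible by formulas in coordinates.
\<close>

section \<open>Evaluation and homogeneity of polynomials\<close>

definition monomial_value :: "('i \<Rightarrow>\<^sub>0 nat) \<Rightarrow> ('i \<Rightarrow> 'a::comm_semiring_1) \<Rightarrow> 'a" where
  "monomial_value m x = (\<Prod>i\<in>Poly_Mapping.keys m. x i ^ Poly_Mapping.lookup m i)"

definition monomial_degree :: "('i \<Rightarrow>\<^sub>0 nat) \<Rightarrow> nat" where
  "monomial_degree m = (\<Sum>i\<in>Poly_Mapping.keys m. Poly_Mapping.lookup m i)"

definition mvar :: "'i \<Rightarrow> ('i, 'k::field) mpoly" where
  "mvar i = Poly_Mapping.single (Poly_Mapping.single i 1) 1"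

definition mconst :: "'k \<Rightarrow> ('i, 'k::field) mpoly" where
  "mconst c = Poly_Mapping.single 0 c"

lemma monomial_value_superset:
  assumes "finite A" "Poly_Mapping.keys m \<subseteq> A"
  shows "monomial_value m x = (\<Prod>i\<in>A. x i ^ Poly_Mapping.lookup m i)"
  unfolding monomial_value_def
  by (rule prod.mono_neutral_left) (use assms in \<open>auto simp: in_keys_iff\<close>)

lemma monomial_degree_superset:
  assumes "finite A" "Poly_Mapping.keys m \<subseteq> A"
  shows "monomial_degree m = (\<Sum>i\<in>A. Poly_Mapping.lookup m i)"
  unfolding monomial_degree_def
  by (rule sum.mono_neutral_left) (use assms in \<open>auto simp: in_keys_iff\<close>)

lemma monomial_value_add: "monomial_value (m + n) x = monomial_value m x * monomial_value n x"
proof -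
  let ?A = "Poly_Mapping.keys m \<union> Poly_Mapping.keys n"
  have "Poly_Mapping.keys (m + n) \<subseteq> ?A"
    by (rule Poly_Mapping.keys_add)
  then show ?thesis
    by (simp add: monomial_value_superset[of ?A] lookup_add power_add prod.distrib)
qed

lemma monomial_degree_add: "monomial_degree (m + n) = monomial_degree m + monomial_degree n"
proof -
  let ?A = "Poly_Mapping.keys m \<union> Poly_Mapping.keys n"
  have "Poly_Mapping.keys (m + n) \<subseteq> ?A"
    by (rule Poly_Mapping.keys_add)
  then show ?thesis
    by (simp add: monomial_degree_superset[of ?A] lookup_add sum.distrib)
qed

lemma poly_mapping_sum_single:
  "p = (\<Sum>m\<in>Poly_Mapping.keys p. Poly_Mapping.single m (Poly_Mapping.lookup p m))"
proof (rule poly_mapping_eqI)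
  fix k
  show "Poly_Mapping.lookup p k =
    Poly_Mapping.lookup (\<Sum>m\<in>Poly_Mapping.keys p. Poly_Mapping.single m (Poly_Mapping.lookup p m)) k"
    by (simp add: lookup_sum lookup_single when_def in_keys_iff sum.delta)
qed

lemma mpoly_eval_superset:
  assumes "finite A" "Poly_Mapping.keys p \<subseteq> A"
  shows "mpoly_eval p x = (\<Sum>m\<in>A. to_ac (Poly_Mapping.lookup p m) * monomial_value m x)"
  unfolding mpoly_eval_def monomial_value_def
  by (rule sum.mono_neutral_left) (use assms in \<open>auto simp: in_keys_iff\<close>)

lemma mpoly_eval_zero [simp]: "mpoly_eval 0 x = 0"
  by (simp add: mpoly_eval_def)

lemma mpoly_eval_single [simp]:
  "mpoly_eval (Poly_Mapping.single m c) x = to_ac c * monomial_value m x"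
  using mpoly_eval_superset[of "{m}" "Poly_Mapping.single m c" x] by simp

lemma mpoly_eval_add [simp]: "mpoly_eval (p + q) x = mpoly_eval p x + mpoly_eval q x"
proof -
  let ?A = "Poly_Mapping.keys p \<union> Poly_Mapping.keys q"
  have "Poly_Mapping.keys (p + q) \<subseteq> ?A"
    by (rule Poly_Mapping.keys_add)
  then show ?thesis
    by (simp add: mpoly_eval_superset[of ?A] lookup_add distrib_right sum.distrib)
qed

lemma mpoly_eval_uminus [simp]: "mpoly_eval (- p) x = - mpoly_eval p x"
  using mpoly_eval_add[of p "- p" x] by (simp add: eq_neg_iff_add_eq_0 add.commute)

lemma mpoly_eval_diff [simp]: "mpoly_eval (p - q) x = mpoly_eval p x - mpoly_eval q x"
  using mpoly_eval_add[of p "- q" x] by simp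

lemma mpoly_eval_sum [simp]: "mpoly_eval (\<Sum>a\<in>A. f a) x = (\<Sum>a\<in>A. mpoly_eval (f a) x)"
  by (induction A rule: infinite_finite_induct) simp_all

lemma mpoly_eval_mult [simp]: "mpoly_eval (p * q) x = mpoly_eval p x * mpoly_eval q x"
proof -
  have "p * q = (\<Sum>m\<in>Poly_Mapping.keys p. \<Sum>n\<in>Poly_Mapping.keys q.
      Poly_Mapping.single (m + n) (Poly_Mapping.lookup p m * Poly_Mapping.lookup q n))"
    by (subst (1) poly_mapping_sum_single[of p], subst (1) poly_mapping_sum_single[of q])
       (simp add: sum_product mult_single)
  then have "mpoly_eval (p * q) x = (\<Sum>m\<in>Poly_Mapping.keys p. \<Sum>n\<in>Poly_Mapping.keys q.
      (to_ac (Poly_Mapping.lookup p m) * monomial_value m x) *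
      (to_ac (Poly_Mapping.lookup q n) * monomial_value n x))"
    by (simp add: monomial_value_add mult_ac)
  also have "\<dots> = mpoly_eval p x * mpoly_eval q x"
    by (simp add: sum_product mpoly_eval_superset[OF finite_keys order_refl])
  finally show ?thesis .
qed

lemma mpoly_eval_one [simp]: "mpoly_eval 1 x = 1"
  using mpoly_eval_single[of 0 1 x] by (simp add: monomial_value_def)

lemma mpoly_eval_prod [simp]: "mpoly_eval (\<Prod>a\<in>A. f a) x = (\<Prod>a\<in>A. mpoly_eval (f a) x)"
  by (induction A rule: infinite_finite_induct) simp_all

lemma mpoly_eval_mvar [simp]: "mpoly_eval (mvar i) x = x i"
  by (simp add: mvar_def monomial_value_def)

lemma mpoly_eval_mconst [simp]: "mpoly_eval (mconst c) x = to_ac c"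
  by (simp add: mconst_def monomial_value_def)

lemma homogeneous_monomial_degree:
  "homogeneous d p \<longleftrightarrow> (\<forall>m\<in>Poly_Mapping.keys p. monomial_degree m = d)"
  by (simp add: homogeneous_def monomial_degree_def)

lemma homogeneous_zero [simp]: "homogeneous d 0"
  by (simp add: homogeneous_def)

lemma homogeneous_mconst [simp]: "homogeneous 0 (mconst c)"
  by (simp add: homogeneous_def mconst_def)

lemma homogeneous_one [simp]: "homogeneous 0 (1 :: ('i, 'k::field) mpoly)"
  by (simp add: homogeneous_def)

lemma homogeneous_mvar [simp]: "homogeneous (Suc 0) (mvar i)"
  by (simp add: homogeneous_def mvar_def)

lemma homogeneous_add: "homogeneous d p \<Longrightarrow> homogeneous d q \<Longrightarrow> homogeneous d (p + q)"
  using Poly_Mapping.keys_add[of p q] by (auto simp: homogeneous_def)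

lemma homogeneous_uminus:
  fixes p :: "('i, 'k::field) mpoly"
  shows "homogeneous d p \<Longrightarrow> homogeneous d (- p)"
  by (simp add: homogeneous_def in_keys_iff)

lemma homogeneous_sum: "(\<And>a. a \<in> A \<Longrightarrow> homogeneous d (f a)) \<Longrightarrow> homogeneous d (\<Sum>a\<in>A. f a)"
  by (induction A rule: infinite_finite_induct) (auto intro: homogeneous_add)

lemma homogeneous_mult:
  fixes p q :: "('i, 'k::field) mpoly"
  shows "homogeneous d p \<Longrightarrow> homogeneous e q \<Longrightarrow> homogeneous (d + e) (p * q)"
  using keys_mult[of p q] unfolding homogeneous_monomial_degree
  by (fastforce simp: monomial_degree_add)

lemma homogeneous_prod:
  fixes f :: "'a \<Rightarrow> ('i, 'k::field) mpoly"
  shows "(\<And>a. a \<in> A \<Longrightarrow> homogeneous (d a) (f a)) \<Longrightarrow>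
    homogeneous (\<Sum>a\<in>A. d a) (\<Prod>a\<in>A. f a)"
  by (induction A rule: infinite_finite_induct) (auto intro: homogeneous_mult)

lemma monomial_value_scale:
  "monomial_value m (\<lambda>i. c * x i) = c ^ monomial_degree m * monomial_value m x"
  by (simp add: monomial_value_def monomial_degree_def power_mult_distrib prod.distrib power_sum)

lemma homogeneous_eval_scale:
  assumes "homogeneous d p"
  shows "mpoly_eval p (\<lambda>i. c * x i) = c ^ d * mpoly_eval p x"
  using assms unfolding homogeneous_monomial_degree
  by (simp add: mpoly_eval_superset[OF finite_keys order_refl] monomial_value_scale
      sum_distrib_left mult_ac)

section \<open>Spaces with regular functions\<close>

lemma function_sheaf_cong:
  assumes "function_sheaf X" "openin (ktop X) U" "f \<in> kreg X U" "\<And>x. x \<in> U \<Longrightarrow> g x = f x"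
  shows "g \<in> kreg X U"
proof -
  have "\<forall>U f g. openin (ktop X) U \<and> f \<in> kreg X U \<and> (\<forall>x\<in>U. g x = f x) \<longrightarrow> g \<in> kreg X U"
    using assms(1) unfolding function_sheaf_def by (rule conjunct1)
  then show ?thesis
    using assms(2-4) by metis
qed

lemma function_sheaf_restrict:
  assumes "function_sheaf X" "openin (ktop X) U" "f \<in> kreg X U" "openin (ktop X) V" "V \<subseteq> U"
  shows "f \<in> kreg X V"
proof -
  have "\<forall>U V f. openin (ktop X) U \<and> openin (ktop X) V \<and> V \<subseteq> U \<and> f \<in> kreg X U \<longrightarrow> f \<in> kreg X V"
    using assms(1) unfolding function_sheaf_def by (elim conjE)
  then show ?thesis
    using assms(2-5) by metis
qed

lemma function_sheaf_glue:
  assumes "function_sheaf X" "openin (ktop X) U"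
    "\<And>x. x \<in> U \<Longrightarrow> \<exists>V. openin (ktop X) V \<and> x \<in> V \<and> V \<subseteq> U \<and> f \<in> kreg X V"
  shows "f \<in> kreg X U"
proof -
  have "\<forall>U f. openin (ktop X) U \<and>
        (\<forall>x\<in>U. \<exists>V. openin (ktop X) V \<and> x \<in> V \<and> V \<subseteq> U \<and> f \<in> kreg X V) \<longrightarrow> f \<in> kreg X U"
    using assms(1) unfolding function_sheaf_def by (elim conjE)
  then show ?thesis
    using assms(2,3) by blast
qed

lemma openin_pointwise:
  "(\<And>x. x \<in> U \<Longrightarrow> \<exists>V. openin T V \<and> x \<in> V \<and> V \<subseteq> U) \<Longrightarrow> openin T U"
  by (subst openin_subopen) blast

text \<open>
  Besides the sheaf axioms, the regular functions on open sets form rings in which a function is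
  invertible wherever it has no zero, and zero loci are closed. These are the properties of a
  variety that are needed to substitute regular functions into polynomials and fractions.
\<close>

definition regular_space :: "('p, 'k::field) kspace \<Rightarrow> bool" where
  "regular_space X \<longleftrightarrow> function_sheaf X \<and> (\<forall>U. openin (ktop X) U \<longrightarrow>
     (\<forall>c. (\<lambda>_. to_ac c) \<in> kreg X U) \<and>
     (\<forall>f\<in>kreg X U. \<forall>g\<in>kreg X U. (\<lambda>x. f x + g x) \<in> kreg X U \<and> (\<lambda>x. f x * g x) \<in> kreg X U) \<and>
     (\<forall>f\<in>kreg X U. openin (ktop X) {x \<in> U. f x \<noteq> 0} \<and>
        (\<lambda>x. inverse (f x)) \<in> kreg X {x \<in> U. f x \<noteq> 0}))"

context
  fixes X :: "('p, 'k::field) kspace" and U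
  assumes X: "regular_space X" and U: "openin (ktop X) U"
begin

lemma regular_const: "(\<lambda>_. to_ac c) \<in> kreg X U"
  using X U unfolding regular_space_def by blast

lemma regular_add: "f \<in> kreg X U \<Longrightarrow> g \<in> kreg X U \<Longrightarrow> (\<lambda>x. f x + g x) \<in> kreg X U"
  using X U unfolding regular_space_def by blast

lemma regular_mult: "f \<in> kreg X U \<Longrightarrow> g \<in> kreg X U \<Longrightarrow> (\<lambda>x. f x * g x) \<in> kreg X U"
  using X U unfolding regular_space_def by blast

lemma regular_nonzero_open: "f \<in> kreg X U \<Longrightarrow> openin (ktop X) {x \<in> U. f x \<noteq> 0}"
  using X U unfolding regular_space_def by blast

lemma regular_inverse: "f \<in> kreg X U \<Longrightarrow> (\<lambda>x. inverse (f x)) \<in> kreg X {x \<in> U. f x \<noteq> 0}"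
  using X U unfolding regular_space_def by blast

lemma regular_diff: "f \<in> kreg X U \<Longrightarrow> g \<in> kreg X U \<Longrightarrow> (\<lambda>x. f x - g x) \<in> kreg X U"
  using regular_add[OF _ regular_mult[OF regular_const[of "-1"]], of f g] by simp

lemma regular_sum: "(\<And>a. a \<in> A \<Longrightarrow> f a \<in> kreg X U) \<Longrightarrow> (\<lambda>x. \<Sum>a\<in>A. f a x) \<in> kreg X U"
  using regular_const[of 0]
  by (induction A rule: infinite_finite_induct) (auto intro: regular_add)

lemma regular_prod: "(\<And>a. a \<in> A \<Longrightarrow> f a \<in> kreg X U) \<Longrightarrow> (\<lambda>x. \<Prod>a\<in>A. f a x) \<in> kreg X U"
  using regular_const[of 1]
  by (induction A rule: infinite_finite_induct) (auto intro: regular_mult)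

lemma regular_power: "f \<in> kreg X U \<Longrightarrow> (\<lambda>x. f x ^ n) \<in> kreg X U"
  using regular_const[of 1] by (induction n) (auto intro: regular_mult)

lemma regular_mpoly:
  "(\<And>i. (\<lambda>x. \<phi> x i) \<in> kreg X U) \<Longrightarrow> (\<lambda>x. mpoly_eval p (\<phi> x)) \<in> kreg X U"
  unfolding mpoly_eval_def by (intro regular_sum regular_mult regular_const regular_prod regular_power)

end

lemma regular_divide:
  assumes X: "regular_space X" and U: "openin (ktop X) U" and f: "f \<in> kreg X U" and g: "g \<in> kreg X U"
  shows "(\<lambda>x. f x / g x) \<in> kreg X {x \<in> U. g x \<noteq> 0}"
proof -
  have V: "openin (ktop X) {x \<in> U. g x \<noteq> 0}"
    by (rule regular_nonzero_open[OF X U g])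
  have "f \<in> kreg X {x \<in> U. g x \<noteq> 0}"
    by (rule function_sheaf_restrict[OF _ U f V]) (use X in \<open>auto simp: regular_space_def\<close>)
  from regular_mult[OF X V this regular_inverse[OF X U g]] show ?thesis
    by (simp add: divide_inverse)
qed

section \<open>Spaces whose regular functions are local fractions\<close>

text \<open>
  Affine and projective space have the same description: regular functions are locally fractions
  \<open>n / d\<close> with \<open>(n, d)\<close> in a family \<open>R\<close>, which consists of pairs of polynomials in the affine case and
  of pairs of forms of equal degree, evaluated at a chosen representative, in the projective case.
\<close>

definition fraction_space ::
  "('p, 'k::field) kspace \<Rightarrow> (('p \<Rightarrow> 'k alg_closure) \<times> ('p \<Rightarrow> 'k alg_closure)) set \<Rightarrow> bool" where
  "fraction_space X R \<longleftrightarrow>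
     ktop X = topology_generated_by {{x \<in> kpoints X. n x \<noteq> 0} | n d. (n, d) \<in> R} \<and>
     (\<forall>U. openin (ktop X) U \<longrightarrow> kreg X U = {f. \<forall>x\<in>U. \<exists>V n d. openin (ktop X) V \<and> x \<in> V \<and> V \<subseteq> U \<and>
        (n, d) \<in> R \<and> (\<forall>y\<in>V. d y \<noteq> 0 \<and> f y = n y / d y)}) \<and>
     (\<forall>c. (\<lambda>_. to_ac c, \<lambda>_. 1) \<in> R) \<and>
     (\<forall>n d. (n, d) \<in> R \<longrightarrow> (d, n) \<in> R) \<and>
     (\<forall>n d n' d'. (n, d) \<in> R \<and> (n', d') \<in> R \<longrightarrow>
        (\<lambda>x. n x * d' x + n' x * d x, \<lambda>x. d x * d' x) \<in> R \<and>
        (\<lambda>x. n x * n' x, \<lambda>x. d x * d' x) \<in> R)"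

lemma fraction_spaceI:
  assumes "ktop X = topology_generated_by {{x \<in> kpoints X. n x \<noteq> 0} | n d. (n, d) \<in> R}"
    and "\<And>U. openin (ktop X) U \<Longrightarrow> kreg X U = {f. \<forall>x\<in>U. \<exists>V n d. openin (ktop X) V \<and> x \<in> V \<and> V \<subseteq> U \<and>
        (n, d) \<in> R \<and> (\<forall>y\<in>V. d y \<noteq> 0 \<and> f y = n y / d y)}"
    and "\<And>c. (\<lambda>_. to_ac c, \<lambda>_. 1) \<in> R"
    and "\<And>n d. (n, d) \<in> R \<Longrightarrow> (d, n) \<in> R"
    and "\<And>n d n' d'. (n, d) \<in> R \<Longrightarrow> (n', d') \<in> R \<Longrightarrow> (\<lambda>x. n x * d' x + n' x * d x, \<lambda>x. d x * d' x) \<in> R"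
    and "\<And>n d n' d'. (n, d) \<in> R \<Longrightarrow> (n', d') \<in> R \<Longrightarrow> (\<lambda>x. n x * n' x, \<lambda>x. d x * d' x) \<in> R"
  shows "fraction_space X R"
  unfolding fraction_space_def
  by (intro conjI allI impI; (elim conjE)?;
      (rule assms(1) | erule assms(2) | rule assms(3) | erule assms(4) | erule (1) assms(5) | erule (1) assms(6)))

lemma fraction_space_open:
  assumes "fraction_space X R" "(n, d) \<in> R"
  shows "openin (ktop X) {x \<in> kpoints X. n x \<noteq> 0}"
proof -
  have "ktop X = topology_generated_by {{x \<in> kpoints X. n x \<noteq> 0} | n d. (n, d) \<in> R}"
    using assms(1) unfolding fraction_space_def by simp
  then show ?thesis
    using assms(2) by (metis (mono_tags, lifting) mem_Collect_eq topology_generated_by_Basis)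
qed

lemma fraction_space_kreg:
  assumes "fraction_space X R" "openin (ktop X) U"
  shows "f \<in> kreg X U \<longleftrightarrow> (\<forall>x\<in>U. \<exists>V n d. openin (ktop X) V \<and> x \<in> V \<and> V \<subseteq> U \<and>
        (n, d) \<in> R \<and> (\<forall>y\<in>V. d y \<noteq> 0 \<and> f y = n y / d y))"
proof -
  have "kreg X U = {f. \<forall>x\<in>U. \<exists>V n d. openin (ktop X) V \<and> x \<in> V \<and> V \<subseteq> U \<and>
        (n, d) \<in> R \<and> (\<forall>y\<in>V. d y \<noteq> 0 \<and> f y = n y / d y)}"
    using assms unfolding fraction_space_def by blast
  then show ?thesis
    by simp
qed

lemma fraction_space_locally:
  assumes X: "fraction_space X R" and U: "openin (ktop X) U" and f: "f \<in> kreg X U" and x: "x \<in> U"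
  obtains V n d where "openin (ktop X) V" "x \<in> V" "V \<subseteq> U" "(n, d) \<in> R"
    "\<forall>y\<in>V. d y \<noteq> 0 \<and> f y = n y / d y"
proof -
  have "\<exists>V n d. openin (ktop X) V \<and> x \<in> V \<and> V \<subseteq> U \<and>
        (n, d) \<in> R \<and> (\<forall>y\<in>V. d y \<noteq> 0 \<and> f y = n y / d y)"
    using fraction_space_kreg[OF X U, THEN iffD1, OF f] x by (rule bspec)
  then show thesis
    by (elim exE conjE) (rule that)
qed

lemma fraction_space_kregI_local:
  assumes X: "fraction_space X R" and U: "openin (ktop X) U"
    and loc: "\<And>x. x \<in> U \<Longrightarrow> \<exists>V n d. openin (ktop X) V \<and> x \<in> V \<and> (n, d) \<in> R \<and>
      (\<forall>y\<in>V \<inter> U. d y \<noteq> 0 \<and> f y = n y / d y)"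
  shows "f \<in> kreg X U"
  unfolding fraction_space_kreg[OF X U]
proof
  fix x assume x: "x \<in> U"
  from loc[OF x] obtain V n d where V: "openin (ktop X) V" "x \<in> V" "(n, d) \<in> R"
    "\<forall>y\<in>V \<inter> U. d y \<noteq> 0 \<and> f y = n y / d y"
    by (elim exE conjE)
  then show "\<exists>V n d. openin (ktop X) V \<and> x \<in> V \<and> V \<subseteq> U \<and>
        (n, d) \<in> R \<and> (\<forall>y\<in>V. d y \<noteq> 0 \<and> f y = n y / d y)"
    using U x by (intro exI[of _ "V \<inter> U"] exI[of _ n] exI[of _ d] conjI) auto
qed

lemma fraction_space_kregI:
  assumes "fraction_space X R" "openin (ktop X) U" "(n, d) \<in> R"
    "\<And>y. y \<in> U \<Longrightarrow> d y \<noteq> 0 \<and> f y = n y / d y"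
  shows "f \<in> kreg X U"
  by (rule fraction_space_kregI_local[OF assms(1,2)])
     (use assms(2-4) in \<open>intro exI[of _ U] exI[of _ n] exI[of _ d] conjI; simp\<close>)

lemma fraction_space_sheaf:
  assumes X: "fraction_space X R"
  shows "function_sheaf X"
  unfolding function_sheaf_def
proof (intro conjI allI impI; elim conjE)
  fix U f g assume U: "openin (ktop X) U" and f: "f \<in> kreg X U" and fg: "\<forall>x\<in>U. g x = f x"
  show "g \<in> kreg X U"
  proof (rule fraction_space_kregI_local[OF X U])
    fix x assume "x \<in> U"
    obtain V n d where "openin (ktop X) V" "x \<in> V" "V \<subseteq> U" "(n, d) \<in> R"
      "\<forall>y\<in>V. d y \<noteq> 0 \<and> f y = n y / d y"
      by (rule fraction_space_locally[OF X U f \<open>x \<in> U\<close>])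
    then show "\<exists>V n d. openin (ktop X) V \<and> x \<in> V \<and> (n, d) \<in> R \<and>
        (\<forall>y\<in>V \<inter> U. d y \<noteq> 0 \<and> g y = n y / d y)"
      using fg by (intro exI[of _ V] exI[of _ n] exI[of _ d] conjI) auto
  qed
next
  fix U V f assume U: "openin (ktop X) U" and V: "openin (ktop X) V" and "V \<subseteq> U" and f: "f \<in> kreg X U"
  show "f \<in> kreg X V"
  proof (rule fraction_space_kregI_local[OF X V])
    fix x assume "x \<in> V"
    then have "x \<in> U" using \<open>V \<subseteq> U\<close> by auto
    obtain W n d where "openin (ktop X) W" "x \<in> W" "W \<subseteq> U" "(n, d) \<in> R"
      "\<forall>y\<in>W. d y \<noteq> 0 \<and> f y = n y / d y"
      by (rule fraction_space_locally[OF X U f \<open>x \<in> U\<close>])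
    then show "\<exists>W n d. openin (ktop X) W \<and> x \<in> W \<and> (n, d) \<in> R \<and>
        (\<forall>y\<in>W \<inter> V. d y \<noteq> 0 \<and> f y = n y / d y)"
      by (intro exI[of _ W] exI[of _ n] exI[of _ d] conjI) auto
  qed
next
  fix U f assume U: "openin (ktop X) U"
    and loc: "\<forall>x\<in>U. \<exists>V. openin (ktop X) V \<and> x \<in> V \<and> V \<subseteq> U \<and> f \<in> kreg X V"
  show "f \<in> kreg X U"
  proof (rule fraction_space_kregI_local[OF X U])
    fix x assume "x \<in> U"
    with loc obtain V where V: "openin (ktop X) V" "x \<in> V" "V \<subseteq> U" "f \<in> kreg X V"
      by blast
    obtain W n d where "openin (ktop X) W" "x \<in> W" "W \<subseteq> V" "(n, d) \<in> R"
      "\<forall>y\<in>W. d y \<noteq> 0 \<and> f y = n y / d y"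
      by (rule fraction_space_locally[OF X V(1,4,2)])
    then show "\<exists>W n d. openin (ktop X) W \<and> x \<in> W \<and> (n, d) \<in> R \<and>
        (\<forall>y\<in>W \<inter> U. d y \<noteq> 0 \<and> f y = n y / d y)"
      by (intro exI[of _ W] exI[of _ n] exI[of _ d] conjI) auto
  qed
qed

lemma fraction_space_regular:
  assumes X: "fraction_space X R"
  shows "regular_space X"
  unfolding regular_space_def
proof (intro conjI allI impI ballI)
  show sh: "function_sheaf X"
    by (rule fraction_space_sheaf[OF X])
  have const: "(\<lambda>_. to_ac c, \<lambda>_. 1) \<in> R" for c
    using X by (simp add: fraction_space_def)
  have swap: "(d, n) \<in> R" if "(n, d) \<in> R" for n d
    using X that by (simp add: fraction_space_def)
  have plus: "(\<lambda>x. n x * d' x + n' x * d x, \<lambda>x. d x * d' x) \<in> R"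
    and times: "(\<lambda>x. n x * n' x, \<lambda>x. d x * d' x) \<in> R" if "(n, d) \<in> R" "(n', d') \<in> R" for n d n' d'
    using X that by (simp_all add: fraction_space_def)
  fix U assume U: "openin (ktop X) U"
  show "(\<lambda>_. to_ac c) \<in> kreg X U" for c
    by (rule fraction_space_kregI[OF X U const]) auto
  fix f assume f: "f \<in> kreg X U"
  {
    fix g assume g: "g \<in> kreg X U"
    have combine: "(\<lambda>x. h (f x) (g x)) \<in> kreg X U"
      if N: "\<And>n d n' d'. (n, d) \<in> R \<Longrightarrow> (n', d') \<in> R \<Longrightarrow> (N n d n' d', \<lambda>x. d x * d' x) \<in> R"
        and h: "\<And>n d n' d' x. d x \<noteq> 0 \<Longrightarrow> d' x \<noteq> 0 \<Longrightarrow>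
          h (n x / d x) (n' x / d' x) = N n d n' d' x / (d x * d' x)" for h N
    proof (rule fraction_space_kregI_local[OF X U])
      fix x assume "x \<in> U"
      obtain V n d where V: "openin (ktop X) V" "x \<in> V" "V \<subseteq> U" "(n, d) \<in> R"
        "\<forall>y\<in>V. d y \<noteq> 0 \<and> f y = n y / d y"
        by (rule fraction_space_locally[OF X U f \<open>x \<in> U\<close>])
      obtain V' n' d' where V': "openin (ktop X) V'" "x \<in> V'" "V' \<subseteq> U" "(n', d') \<in> R"
        "\<forall>y\<in>V'. d' y \<noteq> 0 \<and> g y = n' y / d' y"
        by (rule fraction_space_locally[OF X U g \<open>x \<in> U\<close>])
      show "\<exists>V n d. openin (ktop X) V \<and> x \<in> V \<and> (n, d) \<in> R \<and>
          (\<forall>y\<in>V \<inter> U. d y \<noteq> 0 \<and> h (f y) (g y) = n y / d y)"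
        using openin_Int[OF V(1) V'(1)] V(2,5) V'(2,5) N[OF V(4) V'(4)] h[of d _ d' n n']
        by (intro exI[of _ "V \<inter> V'"] exI[of _ "N n d n' d'"] exI[of _ "\<lambda>x. d x * d' x"] conjI) auto
    qed
    show "(\<lambda>x. f x + g x) \<in> kreg X U"
      by (rule combine[OF plus]) (simp_all add: add_frac_eq)
    show "(\<lambda>x. f x * g x) \<in> kreg X U"
      by (rule combine[OF times]) simp_all
  }
  have loc: "\<exists>V. openin (ktop X) V \<and> x \<in> V \<and> V \<subseteq> {x \<in> U. f x \<noteq> 0} \<and> (\<lambda>x. inverse (f x)) \<in> kreg X V"
    if x: "x \<in> {x \<in> U. f x \<noteq> 0}" for x
  proof -
    have "x \<in> U"
      using x by simp
    obtain V n d where V: "openin (ktop X) V" "x \<in> V" "V \<subseteq> U" "(n, d) \<in> R"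
        "\<forall>y\<in>V. d y \<noteq> 0 \<and> f y = n y / d y"
      by (rule fraction_space_locally[OF X U f \<open>x \<in> U\<close>])
    let ?V = "V \<inter> {x \<in> kpoints X. n x \<noteq> 0}"
    have o: "openin (ktop X) ?V"
      by (rule openin_Int[OF V(1) fraction_space_open[OF X V(4)]])
    have "(\<lambda>x. inverse (f x)) \<in> kreg X ?V"
      by (rule fraction_space_kregI[OF X o swap[OF V(4)]]) (use V(5) in auto)
    moreover have "x \<in> ?V"
      using x V openin_subset[OF V(1)] by auto
    moreover have "?V \<subseteq> {x \<in> U. f x \<noteq> 0}"
      using V(3,5) by auto
    ultimately show ?thesis
      using o by blast
  qed
  show o: "openin (ktop X) {x \<in> U. f x \<noteq> 0}"
    by (rule openin_pointwise) (use loc in blast)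
  show "(\<lambda>x. inverse (f x)) \<in> kreg X {x \<in> U. f x \<noteq> 0}"
    by (rule function_sheaf_glue[OF sh o loc])
qed

lemma kmorphism_continuous: "kmorphism X Y \<phi> \<Longrightarrow> continuous_map (ktop X) (ktop Y) \<phi>"
  by (simp add: kmorphism_def)

lemma kmorphism_points: "kmorphism X Y \<phi> \<Longrightarrow> x \<in> kpoints X \<Longrightarrow> \<phi> x \<in> kpoints Y"
  using continuous_map_funspace[OF kmorphism_continuous] by blast

lemma kmorphism_open: "kmorphism X Y \<phi> \<Longrightarrow> openin (ktop Y) V \<Longrightarrow> openin (ktop X) {x \<in> kpoints X. \<phi> x \<in> V}"
  by (rule openin_continuous_map_preimage[OF kmorphism_continuous])

lemma kmorphism_pullback:
  assumes "kmorphism X Y \<phi>" "openin (ktop Y) V" "f \<in> kreg Y V"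
  shows "(\<lambda>x. f (\<phi> x)) \<in> kreg X {x \<in> kpoints X. \<phi> x \<in> V}"
proof -
  have "\<forall>V f. openin (ktop Y) V \<and> f \<in> kreg Y V \<longrightarrow> f \<circ> \<phi> \<in> kreg X {x \<in> kpoints X. \<phi> x \<in> V}"
    using assms(1) unfolding kmorphism_def by (rule conjunct2)
  from this[rule_format, OF conjI, OF assms(2,3)] show ?thesis
    by (simp add: comp_def)
qed

text \<open>
  A local fraction pulls back to a regular function once the fractions themselves do, because
  regularity is local on the source.
\<close>

lemma kmorphism_into_fraction_space:
  assumes Y: "fraction_space Y R" and X: "function_sheaf X"
    and pts: "\<And>x. x \<in> kpoints X \<Longrightarrow> \<phi> x \<in> kpoints Y"
    and op: "\<And>n d. (n, d) \<in> R \<Longrightarrow> openin (ktop X) {x \<in> kpoints X. n (\<phi> x) \<noteq> 0}"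
    and reg: "\<And>n d. (n, d) \<in> R \<Longrightarrow>
      (\<lambda>x. n (\<phi> x) / d (\<phi> x)) \<in> kreg X {x \<in> kpoints X. d (\<phi> x) \<noteq> 0}"
  shows "kmorphism X Y \<phi>"
  unfolding kmorphism_def
proof (intro conjI allI impI; (elim conjE)?)
  let ?B = "{{x \<in> kpoints Y. n x \<noteq> 0} | n d. (n, d) \<in> R}"
  have top: "ktop Y = topology_generated_by ?B"
    using Y by (simp add: fraction_space_def)
  then have un: "kpoints Y = \<Union>?B"
    by (rule ssubst) (rule topology_generated_by_topspace)
  have "\<phi> ` kpoints X \<subseteq> kpoints Y"
    using pts by auto
  then have "\<phi> ` kpoints X \<subseteq> \<Union>?B"
    by (rule subset_trans[OF _ equalityD1[OF un]])
  moreover have "openin (ktop X) (\<phi> -` B \<inter> kpoints X)" if "B \<in> ?B" for B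
  proof -
    from that obtain n d where nd: "(n, d) \<in> R" "B = {x \<in> kpoints Y. n x \<noteq> 0}"
      by blast
    then have "\<phi> -` B \<inter> kpoints X = {x \<in> kpoints X. n (\<phi> x) \<noteq> 0}"
      using pts by auto
    then show ?thesis
      using op[OF nd(1)] by simp
  qed
  ultimately show cont: "continuous_map (ktop X) (ktop Y) \<phi>"
    by (subst top) (rule continuous_on_generated_topo)
  fix V f assume V: "openin (ktop Y) V" and f: "f \<in> kreg Y V"
  have oV: "openin (ktop X) {x \<in> kpoints X. \<phi> x \<in> V}" if "openin (ktop Y) V" for V
    using cont that by (simp add: openin_continuous_map_preimage)
  show "f \<circ> \<phi> \<in> kreg X {x \<in> kpoints X. \<phi> x \<in> V}"
  proof (rule function_sheaf_glue[OF X oV[OF V]])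
    fix x assume x: "x \<in> {x \<in> kpoints X. \<phi> x \<in> V}"
    then have "\<phi> x \<in> V" by simp
    obtain W n d where W: "openin (ktop Y) W" "\<phi> x \<in> W" "W \<subseteq> V" "(n, d) \<in> R"
        "\<forall>y\<in>W. d y \<noteq> 0 \<and> f y = n y / d y"
      by (rule fraction_space_locally[OF Y V f \<open>\<phi> x \<in> V\<close>])
    let ?W = "{x \<in> kpoints X. \<phi> x \<in> W}"
    have oW: "openin (ktop X) ?W"
      by (rule oV[OF W(1)])
    have swap: "(d, n) \<in> R"
      using Y W(4) by (simp add: fraction_space_def)
    have "(\<lambda>x. n (\<phi> x) / d (\<phi> x)) \<in> kreg X ?W"
      by (rule function_sheaf_restrict[OF X op[OF swap] reg[OF W(4)] oW]) (use W in auto)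
    then have "f \<circ> \<phi> \<in> kreg X ?W"
      by (rule function_sheaf_cong[OF X oW]) (use W in auto)
    then show "\<exists>V'. openin (ktop X) V' \<and> x \<in> V' \<and> V' \<subseteq> {x \<in> kpoints X. \<phi> x \<in> V} \<and> f \<circ> \<phi> \<in> kreg X V'"
      using oW x W by (intro exI[of _ ?W]) auto
  qed
qed

section \<open>Morphisms and subspaces\<close>

lemma ktop_ksub [simp]: "ktop (ksub X A) = subtopology (ktop X) A"
  by (simp add: ksub_def)

lemma kreg_ksub:
  "f \<in> kreg (ksub X A) U \<longleftrightarrow> (\<forall>x\<in>U. \<exists>V g. openin (ktop X) V \<and> x \<in> V \<and> g \<in> kreg X V \<and> (\<forall>y\<in>U \<inter> V. f y = g y))"
  by (simp add: ksub_def)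

lemma kreg_ksub_locally:
  assumes "f \<in> kreg (ksub X A) U" "x \<in> U"
  obtains V g where "openin (ktop X) V" "x \<in> V" "g \<in> kreg X V" "\<forall>y\<in>U \<inter> V. f y = g y"
proof -
  have "\<exists>V g. openin (ktop X) V \<and> x \<in> V \<and> g \<in> kreg X V \<and> (\<forall>y\<in>U \<inter> V. f y = g y)"
    using assms(1)[unfolded kreg_ksub] assms(2) by (rule bspec)
  then show thesis
    by (elim exE conjE) (rule that)
qed

lemma kreg_ksubI:
  assumes "\<And>x. x \<in> U \<Longrightarrow> openin (ktop X) (V x)" "\<And>x. x \<in> U \<Longrightarrow> x \<in> V x"
    "\<And>x. x \<in> U \<Longrightarrow> g x \<in> kreg X (V x)" "\<And>x y. x \<in> U \<Longrightarrow> y \<in> U \<Longrightarrow> y \<in> V x \<Longrightarrow> f y = g x y"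
  shows "f \<in> kreg (ksub X A) U"
  unfolding kreg_ksub
proof
  fix x assume "x \<in> U"
  with assms show "\<exists>V g. openin (ktop X) V \<and> x \<in> V \<and> g \<in> kreg X V \<and> (\<forall>y\<in>U \<inter> V. f y = g y)"
    by (intro exI[of _ "V x"] exI[of _ "g x"] conjI) auto
qed

text \<open>
  Functions on a subspace are locally restrictions from the ambient space, a condition that is
  local by construction.
\<close>

lemma ksub_sheaf:
  assumes X: "function_sheaf X"
  shows "function_sheaf (ksub X A)"
  unfolding function_sheaf_def
proof (intro conjI allI impI; elim conjE)
  fix U f g assume f: "f \<in> kreg (ksub X A) U" and eq: "\<forall>x\<in>U. g x = f x"
  show "g \<in> kreg (ksub X A) U"
    unfolding kreg_ksub
  proof
    fix x assume x: "x \<in> U"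
    obtain V h where "openin (ktop X) V" "x \<in> V" "h \<in> kreg X V" "\<forall>y\<in>U \<inter> V. f y = h y"
      by (rule kreg_ksub_locally[OF f x])
    then show "\<exists>V h. openin (ktop X) V \<and> x \<in> V \<and> h \<in> kreg X V \<and> (\<forall>y\<in>U \<inter> V. g y = h y)"
      using eq by (intro exI[of _ V] exI[of _ h] conjI) auto
  qed
next
  fix U V f assume "V \<subseteq> U" and f: "f \<in> kreg (ksub X A) U"
  show "f \<in> kreg (ksub X A) V"
    unfolding kreg_ksub
  proof
    fix x assume "x \<in> V"
    then have x: "x \<in> U"
      using \<open>V \<subseteq> U\<close> by auto
    obtain W h where "openin (ktop X) W" "x \<in> W" "h \<in> kreg X W" "\<forall>y\<in>U \<inter> W. f y = h y"
      by (rule kreg_ksub_locally[OF f x])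
    then show "\<exists>W h. openin (ktop X) W \<and> x \<in> W \<and> h \<in> kreg X W \<and> (\<forall>y\<in>V \<inter> W. f y = h y)"
      using \<open>V \<subseteq> U\<close> by (intro exI[of _ W] exI[of _ h] conjI) auto
  qed
next
  fix U f assume U: "openin (ktop (ksub X A)) U"
    and loc: "\<forall>x\<in>U. \<exists>V. openin (ktop (ksub X A)) V \<and> x \<in> V \<and> V \<subseteq> U \<and> f \<in> kreg (ksub X A) V"
  show "f \<in> kreg (ksub X A) U"
    unfolding kreg_ksub
  proof
    fix x assume "x \<in> U"
    with loc obtain V where V: "openin (ktop (ksub X A)) V" "x \<in> V" "V \<subseteq> U" "f \<in> kreg (ksub X A) V"
      by blast
    from V(1) obtain V' where V': "openin (ktop X) V'" "V = V' \<inter> A"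
      by (auto simp: openin_subtopology)
    obtain W g where W: "openin (ktop X) W" "x \<in> W" "g \<in> kreg X W" "\<forall>y\<in>V \<inter> W. f y = g y"
      by (rule kreg_ksub_locally[OF V(4,2)])
    have o: "openin (ktop X) (V' \<inter> W)"
      by (rule openin_Int[OF V'(1) W(1)])
    have "g \<in> kreg X (V' \<inter> W)"
      by (rule function_sheaf_restrict[OF X W(1,3) o]) auto
    moreover have "U \<subseteq> A"
      using openin_subset[OF U] by auto
    ultimately show "\<exists>V g. openin (ktop X) V \<and> x \<in> V \<and> g \<in> kreg X V \<and> (\<forall>y\<in>U \<inter> V. f y = g y)"
      using o V' V W by (intro exI[of _ "V' \<inter> W"] exI[of _ g]) auto
  qed
qed

lemma ksub_regular:
  assumes X: "regular_space X"
  shows "regular_space (ksub X A)"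
  unfolding regular_space_def
proof (intro conjI allI impI ballI)
  have sh: "function_sheaf X"
    using X by (simp add: regular_space_def)
  show sh': "function_sheaf (ksub X A)"
    by (rule ksub_sheaf[OF sh])
  fix U assume U: "openin (ktop (ksub X A)) U"
  have UX: "U \<subseteq> kpoints X"
    using openin_subset[OF U] by auto
  show "(\<lambda>_. to_ac c) \<in> kreg (ksub X A) U" for c
    by (rule kreg_ksubI[where V = "\<lambda>_. kpoints X" and g = "\<lambda>_ _. to_ac c"])
       (use UX in \<open>auto intro: regular_const[OF X]\<close>)
  fix f assume f: "f \<in> kreg (ksub X A) U"
  {
    fix g assume g: "g \<in> kreg (ksub X A) U"
    have *: "(\<lambda>x. h (f x) (g x)) \<in> kreg (ksub X A) U"
      if h: "\<And>V f g. openin (ktop X) V \<Longrightarrow> f \<in> kreg X V \<Longrightarrow> g \<in> kreg X V \<Longrightarrow> (\<lambda>x. h (f x) (g x)) \<in> kreg X V"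
      for h
      unfolding kreg_ksub
    proof
      fix x assume x: "x \<in> U"
      obtain V f' where V: "openin (ktop X) V" "x \<in> V" "f' \<in> kreg X V" "\<forall>y\<in>U \<inter> V. f y = f' y"
        by (rule kreg_ksub_locally[OF f x])
      obtain V' g' where V': "openin (ktop X) V'" "x \<in> V'" "g' \<in> kreg X V'" "\<forall>y\<in>U \<inter> V'. g y = g' y"
        by (rule kreg_ksub_locally[OF g x])
      have o: "openin (ktop X) (V \<inter> V')"
        by (rule openin_Int[OF V(1) V'(1)])
      have "(\<lambda>x. h (f' x) (g' x)) \<in> kreg X (V \<inter> V')"
        by (rule h[OF o function_sheaf_restrict[OF sh V(1,3) o] function_sheaf_restrict[OF sh V'(1,3) o]]) auto
      then show "\<exists>V k. openin (ktop X) V \<and> x \<in> V \<and> k \<in> kreg X V \<and> (\<forall>y\<in>U \<inter> V. h (f y) (g y) = k y)"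
        using o V(2,4) V'(2,4)
        by (intro exI[of _ "V \<inter> V'"] exI[of _ "\<lambda>x. h (f' x) (g' x)"] conjI) auto
    qed
    show "(\<lambda>x. f x + g x) \<in> kreg (ksub X A) U"
      by (rule *[OF regular_add[OF X]])
    show "(\<lambda>x. f x * g x) \<in> kreg (ksub X A) U"
      by (rule *[OF regular_mult[OF X]])
  }
  have loc: "\<exists>V f'. openin (ktop X) V \<and> x \<in> V \<and> (\<forall>y\<in>U \<inter> V. f y = f' y \<and> f y \<noteq> 0) \<and>
      (\<lambda>x. inverse (f' x)) \<in> kreg X V"
    if x: "x \<in> U" "f x \<noteq> 0" for x
  proof -
    obtain V f' where V: "openin (ktop X) V" "x \<in> V" "f' \<in> kreg X V" "\<forall>y\<in>U \<inter> V. f y = f' y"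
      by (rule kreg_ksub_locally[OF f x(1)])
    let ?W = "{x \<in> V. f' x \<noteq> 0}"
    have o: "openin (ktop X) ?W"
      by (rule regular_nonzero_open[OF X V(1,3)])
    show ?thesis
      using o V(2,4) x regular_inverse[OF X V(1,3)]
      by (intro exI[of _ ?W] exI[of _ f'] conjI) auto
  qed
  show "openin (ktop (ksub X A)) {x \<in> U. f x \<noteq> 0}"
  proof (rule openin_pointwise)
    fix x assume x: "x \<in> {x \<in> U. f x \<noteq> 0}"
    with loc[of x] obtain V f' where V: "openin (ktop X) V" "x \<in> V" "\<forall>y\<in>U \<inter> V. f y = f' y \<and> f y \<noteq> 0"
      by auto
    have "openin (ktop (ksub X A)) (U \<inter> (V \<inter> A))"
      by (rule openin_Int[OF U]) (use V(1) in \<open>simp add: openin_subtopology_Int\<close>)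
    then show "\<exists>V. openin (ktop (ksub X A)) V \<and> x \<in> V \<and> V \<subseteq> {x \<in> U. f x \<noteq> 0}"
      using V(2,3) x openin_subset[OF U] by (intro exI[of _ "U \<inter> (V \<inter> A)"] conjI) auto
  qed
  show "(\<lambda>x. inverse (f x)) \<in> kreg (ksub X A) {x \<in> U. f x \<noteq> 0}"
    unfolding kreg_ksub
  proof
    fix x assume x: "x \<in> {x \<in> U. f x \<noteq> 0}"
    with loc[of x] obtain V f' where V: "openin (ktop X) V" "x \<in> V" "\<forall>y\<in>U \<inter> V. f y = f' y \<and> f y \<noteq> 0"
      "(\<lambda>x. inverse (f' x)) \<in> kreg X V"
      by auto
    then show "\<exists>V g. openin (ktop X) V \<and> x \<in> V \<and> g \<in> kreg X V \<and>
        (\<forall>y\<in>{x \<in> U. f x \<noteq> 0} \<inter> V. inverse (f y) = g y)"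
      by (intro exI[of _ V] exI[of _ "\<lambda>x. inverse (f' x)"] conjI) auto
  qed
qed

lemma kmorphism_id:
  assumes "function_sheaf X"
  shows "kmorphism X X (\<lambda>x. x)"
  unfolding kmorphism_def
proof (intro conjI allI impI; (elim conjE)?)
  fix V f assume V: "openin (ktop X) V" "f \<in> kreg X V"
  have "{x \<in> kpoints X. x \<in> V} = V"
    using openin_subset[OF V(1)] by auto
  then show "f \<circ> (\<lambda>x. x) \<in> kreg X {x \<in> kpoints X. x \<in> V}"
    using V by (simp add: comp_def)
qed (auto simp: id_def[symmetric])

lemma kmorphism_compose:
  assumes f: "kmorphism X Y \<phi>" and g: "kmorphism Y Z \<psi>"
  shows "kmorphism X Z (\<lambda>x. \<psi> (\<phi> x))"
  unfolding kmorphism_def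
proof (intro conjI allI impI; (elim conjE)?)
  show "continuous_map (ktop X) (ktop Z) (\<lambda>x. \<psi> (\<phi> x))"
    using f g continuous_map_compose[of "ktop X" "ktop Y" \<phi> "ktop Z" \<psi>] unfolding kmorphism_def
    by (simp add: comp_def)
  fix V h assume V: "openin (ktop Z) V" "h \<in> kreg Z V"
  have "{x \<in> kpoints X. \<phi> x \<in> {y \<in> kpoints Y. \<psi> y \<in> V}} = {x \<in> kpoints X. \<psi> (\<phi> x) \<in> V}"
    using kmorphism_points[OF f] by auto
  then show "h \<circ> (\<lambda>x. \<psi> (\<phi> x)) \<in> kreg X {x \<in> kpoints X. \<psi> (\<phi> x) \<in> V}"
    using kmorphism_pullback[OF f kmorphism_open[OF g V(1)] kmorphism_pullback[OF g V]]
    by (simp add: comp_def)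
qed

lemma kmorphism_from_ksub:
  assumes f: "kmorphism X Y \<phi>"
  shows "kmorphism (ksub X A) Y \<phi>"
  unfolding kmorphism_def
proof (intro conjI allI impI; (elim conjE)?)
  show "continuous_map (ktop (ksub X A)) (ktop Y) \<phi>"
    using f by (simp add: kmorphism_def continuous_map_from_subtopology)
  fix V h assume V: "openin (ktop Y) V" "h \<in> kreg Y V"
  show "h \<circ> \<phi> \<in> kreg (ksub X A) {x \<in> kpoints (ksub X A). \<phi> x \<in> V}"
    by (rule kreg_ksubI[where V = "\<lambda>_. {x \<in> kpoints X. \<phi> x \<in> V}" and g = "\<lambda>_ x. h (\<phi> x)"])
       (use kmorphism_pullback[OF f V] kmorphism_open[OF f V(1)] in auto)
qed

text \<open>
  Together with \<open>kmorphism_from_ksub\<close> this characterises the induced structure by a universal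
  property; the comparisons of iterated subspaces below follow formally from it.
\<close>

lemma kmorphism_into_ksub:
  assumes f: "kmorphism X Y \<phi>" and X: "function_sheaf X" and B: "\<And>x. x \<in> kpoints X \<Longrightarrow> \<phi> x \<in> B"
  shows "kmorphism X (ksub Y B) \<phi>"
  unfolding kmorphism_def
proof (intro conjI allI impI; (elim conjE)?)
  show cont: "continuous_map (ktop X) (ktop (ksub Y B)) \<phi>"
    using f B by (simp add: kmorphism_def continuous_map_in_subtopology image_subset_iff)
  fix V h assume V: "openin (ktop (ksub Y B)) V" "h \<in> kreg (ksub Y B) V"
  have o: "openin (ktop X) {x \<in> kpoints X. \<phi> x \<in> V}"
    using openin_continuous_map_preimage[OF cont V(1)] .
  show "h \<circ> \<phi> \<in> kreg X {x \<in> kpoints X. \<phi> x \<in> V}"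
  proof (rule function_sheaf_glue[OF X o])
    fix x assume x: "x \<in> {x \<in> kpoints X. \<phi> x \<in> V}"
    then have "\<phi> x \<in> V" by simp
    obtain W g where W: "openin (ktop Y) W" "\<phi> x \<in> W" "g \<in> kreg Y W" "\<forall>y\<in>V \<inter> W. h y = g y"
      by (rule kreg_ksub_locally[OF V(2) \<open>\<phi> x \<in> V\<close>])
    let ?W = "{x \<in> kpoints X. \<phi> x \<in> V} \<inter> {x \<in> kpoints X. \<phi> x \<in> W}"
    have o': "openin (ktop X) ?W"
      using o kmorphism_open[OF f W(1)] by blast
    have "(\<lambda>x. g (\<phi> x)) \<in> kreg X ?W"
      by (rule function_sheaf_restrict[OF X kmorphism_open[OF f W(1)] kmorphism_pullback[OF f W(1,3)] o']) auto
    then have "h \<circ> \<phi> \<in> kreg X ?W"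
      by (rule function_sheaf_cong[OF X o']) (use W(4) in auto)
    then show "\<exists>V'. openin (ktop X) V' \<and> x \<in> V' \<and> V' \<subseteq> {x \<in> kpoints X. \<phi> x \<in> V} \<and> h \<circ> \<phi> \<in> kreg X V'"
      using o' x W(2) by (intro exI[of _ ?W] conjI) auto
  qed
qed

lemma kmorphism_ksub:
  assumes "kmorphism X Y \<phi>" "function_sheaf X" "\<And>x. x \<in> kpoints X \<Longrightarrow> x \<in> A \<Longrightarrow> \<phi> x \<in> B"
  shows "kmorphism (ksub X A) (ksub Y B) \<phi>"
  by (rule kmorphism_into_ksub[OF kmorphism_from_ksub[OF assms(1)] ksub_sheaf[OF assms(2)]])
     (use assms(3) in auto)

lemma kisomorphicI:
  "\<lbrakk>kmorphism X Y \<phi>; kmorphism Y X \<psi>; \<And>x. x \<in> kpoints X \<Longrightarrow> \<psi> (\<phi> x) = x;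
    \<And>y. y \<in> kpoints Y \<Longrightarrow> \<phi> (\<psi> y) = y\<rbrakk> \<Longrightarrow> kisomorphic X Y"
  unfolding kisomorphic_def by blast

lemma kisomorphic_refl: "function_sheaf X \<Longrightarrow> kisomorphic X X"
  by (rule kisomorphicI[OF kmorphism_id kmorphism_id]) auto

lemma kisomorphic_sym: "kisomorphic X Y \<Longrightarrow> kisomorphic Y X"
  unfolding kisomorphic_def by blast

lemma kisomorphic_trans:
  assumes "kisomorphic X Y" "kisomorphic Y Z"
  shows "kisomorphic X Z"
proof -
  obtain \<phi> \<psi> where 1: "kmorphism X Y \<phi>" "kmorphism Y X \<psi>"
    "\<forall>x\<in>kpoints X. \<psi> (\<phi> x) = x" "\<forall>y\<in>kpoints Y. \<phi> (\<psi> y) = y"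
    using assms(1) unfolding kisomorphic_def by blast
  obtain \<phi>' \<psi>' where 2: "kmorphism Y Z \<phi>'" "kmorphism Z Y \<psi>'"
    "\<forall>x\<in>kpoints Y. \<psi>' (\<phi>' x) = x" "\<forall>y\<in>kpoints Z. \<phi>' (\<psi>' y) = y"
    using assms(2) unfolding kisomorphic_def by blast
  show ?thesis
    by (rule kisomorphicI[OF kmorphism_compose[OF 1(1) 2(1)] kmorphism_compose[OF 2(2) 1(2)]])
       (use 1 2 kmorphism_points[OF 1(1)] kmorphism_points[OF 2(2)] in auto)
qed

lemma kisomorphic_ksub:
  assumes "kmorphism X Y \<phi>" "kmorphism Y X \<psi>" "\<And>x. x \<in> kpoints X \<Longrightarrow> \<psi> (\<phi> x) = x"
    "\<And>y. y \<in> kpoints Y \<Longrightarrow> \<phi> (\<psi> y) = y" "function_sheaf X" "function_sheaf Y"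
    "\<And>x. x \<in> kpoints X \<Longrightarrow> x \<in> A \<longleftrightarrow> \<phi> x \<in> B"
  shows "kisomorphic (ksub X A) (ksub Y B)"
proof (rule kisomorphicI)
  show "kmorphism (ksub X A) (ksub Y B) \<phi>"
    by (rule kmorphism_ksub) (use assms in auto)
  show "kmorphism (ksub Y B) (ksub X A) \<psi>"
    by (rule kmorphism_ksub) (use assms kmorphism_points[OF assms(2)] in auto)
qed (use assms in auto)

lemma kisomorphic_ksub_ksub:
  assumes X: "function_sheaf X"
  shows "kisomorphic (ksub (ksub X A) B) (ksub X (A \<inter> B))"
proof (rule kisomorphicI)
  show "kmorphism (ksub (ksub X A) B) (ksub X (A \<inter> B)) (\<lambda>x. x)"
    by (intro kmorphism_into_ksub kmorphism_from_ksub kmorphism_id ksub_sheaf X) auto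
  show "kmorphism (ksub X (A \<inter> B)) (ksub (ksub X A) B) (\<lambda>x. x)"
    by (intro kmorphism_into_ksub kmorphism_from_ksub kmorphism_id ksub_sheaf X) auto
qed auto

lemma kisomorphic_ksub_points:
  assumes X: "function_sheaf X"
  shows "kisomorphic X (ksub X (kpoints X))"
proof (rule kisomorphicI)
  show "kmorphism X (ksub X (kpoints X)) (\<lambda>x. x)" "kmorphism (ksub X (kpoints X)) X (\<lambda>x. x)"
    by (intro kmorphism_into_ksub kmorphism_from_ksub kmorphism_id X; simp)+
qed auto

lemma kreg_ksub_open:
  assumes X: "function_sheaf X" and U: "openin (ktop X) U" and "U \<subseteq> A"
  shows "f \<in> kreg (ksub X A) U \<longleftrightarrow> f \<in> kreg X U"
proof
  assume f: "f \<in> kreg (ksub X A) U"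
  show "f \<in> kreg X U"
  proof (rule function_sheaf_glue[OF X U])
    fix x assume x: "x \<in> U"
    obtain V g where V: "openin (ktop X) V" "x \<in> V" "g \<in> kreg X V" "\<forall>y\<in>U \<inter> V. f y = g y"
      by (rule kreg_ksub_locally[OF f x])
    have o: "openin (ktop X) (U \<inter> V)"
      by (rule openin_Int[OF U V(1)])
    have "g \<in> kreg X (U \<inter> V)"
      by (rule function_sheaf_restrict[OF X V(1,3) o]) auto
    then have "f \<in> kreg X (U \<inter> V)"
      by (rule function_sheaf_cong[OF X o]) (use V(4) in auto)
    then show "\<exists>V. openin (ktop X) V \<and> x \<in> V \<and> V \<subseteq> U \<and> f \<in> kreg X V"
      using o x V(2) by (intro exI[of _ "U \<inter> V"] conjI) auto
  qed
qed (rule kreg_ksubI[where V = "\<lambda>_. U" and g = "\<lambda>_. f"], use U in auto)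

text \<open>
  Operations on functions are transported to \<open>Y\<close> by pulling back to \<open>X\<close> and returning along the
  inverse.
\<close>

lemma kisomorphic_regular:
  assumes iso: "kisomorphic X Y" and X: "regular_space X" and Y: "function_sheaf Y"
  shows "regular_space Y"
proof -
  obtain \<phi> \<psi> where m: "kmorphism X Y \<phi>" "kmorphism Y X \<psi>"
    and inv: "\<And>x. x \<in> kpoints X \<Longrightarrow> \<psi> (\<phi> x) = x" "\<And>y. y \<in> kpoints Y \<Longrightarrow> \<phi> (\<psi> y) = y"
    using iso unfolding kisomorphic_def by blast
  have pull: "h \<in> kreg Y V" if V: "openin (ktop Y) V" and W: "openin (ktop X) W"
    and eq: "\<And>y. y \<in> V \<Longrightarrow> \<psi> y \<in> W" "\<And>x. x \<in> W \<Longrightarrow> \<phi> x \<in> V"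
    and h: "h' \<in> kreg X W" "\<And>x. x \<in> W \<Longrightarrow> h' x = h (\<phi> x)" for h h' V W
  proof -
    have "{y \<in> kpoints Y. \<psi> y \<in> W} = V"
      using openin_subset[OF V] eq inv(2) by force
    then have "(\<lambda>y. h' (\<psi> y)) \<in> kreg Y V"
      using kmorphism_pullback[OF m(2) W h(1)] by simp
    then show ?thesis
      by (rule function_sheaf_cong[OF Y V]) (use h eq inv(2) openin_subset[OF V] in auto)
  qed
  show ?thesis
    unfolding regular_space_def
  proof (intro conjI allI impI ballI)
    show "function_sheaf Y" by (rule Y)
    fix U assume U: "openin (ktop Y) U"
    let ?U = "{x \<in> kpoints X. \<phi> x \<in> U}"
    have oU: "openin (ktop X) ?U"
      by (rule kmorphism_open[OF m(1) U])
    have UU: "\<psi> y \<in> ?U" if "y \<in> U" for y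
      using that inv(2) kmorphism_points[OF m(2)] openin_subset[OF U] by auto
    show "(\<lambda>_. to_ac c) \<in> kreg Y U" for c
      by (rule pull[OF U oU _ _ regular_const[OF X oU]]) (use UU in auto)
    fix f assume f: "f \<in> kreg Y U"
    note f' = kmorphism_pullback[OF m(1) U f]
    {
      fix g assume g: "g \<in> kreg Y U"
      note g' = kmorphism_pullback[OF m(1) U g]
      show "(\<lambda>x. f x + g x) \<in> kreg Y U"
        by (rule pull[OF U oU _ _ regular_add[OF X oU f' g']]) (use UU in auto)
      show "(\<lambda>x. f x * g x) \<in> kreg Y U"
        by (rule pull[OF U oU _ _ regular_mult[OF X oU f' g']]) (use UU in auto)
    }
    have o: "openin (ktop X) {x \<in> ?U. f (\<phi> x) \<noteq> 0}"
      by (rule regular_nonzero_open[OF X oU f'])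
    have "{y \<in> kpoints Y. \<psi> y \<in> {x \<in> ?U. f (\<phi> x) \<noteq> 0}} = {y \<in> U. f y \<noteq> 0}"
      using openin_subset[OF U] inv(2) kmorphism_points[OF m(2)] by force
    with kmorphism_open[OF m(2) o] show o': "openin (ktop Y) {y \<in> U. f y \<noteq> 0}"
      by simp
    show "(\<lambda>x. inverse (f x)) \<in> kreg Y {y \<in> U. f y \<noteq> 0}"
      by (rule pull[OF o' o _ _ regular_inverse[OF X oU f']]) (use UU inv(2) openin_subset[OF U] in auto)
  qed
qed

section \<open>Affine space\<close>

definition affine_fractions ::
  "'k::field itself \<Rightarrow> 'i itself \<Rightarrow> ((('i \<Rightarrow> 'k alg_closure) \<Rightarrow> 'k alg_closure) \<times> (('i \<Rightarrow> 'k alg_closure) \<Rightarrow> 'k alg_closure)) set" where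
  "affine_fractions _ _ = {(mpoly_eval p, mpoly_eval q) | p q :: ('i, 'k) mpoly. True}"

lemma kpoints_affine_space [simp]:
  "kpoints (affine_space I :: ('i \<Rightarrow> 'k::field alg_closure, 'k) kspace) = affine_points I"
proof -
  have "x \<in> \<Union>(range (\<lambda>p :: ('i, 'k) mpoly. {x \<in> affine_points I. mpoly_eval p x \<noteq> 0}))"
    if "x \<in> affine_points I" for x
    using that by (intro UN_I[of 1]) auto
  then show ?thesis
    unfolding affine_space_def affine_top_def by auto
qed

lemma affine_space_fraction_space:
  "fraction_space (affine_space I :: ('i \<Rightarrow> 'k::field alg_closure, 'k) kspace) (affine_fractions TYPE('k) TYPE('i))"
proof -
  let ?X = "affine_space I :: ('i \<Rightarrow> 'k alg_closure, 'k) kspace"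
  let ?R = "affine_fractions TYPE('k) TYPE('i)"
  have R: "(n, d) \<in> ?R \<longleftrightarrow> (\<exists>p q. n = mpoly_eval p \<and> d = mpoly_eval q)" for n d
    by (simp add: affine_fractions_def)
  have "{{x \<in> kpoints ?X. n x \<noteq> 0} | n d. (n, d) \<in> ?R} =
      range (\<lambda>p :: ('i, 'k) mpoly. {x \<in> affine_points I. mpoly_eval p x \<noteq> 0})"
    unfolding R by auto
  then have 1: "ktop ?X = topology_generated_by {{x \<in> kpoints ?X. n x \<noteq> 0} | n d. (n, d) \<in> ?R}"
    by (simp add: affine_space_def affine_top_def)
  have 2: "kreg ?X U = {f. \<forall>x\<in>U. \<exists>V n d. openin (ktop ?X) V \<and> x \<in> V \<and> V \<subseteq> U \<and>
        (n, d) \<in> ?R \<and> (\<forall>y\<in>V. d y \<noteq> 0 \<and> f y = n y / d y)}" for U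
  proof -
    have "(\<exists>p q. openin T V \<and> x \<in> V \<and> V \<subseteq> U \<and> (\<forall>y\<in>V. mpoly_eval q y \<noteq> 0 \<and> f y = mpoly_eval p y / mpoly_eval q y)) \<longleftrightarrow>
      (\<exists>n d. openin T V \<and> x \<in> V \<and> V \<subseteq> U \<and> (n, d) \<in> ?R \<and> (\<forall>y\<in>V. d y \<noteq> 0 \<and> f y = n y / d y))" for f x V T
      unfolding affine_fractions_def by auto
    then show ?thesis
      by (simp add: affine_space_def)
  qed
  have 3: "(\<lambda>_. to_ac c, \<lambda>_. 1) \<in> ?R" for c
    unfolding R by (intro exI[of _ "mconst c"] exI[of _ 1]) auto
  have 4: "(n, d) \<in> ?R \<Longrightarrow> (d, n) \<in> ?R" for n d
    unfolding R by auto
  have 5: "(\<lambda>x. n x * d' x + n' x * d x, \<lambda>x. d x * d' x) \<in> ?R \<and> (\<lambda>x. n x * n' x, \<lambda>x. d x * d' x) \<in> ?R"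
    if "(n, d) \<in> ?R" "(n', d') \<in> ?R" for n d n' d'
  proof -
    from that obtain p q p' q' where "n = mpoly_eval p" "d = mpoly_eval q" "n' = mpoly_eval p'" "d' = mpoly_eval q'"
      unfolding R by auto
    then show ?thesis
      unfolding R
      by (intro conjI exI[of _ "p * q' + p' * q"] exI[of _ "p * p'"] exI[of _ "q * q'"]) auto
  qed
  show ?thesis
    by (rule fraction_spaceI[OF 1 2 3 4 conjunct1[OF 5] conjunct2[OF 5]])
qed

lemmas affine_space_regular = fraction_space_regular[OF affine_space_fraction_space]

lemmas affine_space_sheaf = fraction_space_sheaf[OF affine_space_fraction_space]

lemma regular_sheaf: "regular_space X \<Longrightarrow> function_sheaf X"
  by (simp add: regular_space_def)

lemma mpoly_eval_regular:
  assumes U: "openin (ktop (affine_space I)) U"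
  shows "mpoly_eval p \<in> kreg (affine_space I) U"
  by (rule fraction_space_kregI[OF affine_space_fraction_space U, of _ "mpoly_eval 1"])
     (auto simp: affine_fractions_def)

lemma coordinate_regular:
  assumes U: "openin (ktop (affine_space I)) U"
  shows "(\<lambda>x. x i) \<in> kreg (affine_space I) U"
  using mpoly_eval_regular[OF U, of "mvar i"] by (simp add: mpoly_eval_mvar[abs_def])

lemma kmorphism_into_affine_space:
  fixes X :: "('p, 'k::field) kspace" and c :: "'p \<Rightarrow> 'i \<Rightarrow> 'k alg_closure"
  assumes X: "regular_space X" and c: "\<And>i. (\<lambda>x. c x i) \<in> kreg X (kpoints X)"
    and pts: "\<And>x. x \<in> kpoints X \<Longrightarrow> c x \<in> affine_points I"
  shows "kmorphism X (affine_space I) c"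
proof (rule kmorphism_into_fraction_space[OF affine_space_fraction_space regular_sheaf[OF X]])
  show "c x \<in> kpoints (affine_space I)" if "x \<in> kpoints X" for x
    using pts[OF that] by simp
  fix n d :: "('i \<Rightarrow> 'k alg_closure) \<Rightarrow> 'k alg_closure"
  assume "(n, d) \<in> affine_fractions TYPE('k) TYPE('i)"
  then obtain p q where "n = mpoly_eval p" "d = mpoly_eval q"
    by (auto simp: affine_fractions_def)
  moreover have "(\<lambda>x. mpoly_eval p (c x)) \<in> kreg X (kpoints X)" for p
    by (rule regular_mpoly[OF X openin_topspace c])
  ultimately show "openin (ktop X) {x \<in> kpoints X. n (c x) \<noteq> 0}"
    "(\<lambda>x. n (c x) / d (c x)) \<in> kreg X {x \<in> kpoints X. d (c x) \<noteq> 0}"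
    using regular_nonzero_open[OF X openin_topspace] regular_divide[OF X openin_topspace] by simp_all
qed

lemma kreg_ksub_restrict:
  assumes "f \<in> kreg X V" "openin (ktop X) V" "U \<subseteq> V"
  shows "f \<in> kreg (ksub X A) U"
  by (rule kreg_ksubI[where V = "\<lambda>_. V" and g = "\<lambda>_. f"]) (use assms in auto)

lemma kreg_ksub_points:
  "f \<in> kreg X (kpoints X) \<Longrightarrow> f \<in> kreg (ksub X A) (kpoints (ksub X A))"
  by (erule kreg_ksub_restrict) auto

lemma regular_zero_closed:
  assumes X: "regular_space X" and f: "f \<in> kreg X (kpoints X)"
  shows "closedin (ktop X) {x \<in> kpoints X. f x = 0}"
proof -
  have "kpoints X - {x \<in> kpoints X. f x = 0} = {x \<in> kpoints X. f x \<noteq> 0}"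
    by auto
  then show ?thesis
    using regular_nonzero_open[OF X openin_topspace f] by (simp add: closedin_def)
qed

lemma affine_variety_iso:
  assumes "affine_variety X" "kisomorphic X Y"
  shows "affine_variety Y"
proof -
  obtain n :: nat and Z where Z: "closedin (ktop (affine_space {..<n})) Z" "kisomorphic X (ksub (affine_space {..<n}) Z)"
    using assms(1) unfolding affine_variety_def by (elim exE conjE)
  from kisomorphic_trans[OF kisomorphic_sym[OF assms(2)] Z(2)] Z(1) show ?thesis
    unfolding affine_variety_def by (intro exI conjI)
qed

text \<open>
  The open subset \<open>q \<noteq> 0\<close> is identified with the graph of \<open>1 / q\<close>, which is closed in an affine
  space with one more coordinate, here the one of index \<open>n\<close>.
\<close>

lemma affine_variety_basic_open:
  fixes q :: "('i, 'k::field) mpoly"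
  assumes I: "finite I" and C: "closedin (ktop (affine_space I :: ('i \<Rightarrow> 'k alg_closure, 'k) kspace)) C"
  shows "affine_variety (ksub (affine_space I) {x \<in> C. mpoly_eval q x \<noteq> 0})"
proof -
  define n where "n = card I"
  obtain e where e: "bij_betw e {..<n} I"
    using ex_bij_betw_nat_finite[OF I] by (auto simp: n_def atLeast0LessThan)
  define e' where "e' = inv_into {..<n} e"
  have e': "i \<in> I \<Longrightarrow> e' i < n \<and> e (e' i) = i" "k < n \<Longrightarrow> e' (e k) = k" "k < n \<Longrightarrow> e k \<in> I" for i k
    using bij_betw_inv_into_right[OF e] bij_betw_inv_into_left[OF e] bij_betwE[OF e]
      bij_betwE[OF bij_betw_inv_into[OF e]] by (auto simp: e'_def)
  let ?A = "{x \<in> C. mpoly_eval q x \<noteq> 0}"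
  let ?X = "ksub (affine_space I) ?A"
  let ?P = "affine_space {..<Suc n} :: (nat \<Rightarrow> 'k alg_closure, 'k) kspace"
  define \<phi> where "\<phi> x = (\<lambda>k. if k < n then x (e k) else if k = n then inverse (mpoly_eval q x) else 0)"
    for x :: "'i \<Rightarrow> 'k alg_closure"
  define \<psi> where "\<psi> y = (\<lambda>i. if i \<in> I then y (e' i) else 0)" for y :: "nat \<Rightarrow> 'k alg_closure"
  define Z where "Z = {y \<in> kpoints ?P. \<psi> y \<in> C} \<inter> {y \<in> kpoints ?P. mpoly_eval q (\<psi> y) * y n - 1 = 0}"
  have CI: "C \<subseteq> affine_points I"
    using closedin_subset[OF C] by simp
  have one: "(\<lambda>_. 1) \<in> kreg X (kpoints X)" and zero: "(\<lambda>_. 0) \<in> kreg X (kpoints X)"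
    if "regular_space X" for X :: "('p, 'k) kspace"
    using regular_const[OF that openin_topspace, of 1] regular_const[OF that openin_topspace, of 0]
    by simp_all
  have \<psi>coord: "(\<lambda>y. \<psi> y i) \<in> kreg ?P (kpoints ?P)" for i
    using coordinate_regular[OF openin_topspace, of "e' i" "{..<Suc n}"] zero[OF affine_space_regular]
    by (cases "i \<in> I") (simp_all add: \<psi>_def)
  have \<psi>: "kmorphism ?P (affine_space I) \<psi>"
    by (rule kmorphism_into_affine_space[OF affine_space_regular \<psi>coord])
       (simp add: \<psi>_def affine_points_def)
  have "closedin (ktop ?P) {y \<in> kpoints ?P. \<psi> y \<in> C}"
    by (rule closedin_continuous_map_preimage[OF kmorphism_continuous[OF \<psi>] C])
  moreover have "closedin (ktop ?P) {y \<in> kpoints ?P. mpoly_eval q (\<psi> y) * y n - 1 = 0}"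
    by (rule regular_zero_closed[OF affine_space_regular])
       (intro regular_diff[OF affine_space_regular openin_topspace] regular_mult[OF affine_space_regular openin_topspace]
          regular_mpoly[OF affine_space_regular openin_topspace] \<psi>coord coordinate_regular[OF openin_topspace]
          one[OF affine_space_regular])
  ultimately have Z: "closedin (ktop ?P) Z"
    unfolding Z_def by (rule closedin_Int)
  have X: "regular_space ?X"
    by (rule ksub_regular[OF affine_space_regular])
  have ptX: "kpoints ?X = ?A"
    using CI by auto
  have ptZ: "kpoints (ksub ?P Z) = Z"
    by (auto simp: Z_def)
  have mp: "mpoly_eval q \<in> kreg ?X (kpoints ?X)"
    by (rule kreg_ksub_points[OF mpoly_eval_regular[OF openin_topspace]])
  have "{x \<in> kpoints ?X. mpoly_eval q x \<noteq> 0} = kpoints ?X"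
    using ptX by auto
  with regular_inverse[OF X openin_topspace mp] have inv: "(\<lambda>x. inverse (mpoly_eval q x)) \<in> kreg ?X (kpoints ?X)"
    by simp
  have "kmorphism ?X ?P \<phi>"
  proof (rule kmorphism_into_affine_space[OF X])
    fix k
    consider "k < n" | "k = n" | "k > n" by linarith
    then show "(\<lambda>x. \<phi> x k) \<in> kreg ?X (kpoints ?X)"
    proof cases
      case 1
      then have "(\<lambda>x. \<phi> x k) = (\<lambda>x. x (e k))"
        by (simp add: \<phi>_def)
      then show ?thesis
        by (rule ssubst) (rule kreg_ksub_points[OF coordinate_regular[OF openin_topspace]])
    next
      case 2
      then have "(\<lambda>x. \<phi> x k) = (\<lambda>x. inverse (mpoly_eval q x))"
        by (simp add: \<phi>_def)
      then show ?thesis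
        by (rule ssubst) (rule inv)
    next
      case 3
      then have "(\<lambda>x. \<phi> x k) = (\<lambda>x. 0)"
        by (simp add: \<phi>_def)
      then show ?thesis
        by (rule ssubst) (rule zero[OF X])
    qed
  qed (simp add: \<phi>_def affine_points_def)
  moreover have \<psi>\<phi>: "\<psi> (\<phi> x) = x" if "x \<in> ?A" for x
    using that CI e' by (fastforce simp: \<psi>_def \<phi>_def affine_points_def)
  moreover have "\<phi> x \<in> kpoints ?P" for x
    by (simp add: \<phi>_def affine_points_def)
  ultimately have \<phi>: "kmorphism ?X (ksub ?P Z) \<phi>"
    by (intro kmorphism_into_ksub regular_sheaf[OF X]) (simp_all add: ptX Z_def \<phi>_def)
  have "kisomorphic ?X (ksub ?P Z)"
  proof (rule kisomorphicI[OF \<phi>])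
    show "kmorphism (ksub ?P Z) ?X \<psi>"
      by (rule kmorphism_ksub[OF \<psi> affine_space_sheaf]) (auto simp: Z_def)
    show "\<psi> (\<phi> x) = x" if "x \<in> kpoints ?X" for x
      using that \<psi>\<phi> ptX by simp
    show "\<phi> (\<psi> y) = y" if "y \<in> kpoints (ksub ?P Z)" for y
    proof
      fix k
      have y: "y \<in> Z"
        using that ptZ by simp
      then have inv: "mpoly_eval q (\<psi> y) * y n = 1" and supp: "y \<in> affine_points {..<Suc n}"
        by (auto simp: Z_def)
      consider "k < n" | "k = n" | "k > n" by linarith
      then show "\<phi> (\<psi> y) k = y k"
      proof cases
        case 2
        then show ?thesis
          using inv by (simp add: \<phi>_def inverse_unique)
      qed (use e' supp in \<open>auto simp: \<phi>_def \<psi>_def affine_points_def\<close>)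
    qed
  qed
  then show ?thesis
    using Z unfolding affine_variety_def by (intro exI conjI)
qed

section \<open>Prevarieties and separatedness\<close>

lemma affine_variety_regular:
  assumes "affine_variety X" "function_sheaf X"
  shows "regular_space X"
proof -
  obtain n :: nat and Z where "kisomorphic X (ksub (affine_space {..<n}) Z)"
    using assms(1) unfolding affine_variety_def by (elim exE conjE)
  then show ?thesis
    using kisomorphic_regular[OF kisomorphic_sym ksub_regular[OF affine_space_regular]] assms(2) by metis
qed

text \<open>
  All conditions are local, and on the members of an affine cover they are inherited from affine
  space.
\<close>

lemma prevariety_regular:
  assumes T: "prevariety T"
  shows "regular_space T"
proof -
  have sh: "function_sheaf T"
    using T by (simp add: prevariety_def)
  obtain \<U> where \<U>: "\<Union>\<U> = kpoints T" "\<forall>V\<in>\<U>. openin (ktop T) V \<and> affine_variety (ksub T V)"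
    using T unfolding prevariety_def by (elim conjE exE)
  have reg: "regular_space (ksub T V)" if "V \<in> \<U>" for V
    using affine_variety_regular[OF _ ksub_sheaf[OF sh]] \<U>(2) that by simp
  have cover: "\<exists>V\<in>\<U>. x \<in> U \<inter> V \<and> openin (ktop T) (U \<inter> V) \<and> openin (ktop (ksub T V)) (U \<inter> V)"
    if U: "openin (ktop T) U" and x: "x \<in> U" for x U
  proof -
    have "x \<in> \<Union>\<U>"
      using openin_subset[OF U] x \<U>(1) by auto
    then obtain V where V: "V \<in> \<U>" "x \<in> V" by blast
    moreover have "openin (ktop T) V"
      using \<U>(2) V by simp
    ultimately show ?thesis
      using U x by (intro bexI[of _ V]) (simp_all add: openin_Int openin_subtopology_Int)
  qed
  have glue: "f \<in> kreg T U" if U: "openin (ktop T) U"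
    and loc: "\<And>V. V \<in> \<U> \<Longrightarrow> openin (ktop T) (U \<inter> V) \<Longrightarrow> openin (ktop (ksub T V)) (U \<inter> V) \<Longrightarrow>
      f \<in> kreg (ksub T V) (U \<inter> V)" for f U
  proof (rule function_sheaf_glue[OF sh U])
    fix x assume "x \<in> U"
    from cover[OF U this] obtain V where V: "V \<in> \<U>" "x \<in> U \<inter> V" "openin (ktop T) (U \<inter> V)"
      "openin (ktop (ksub T V)) (U \<inter> V)" by auto
    have "f \<in> kreg T (U \<inter> V)"
      using loc[OF V(1,3,4)] kreg_ksub_open[OF sh V(3), of V f] by simp
    then show "\<exists>V. openin (ktop T) V \<and> x \<in> V \<and> V \<subseteq> U \<and> f \<in> kreg T V"
      using V(2,3) by (intro exI[of _ "U \<inter> V"] conjI) auto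
  qed
  show ?thesis
    unfolding regular_space_def
  proof (intro conjI allI impI ballI)
    show "function_sheaf T" by (rule sh)
    fix U assume U: "openin (ktop T) U"
    show "(\<lambda>_. to_ac c) \<in> kreg T U" for c
      by (rule glue[OF U]) (rule regular_const[OF reg])
    fix f assume f: "f \<in> kreg T U"
    have res: "g \<in> kreg (ksub T V) (U \<inter> V)" if "g \<in> kreg T U" for g V
      by (rule kreg_ksub_restrict[OF that U]) auto
    {
      fix g assume g: "g \<in> kreg T U"
      show "(\<lambda>x. f x + g x) \<in> kreg T U"
        by (rule glue[OF U]) (rule regular_add[OF reg _ res[OF f] res[OF g]])
      show "(\<lambda>x. f x * g x) \<in> kreg T U"
        by (rule glue[OF U]) (rule regular_mult[OF reg _ res[OF f] res[OF g]])
    }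
    show o: "openin (ktop T) {x \<in> U. f x \<noteq> 0}"
    proof (rule openin_pointwise)
      fix x assume x: "x \<in> {x \<in> U. f x \<noteq> 0}"
      from cover[OF U, of x] x obtain V where V: "V \<in> \<U>" "x \<in> U \<inter> V" "openin (ktop T) (U \<inter> V)"
        "openin (ktop (ksub T V)) (U \<inter> V)" by auto
      have "openin (ktop T) V"
        using \<U>(2) V(1) by simp
      then have "openin (ktop T) {x \<in> U \<inter> V. f x \<noteq> 0}"
        using regular_nonzero_open[OF reg[OF V(1)] V(4) res[OF f]]
        by (simp add: openin_open_subtopology)
      then show "\<exists>V. openin (ktop T) V \<and> x \<in> V \<and> V \<subseteq> {x \<in> U. f x \<noteq> 0}"
        using x V(2) by (intro exI[of _ "{x \<in> U \<inter> V. f x \<noteq> 0}"] conjI) auto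
    qed
    show "(\<lambda>x. inverse (f x)) \<in> kreg T {x \<in> U. f x \<noteq> 0}"
    proof (rule glue[OF o])
      fix V assume V: "V \<in> \<U>" "openin (ktop T) ({x \<in> U. f x \<noteq> 0} \<inter> V)"
        "openin (ktop (ksub T V)) ({x \<in> U. f x \<noteq> 0} \<inter> V)"
      have f': "f \<in> kreg (ksub T V) ({x \<in> U. f x \<noteq> 0} \<inter> V)"
        by (rule kreg_ksub_restrict[OF f U]) auto
      have eq: "{x \<in> {x \<in> U. f x \<noteq> 0} \<inter> V. f x \<noteq> 0} = {x \<in> U. f x \<noteq> 0} \<inter> V"
        by auto
      from regular_inverse[OF reg[OF V(1)] V(3) f']
      show "(\<lambda>x. inverse (f x)) \<in> kreg (ksub T V) ({x \<in> U. f x \<noteq> 0} \<inter> V)"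
        unfolding eq .
    qed
  qed
qed

text \<open>
  If \<open>f x * g y \<noteq> 1\<close> while \<open>f * g = 1\<close> on the overlap of the domains, then two morphisms with values
  \<open>x\<close> and \<open>y\<close> at a point differ on the open set where the product of the pullbacks of \<open>f\<close> and \<open>g\<close>
  is not \<open>1\<close>. On projective space, \<open>f\<close> and \<open>g\<close> can be taken to be ratios of two coordinates that
  are inverse to each other, even for points without a common coordinate chart.
\<close>

lemma separatedI:
  fixes X :: "('p, 'k::field) kspace"
  assumes sep: "\<And>x y. x \<in> kpoints X \<Longrightarrow> y \<in> kpoints X \<Longrightarrow> x \<noteq> y \<Longrightarrow>
    \<exists>U V f g. openin (ktop X) U \<and> openin (ktop X) V \<and> x \<in> U \<and> y \<in> V \<and> f \<in> kreg X U \<and> g \<in> kreg X V \<and>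
      f x * g y \<noteq> 1 \<and> (\<forall>z\<in>U \<inter> V. f z * g z = 1)"
  shows "separated X"
  unfolding separated_def
proof (intro allI impI, elim conjE)
  fix T :: "(nat \<Rightarrow> 'k alg_closure, 'k) kspace" and \<phi> \<psi>
  assume T: "prevariety T" and \<phi>: "kmorphism T X \<phi>" and \<psi>: "kmorphism T X \<psi>"
  have reg: "regular_space T"
    by (rule prevariety_regular[OF T])
  have "openin (ktop T) {t \<in> kpoints T. \<phi> t \<noteq> \<psi> t}"
  proof (rule openin_pointwise)
    fix t assume "t \<in> {t \<in> kpoints T. \<phi> t \<noteq> \<psi> t}"
    then have t: "t \<in> kpoints T" and ne: "\<phi> t \<noteq> \<psi> t" by auto
    obtain U V f g where U: "openin (ktop X) U" "\<phi> t \<in> U" "f \<in> kreg X U"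
      and V: "openin (ktop X) V" "\<psi> t \<in> V" "g \<in> kreg X V"
      and fg: "f (\<phi> t) * g (\<psi> t) \<noteq> 1" "\<forall>z\<in>U \<inter> V. f z * g z = 1"
      using sep[OF kmorphism_points[OF \<phi> t] kmorphism_points[OF \<psi> t] ne] by (elim exE conjE)
    let ?U = "{t \<in> kpoints T. \<phi> t \<in> U}" and ?V = "{t \<in> kpoints T. \<psi> t \<in> V}"
    have oU: "openin (ktop T) ?U" and oV: "openin (ktop T) ?V"
      by (rule kmorphism_open[OF \<phi> U(1)]) (rule kmorphism_open[OF \<psi> V(1)])
    have o: "openin (ktop T) (?U \<inter> ?V)"
      by (rule openin_Int[OF oU oV])
    have f': "(\<lambda>t. f (\<phi> t)) \<in> kreg T (?U \<inter> ?V)"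
      by (rule function_sheaf_restrict[OF regular_sheaf[OF reg] oU kmorphism_pullback[OF \<phi> U(1,3)] o]) auto
    have g': "(\<lambda>t. g (\<psi> t)) \<in> kreg T (?U \<inter> ?V)"
      by (rule function_sheaf_restrict[OF regular_sheaf[OF reg] oV kmorphism_pullback[OF \<psi> V(1,3)] o]) auto
    have one: "(\<lambda>_. 1) \<in> kreg T (?U \<inter> ?V)"
      using regular_const[OF reg o, of 1] by simp
    have "openin (ktop T) {t \<in> ?U \<inter> ?V. f (\<phi> t) * g (\<psi> t) - 1 \<noteq> 0}"
      by (rule regular_nonzero_open[OF reg o regular_diff[OF reg o regular_mult[OF reg o f' g'] one]])
    then show "\<exists>W. openin (ktop T) W \<and> t \<in> W \<and> W \<subseteq> {t \<in> kpoints T. \<phi> t \<noteq> \<psi> t}"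
      using t U(2) V(2) fg
      by (intro exI[of _ "{t \<in> ?U \<inter> ?V. f (\<phi> t) * g (\<psi> t) - 1 \<noteq> 0}"] conjI) auto
  qed
  moreover have "kpoints T - {t \<in> kpoints T. \<phi> t = \<psi> t} = {t \<in> kpoints T. \<phi> t \<noteq> \<psi> t}"
    by auto
  ultimately show "closedin (ktop T) {t \<in> kpoints T. \<phi> t = \<psi> t}"
    by (simp add: closedin_def)
qed

text \<open>
  In a closed embedding into affine space, two different points differ in some coordinate. That coordinate is non-zero at one of the points,
  and there its inverse serves as a partner in \<open>separatedI\<close>.
\<close>

lemma affine_is_variety:
  fixes X :: "('p, 'k::field) kspace"
  assumes aff: "affine_variety X" and sh: "function_sheaf X"
  shows "is_variety X"
  unfolding is_variety_def
proof
  have "affine_variety (ksub X (kpoints X))"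
    by (rule affine_variety_iso[OF aff kisomorphic_ksub_points[OF sh]])
  then show "prevariety X"
    unfolding prevariety_def using sh by (intro conjI exI[of _ "{kpoints X}"]) auto
  obtain n :: nat and Z where "kisomorphic X (ksub (affine_space {..<n}) Z)"
    using aff unfolding affine_variety_def by (elim exE conjE)
  then obtain \<phi> \<psi> where \<phi>: "kmorphism X (ksub (affine_space {..<n}) Z) \<phi>"
    and inv: "\<forall>x\<in>kpoints X. \<psi> (\<phi> x) = x"
    unfolding kisomorphic_def by (elim exE conjE)
  have reg: "regular_space X"
    by (rule affine_variety_regular[OF aff sh])
  note o = openin_topspace[of "ktop X"]
  show "separated X"
  proof (rule separatedI)
    fix x y assume x: "x \<in> kpoints X" and y: "y \<in> kpoints X" and "x \<noteq> y"
    then have "\<phi> x \<noteq> \<phi> y"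
      using inv by metis
    then obtain k where k: "\<phi> x k \<noteq> \<phi> y k"
      by auto
    have "{x \<in> kpoints X. \<phi> x \<in> kpoints (ksub (affine_space {..<n}) Z)} = kpoints X"
      using kmorphism_points[OF \<phi>] by auto
    then have f: "(\<lambda>x. \<phi> x k) \<in> kreg X (kpoints X)"
      using kmorphism_pullback[OF \<phi> openin_topspace kreg_ksub_points[OF coordinate_regular[OF openin_topspace, of k]]]
      by simp
    let ?U = "{x \<in> kpoints X. \<phi> x k \<noteq> 0}"
    have U: "openin (ktop X) ?U" and g: "(\<lambda>x. inverse (\<phi> x k)) \<in> kreg X ?U"
      by (rule regular_nonzero_open[OF reg o f]) (rule regular_inverse[OF reg o f])
    show "\<exists>U V f g. openin (ktop X) U \<and> openin (ktop X) V \<and> x \<in> U \<and> y \<in> V \<and> f \<in> kreg X U \<and> g \<in> kreg X V \<and>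
      f x * g y \<noteq> 1 \<and> (\<forall>z\<in>U \<inter> V. f z * g z = 1)"
    proof (cases "\<phi> x k = 0")
      case True
      with k have "\<phi> y k \<noteq> 0" by simp
      with f g U o x y True show ?thesis
        by (intro exI[of _ "kpoints X"] exI[of _ ?U] exI[of _ "\<lambda>x. \<phi> x k"] exI[of _ "\<lambda>x. inverse (\<phi> x k)"] conjI) auto
    next
      case False
      with f g U o x y k show ?thesis
        by (intro exI[of _ ?U] exI[of _ "kpoints X"] exI[of _ "\<lambda>x. inverse (\<phi> x k)"] exI[of _ "\<lambda>x. \<phi> x k"] conjI)
           (auto simp: field_simps)
    qed
  qed
qed

section \<open>Projective space\<close>

definition line :: "('i \<Rightarrow> 'a::field) \<Rightarrow> ('i \<Rightarrow> 'a) set" where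
  "line x = {(\<lambda>i. c * x i) | c. c \<noteq> 0}"

text \<open>
  A homogeneous condition can be tested on this single vector of the line, and a quotient of two
  forms of equal degree can be evaluated at it.
\<close>

definition line_rep :: "('i \<Rightarrow> 'a::field) set \<Rightarrow> 'i \<Rightarrow> 'a" where
  "line_rep L = (SOME x. x \<in> L)"

lemma line_self: "x \<in> line x"
  unfolding line_def by (intro CollectI exI[of _ 1]) auto

lemma line_in_proj_points: "x \<in> affine_points I \<Longrightarrow> x \<noteq> 0 \<Longrightarrow> line x \<in> proj_points I"
  unfolding proj_points_def line_def by auto

lemma line_rep_line:
  obtains c where "c \<noteq> 0" "line_rep (line x) = (\<lambda>i. c * x i)"
proof -
  have "line_rep (line x) \<in> line x"
    unfolding line_rep_def by (rule someI[of "\<lambda>y. y \<in> line x" x]) (rule line_self)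
  then show thesis
    using that unfolding line_def by auto
qed

lemma line_scale:
  assumes "c \<noteq> (0::'a::field)"
  shows "line (\<lambda>i. c * x i) = line x"
proof -
  have "\<exists>d'. (\<lambda>i. d * x i) = (\<lambda>i. d' * (c * x i)) \<and> d' \<noteq> 0" if "d \<noteq> 0" for d
    using that assms by (intro exI[of _ "d / c"]) auto
  moreover have "\<exists>d'. (\<lambda>i. d * (c * x i)) = (\<lambda>i. d' * x i) \<and> d' \<noteq> 0" if "d \<noteq> 0" for d
    using that assms by (intro exI[of _ "d * c"]) auto
  ultimately show ?thesis
    unfolding line_def by blast
qed

lemma line_rep_point:
  assumes "L \<in> proj_points I"
  shows "line (line_rep L) = L" "line_rep L \<in> affine_points I" "line_rep L \<noteq> 0" "line_rep L \<in> L"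
proof -
  obtain x where x: "L = line x" "x \<in> affine_points I" "x \<noteq> 0"
    using assms unfolding proj_points_def line_def by auto
  obtain c where c: "c \<noteq> 0" "line_rep L = (\<lambda>i. c * x i)"
    using line_rep_line[of x] x(1) by metis
  show "line (line_rep L) = L"
    using c line_scale[OF c(1)] x(1) by simp
  show "line_rep L \<in> affine_points I"
    using x(2) c by (simp add: affine_points_def)
  show "line_rep L \<in> L"
    using c x(1) by (auto simp: line_def)
  show "line_rep L \<noteq> 0"
    using x(3) c by (auto simp: fun_eq_iff)
qed

lemma proj_point_homogeneous:
  assumes "L \<in> proj_points I" "y \<in> L"
  obtains c where "c \<noteq> 0" "\<And>d p. homogeneous d p \<Longrightarrow> mpoly_eval p y = c ^ d * mpoly_eval p (line_rep L)"
proof -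
  have "y \<in> line (line_rep L)"
    using assms line_rep_point(1) by metis
  then obtain c where "c \<noteq> 0" "y = (\<lambda>i. c * line_rep L i)"
    unfolding line_def by auto
  then show thesis
    using that homogeneous_eval_scale by metis
qed

lemma proj_zeros_rep:
  assumes "homogeneous d p"
  shows "proj_zeros I p = {L \<in> proj_points I. mpoly_eval p (line_rep L) = 0}"
proof -
  have "(\<forall>x\<in>L. mpoly_eval p x = 0) \<longleftrightarrow> mpoly_eval p (line_rep L) = 0" if L: "L \<in> proj_points I" for L
  proof
    assume z: "mpoly_eval p (line_rep L) = 0"
    show "\<forall>x\<in>L. mpoly_eval p x = 0"
    proof
      fix x assume "x \<in> L"
      then obtain c where "c \<noteq> 0" "mpoly_eval p x = c ^ d * mpoly_eval p (line_rep L)"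
        using proj_point_homogeneous[OF L] assms by metis
      then show "mpoly_eval p x = 0"
        using z by simp
    qed
  qed (use line_rep_point(4)[OF L] in auto)
  then show ?thesis
    unfolding proj_zeros_def by auto
qed

definition proj_fractions ::
  "'k::field itself \<Rightarrow> 'i itself \<Rightarrow> ((('i \<Rightarrow> 'k alg_closure) set \<Rightarrow> 'k alg_closure) \<times> (('i \<Rightarrow> 'k alg_closure) set \<Rightarrow> 'k alg_closure)) set" where
  "proj_fractions _ _ = {(\<lambda>L. mpoly_eval p (line_rep L), \<lambda>L. mpoly_eval q (line_rep L)) | p q :: ('i, 'k) mpoly.
     \<exists>d. homogeneous d p \<and> homogeneous d q}"

lemma kpoints_proj_space [simp]:
  "kpoints (proj_space I :: (('i \<Rightarrow> 'k::field alg_closure) set, 'k) kspace) = proj_points I"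
proof -
  have "proj_zeros I (1 :: ('i, 'k) mpoly) = {}"
    by (simp add: proj_zeros_rep[OF homogeneous_one])
  then have "proj_points I \<in> {proj_points I - proj_zeros I p | p :: ('i, 'k) mpoly. \<exists>d. homogeneous d p}"
    using homogeneous_one by (intro CollectI exI[of _ 1] conjI exI[of _ 0]) simp_all
  then have "\<Union>{proj_points I - proj_zeros I p | p :: ('i, 'k) mpoly. \<exists>d. homogeneous d p} = proj_points I"
    by blast
  then show ?thesis
    unfolding proj_space_def proj_top_def by simp
qed

lemma proj_space_fraction_space:
  "fraction_space (proj_space I :: (('i \<Rightarrow> 'k::field alg_closure) set, 'k) kspace) (proj_fractions TYPE('k) TYPE('i))"
proof -
  let ?X = "proj_space I :: (('i \<Rightarrow> 'k alg_closure) set, 'k) kspace"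
  let ?R = "proj_fractions TYPE('k) TYPE('i)"
  have R: "(n, d) \<in> ?R \<longleftrightarrow> (\<exists>p q e. homogeneous e p \<and> homogeneous e q \<and>
      n = (\<lambda>L. mpoly_eval p (line_rep L)) \<and> d = (\<lambda>L. mpoly_eval q (line_rep L)))" for n d
    by (auto simp: proj_fractions_def)
  have "{{x \<in> kpoints ?X. n x \<noteq> 0} | n d. (n, d) \<in> ?R} =
      {proj_points I - proj_zeros I p | p :: ('i, 'k) mpoly. \<exists>d. homogeneous d p}" (is "?A = ?B")
  proof (intro equalityI subsetI)
    fix A assume "A \<in> ?A"
    then obtain p :: "('i, 'k) mpoly" and e where "homogeneous e p" "A = {L \<in> proj_points I. mpoly_eval p (line_rep L) \<noteq> 0}"
      unfolding R by auto
    moreover from this have "A = proj_points I - proj_zeros I p"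
      by (auto simp: proj_zeros_rep)
    ultimately show "A \<in> ?B" by auto
  next
    fix A assume "A \<in> ?B"
    then obtain p :: "('i, 'k) mpoly" and e where p: "homogeneous e p" "A = proj_points I - proj_zeros I p"
      by auto
    then have "A = {L \<in> kpoints ?X. mpoly_eval p (line_rep L) \<noteq> 0}"
      by (auto simp: proj_zeros_rep)
    moreover have "(\<lambda>L. mpoly_eval p (line_rep L), \<lambda>L. mpoly_eval p (line_rep L)) \<in> ?R"
      unfolding R using p(1) by auto
    ultimately show "A \<in> ?A"
      by (intro CollectI exI[of _ "\<lambda>L. mpoly_eval p (line_rep L)"] conjI)
  qed
  then have 1: "ktop ?X = topology_generated_by {{x \<in> kpoints ?X. n x \<noteq> 0} | n d. (n, d) \<in> ?R}"
    by (simp add: proj_space_def proj_top_def)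
  have 2: "kreg ?X U = {f. \<forall>x\<in>U. \<exists>V n d. openin (ktop ?X) V \<and> x \<in> V \<and> V \<subseteq> U \<and>
        (n, d) \<in> ?R \<and> (\<forall>y\<in>V. d y \<noteq> 0 \<and> f y = n y / d y)}" if "openin (ktop ?X) U" for U
  proof -
    have loc: "(\<forall>M\<in>V. \<forall>y\<in>M. mpoly_eval q y \<noteq> 0 \<and> f M = mpoly_eval p y / mpoly_eval q y) \<longleftrightarrow>
        (\<forall>M\<in>V. mpoly_eval q (line_rep M) \<noteq> 0 \<and> f M = mpoly_eval p (line_rep M) / mpoly_eval q (line_rep M))"
      if V: "V \<subseteq> proj_points I" and hom: "homogeneous d p" "homogeneous d q"
      for V f d and p q :: "('i, 'k) mpoly"
    proof (rule ball_cong[OF refl])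
      fix M assume "M \<in> V"
      then have M: "M \<in> proj_points I"
        using V by auto
      have "mpoly_eval q y \<noteq> 0 \<and> f M = mpoly_eval p y / mpoly_eval q y \<longleftrightarrow>
        mpoly_eval q (line_rep M) \<noteq> 0 \<and> f M = mpoly_eval p (line_rep M) / mpoly_eval q (line_rep M)"
        if y: "y \<in> M" for y
      proof -
        obtain c where "c \<noteq> 0" "mpoly_eval p y = c ^ d * mpoly_eval p (line_rep M)"
          "mpoly_eval q y = c ^ d * mpoly_eval q (line_rep M)"
          using proj_point_homogeneous[OF M y] hom by metis
        then show ?thesis
          by simp
      qed
      then show "(\<forall>y\<in>M. mpoly_eval q y \<noteq> 0 \<and> f M = mpoly_eval p y / mpoly_eval q y) \<longleftrightarrow>
        mpoly_eval q (line_rep M) \<noteq> 0 \<and> f M = mpoly_eval p (line_rep M) / mpoly_eval q (line_rep M)"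
        using line_rep_point(4)[OF M] by blast
    qed
    have top: "proj_top TYPE('k) I = ktop ?X"
      by (simp add: proj_space_def)
    have "(\<exists>(p :: ('i, 'k) mpoly) q d. openin (ktop ?X) V \<and> x \<in> V \<and> V \<subseteq> U \<and> homogeneous d p \<and> homogeneous d q \<and>
        (\<forall>M\<in>V. \<forall>y\<in>M. mpoly_eval q y \<noteq> 0 \<and> f M = mpoly_eval p y / mpoly_eval q y)) \<longleftrightarrow>
      (\<exists>n d. openin (ktop ?X) V \<and> x \<in> V \<and> V \<subseteq> U \<and> (n, d) \<in> ?R \<and> (\<forall>y\<in>V. d y \<noteq> 0 \<and> f y = n y / d y))"
      (is "?l \<longleftrightarrow> ?r") for f V x
    proof
      assume ?l
      then obtain p q :: "('i, 'k) mpoly" and d where *: "openin (ktop ?X) V" "x \<in> V" "V \<subseteq> U" "homogeneous d p" "homogeneous d q"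
        "\<forall>M\<in>V. \<forall>y\<in>M. mpoly_eval q y \<noteq> 0 \<and> f M = mpoly_eval p y / mpoly_eval q y"
        by (elim exE conjE)
      have V: "V \<subseteq> proj_points I"
        using openin_subset[OF *(1)] by simp
      have "(\<lambda>L. mpoly_eval p (line_rep L), \<lambda>L. mpoly_eval q (line_rep L)) \<in> ?R"
        unfolding R using *(4,5) by auto
      moreover note *(6)[unfolded loc[OF V *(4,5)]]
      ultimately show ?r
        using *(1-3) by (intro exI conjI)
    next
      assume ?r
      then obtain n d where *: "openin (ktop ?X) V" "x \<in> V" "V \<subseteq> U" "(n, d) \<in> ?R" "\<forall>y\<in>V. d y \<noteq> 0 \<and> f y = n y / d y"
        by (elim exE conjE)
      obtain p q e where pq: "homogeneous e p" "homogeneous e q" "n = (\<lambda>L. mpoly_eval p (line_rep L))" "d = (\<lambda>L. mpoly_eval q (line_rep L))"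
        using *(4) unfolding R by (elim exE conjE)
      have V: "V \<subseteq> proj_points I"
        using openin_subset[OF *(1)] by simp
      have "\<forall>M\<in>V. \<forall>y\<in>M. mpoly_eval q y \<noteq> 0 \<and> f M = mpoly_eval p y / mpoly_eval q y"
        unfolding loc[OF V pq(1,2)] using *(5) unfolding pq(3,4) .
      then show ?l
        using *(1-3) pq(1,2) by (intro exI conjI)
    qed
    then show ?thesis
      by (simp add: top[symmetric]) (simp add: proj_space_def)
  qed
  have 3: "(\<lambda>_. to_ac c, \<lambda>_. 1) \<in> ?R" for c
    unfolding R by (intro exI[of _ "mconst c"] exI[of _ 1] exI[of _ 0]) auto
  have 4: "(n, d) \<in> ?R \<Longrightarrow> (d, n) \<in> ?R" for n d
    unfolding R by auto
  have 5: "(\<lambda>x. n x * d' x + n' x * d x, \<lambda>x. d x * d' x) \<in> ?R \<and> (\<lambda>x. n x * n' x, \<lambda>x. d x * d' x) \<in> ?R"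
    if "(n, d) \<in> ?R" "(n', d') \<in> ?R" for n d n' d'
  proof -
    from that(1) obtain p q e where 1: "homogeneous e p" "homogeneous e q"
      "n = (\<lambda>L. mpoly_eval p (line_rep L))" "d = (\<lambda>L. mpoly_eval q (line_rep L))"
      unfolding R by (elim exE conjE)
    from that(2) obtain p' q' e' where 2: "homogeneous e' p'" "homogeneous e' q'"
      "n' = (\<lambda>L. mpoly_eval p' (line_rep L))" "d' = (\<lambda>L. mpoly_eval q' (line_rep L))"
      unfolding R by (elim exE conjE)
    have "homogeneous (e + e') (p * q' + p' * q)" "homogeneous (e + e') (p * p')" "homogeneous (e + e') (q * q')"
      using homogeneous_add[OF homogeneous_mult[OF 1(1) 2(2)], of "p' * q"] homogeneous_mult[OF 2(1) 1(2)]
        homogeneous_mult[OF 1(1) 2(1)] homogeneous_mult[OF 1(2) 2(2)] by (simp_all add: add.commute)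
    then show ?thesis
      unfolding R 1(3,4) 2(3,4)
      by (intro conjI exI[of _ "p * q' + p' * q"] exI[of _ "p * p'"] exI[of _ "q * q'"] exI[of _ "e + e'"]) auto
  qed
  show ?thesis
    by (rule fraction_spaceI[OF 1 2 3 4 conjunct1[OF 5] conjunct2[OF 5]])
qed

lemmas proj_space_regular = fraction_space_regular[OF proj_space_fraction_space]

lemmas proj_space_sheaf = fraction_space_sheaf[OF proj_space_fraction_space]

lemma proj_fraction_open:
  fixes p :: "('i, 'k::field) mpoly"
  assumes "homogeneous d p"
  shows "openin (ktop (proj_space I)) {L \<in> proj_points I. mpoly_eval p (line_rep L) \<noteq> 0}"
proof -
  have "(\<lambda>L. mpoly_eval p (line_rep L), \<lambda>L. mpoly_eval p (line_rep L)) \<in> proj_fractions TYPE('k) TYPE('i)"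
    using assms by (auto simp: proj_fractions_def)
  from fraction_space_open[OF proj_space_fraction_space this, of I] show ?thesis
    by simp
qed

lemma proj_fraction_regular:
  fixes p q :: "('i, 'k::field) mpoly"
  assumes "homogeneous d p" "homogeneous d q"
  shows "(\<lambda>L. mpoly_eval p (line_rep L) / mpoly_eval q (line_rep L)) \<in>
    kreg (proj_space I) {L \<in> proj_points I. mpoly_eval q (line_rep L) \<noteq> 0}"
proof -
  have "(\<lambda>L. mpoly_eval p (line_rep L), \<lambda>L. mpoly_eval q (line_rep L)) \<in> proj_fractions TYPE('k) TYPE('i)"
    using assms by (auto simp: proj_fractions_def)
  from fraction_space_kregI[OF proj_space_fraction_space proj_fraction_open[OF assms(2)] this] show ?thesis
    by simp
qed

lemma proj_coordinate_open:
  "openin (ktop (proj_space I :: (('i \<Rightarrow> 'k::field alg_closure) set, 'k) kspace)) {L \<in> proj_points I. line_rep L i \<noteq> 0}"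
  using proj_fraction_open[OF homogeneous_mvar, of I i] by simp

lemma proj_coordinate_regular:
  "(\<lambda>L. line_rep L j / line_rep L i) \<in>
    kreg (proj_space I :: (('i \<Rightarrow> 'k::field alg_closure) set, 'k) kspace) {L \<in> proj_points I. line_rep L i \<noteq> 0}"
  using proj_fraction_regular[OF homogeneous_mvar homogeneous_mvar, of j i I] by simp

lemma kmorphism_into_proj_space:
  fixes X :: "('p, 'k::field) kspace"
  assumes X: "function_sheaf X" and pts: "\<And>x. x \<in> kpoints X \<Longrightarrow> \<phi> x \<in> proj_points I"
    and op: "\<And>(p :: ('i, 'k) mpoly) d. homogeneous d p \<Longrightarrow>
      openin (ktop X) {x \<in> kpoints X. mpoly_eval p (line_rep (\<phi> x)) \<noteq> 0}"
    and reg: "\<And>(p :: ('i, 'k) mpoly) q d. homogeneous d p \<Longrightarrow> homogeneous d q \<Longrightarrow>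
      (\<lambda>x. mpoly_eval p (line_rep (\<phi> x)) / mpoly_eval q (line_rep (\<phi> x))) \<in>
        kreg X {x \<in> kpoints X. mpoly_eval q (line_rep (\<phi> x)) \<noteq> 0}"
  shows "kmorphism X (proj_space I) \<phi>"
proof (rule kmorphism_into_fraction_space[OF proj_space_fraction_space X])
  show "\<phi> x \<in> kpoints (proj_space I)" if "x \<in> kpoints X" for x
    using pts[OF that] by simp
  fix n d :: "('i \<Rightarrow> 'k alg_closure) set \<Rightarrow> 'k alg_closure"
  assume "(n, d) \<in> proj_fractions TYPE('k) TYPE('i)"
  then obtain p q e where "homogeneous e p" "homogeneous e q"
    "n = (\<lambda>L. mpoly_eval p (line_rep L))" "d = (\<lambda>L. mpoly_eval q (line_rep L))"
    by (auto simp: proj_fractions_def)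
  then show "openin (ktop X) {x \<in> kpoints X. n (\<phi> x) \<noteq> 0}"
    "(\<lambda>x. n (\<phi> x) / d (\<phi> x)) \<in> kreg X {x \<in> kpoints X. d (\<phi> x) \<noteq> 0}"
    using op reg by simp_all
qed

text \<open>
  The representative chosen for the line through \<open>c x\<close> differs from \<open>c x\<close> by a scalar, which
  affects neither the vanishing of a form nor a quotient of forms of equal degree.
\<close>

lemma kmorphism_line:
  fixes X :: "('p, 'k::field) kspace" and c :: "'p \<Rightarrow> 'i \<Rightarrow> 'k alg_closure"
  assumes X: "regular_space X" and c: "\<And>i. (\<lambda>x. c x i) \<in> kreg X (kpoints X)"
    and pts: "\<And>x. x \<in> kpoints X \<Longrightarrow> c x \<in> affine_points I" "\<And>x. x \<in> kpoints X \<Longrightarrow> c x \<noteq> 0"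
  shows "kmorphism X (proj_space I) (\<lambda>x. line (c x))"
proof (rule kmorphism_into_proj_space[OF regular_sheaf[OF X]])
  show "line (c x) \<in> proj_points I" if "x \<in> kpoints X" for x
    by (rule line_in_proj_points[OF pts[OF that]])
  note o = openin_topspace[of "ktop X"]
  have p: "(\<lambda>x. mpoly_eval p (c x)) \<in> kreg X (kpoints X)" for p
    by (rule regular_mpoly[OF X o c])
  have sc: "mpoly_eval p (line_rep (line (c x))) \<noteq> 0 \<longleftrightarrow> mpoly_eval p (c x) \<noteq> 0"
    if "homogeneous d p" for x d and p :: "('i, 'k) mpoly"
    by (rule line_rep_line[of "c x"]) (simp add: homogeneous_eval_scale[OF that])
  show "openin (ktop X) {x \<in> kpoints X. mpoly_eval p (line_rep (line (c x))) \<noteq> 0}"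
    if "homogeneous d p" for d and p :: "('i, 'k) mpoly"
    unfolding sc[OF that] by (rule regular_nonzero_open[OF X o p])
  fix p q :: "('i, 'k) mpoly" and d assume p': "homogeneous d p" and q': "homogeneous d q"
  have "mpoly_eval p (line_rep (line (c x))) / mpoly_eval q (line_rep (line (c x))) = mpoly_eval p (c x) / mpoly_eval q (c x)" for x
    by (rule line_rep_line[of "c x"]) (simp add: homogeneous_eval_scale[OF p'] homogeneous_eval_scale[OF q'])
  then show "(\<lambda>x. mpoly_eval p (line_rep (line (c x))) / mpoly_eval q (line_rep (line (c x)))) \<in>
        kreg X {x \<in> kpoints X. mpoly_eval q (line_rep (line (c x))) \<noteq> 0}"
    unfolding sc[OF q'] using regular_divide[OF X o p p] by simp
qed

text \<open>
  Each line with \<open>x\<^sub>i \<noteq> 0\<close> contains a unique vector with \<open>x\<^sub>i = 1\<close>.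
\<close>

lemma kisomorphic_chart:
  fixes p :: "('i, 'k::field) mpoly"
  assumes i: "i \<in> I" and p: "homogeneous d p"
  shows "kisomorphic (ksub (proj_space I) {L \<in> proj_points I. mpoly_eval p (line_rep L) \<noteq> 0 \<and> line_rep L i \<noteq> 0})
    (ksub (affine_space I) {x \<in> affine_points I. x i = 1 \<and> mpoly_eval p x \<noteq> 0})"
proof -
  let ?A = "{L \<in> proj_points I. mpoly_eval p (line_rep L) \<noteq> 0 \<and> line_rep L i \<noteq> 0}"
  let ?B = "{x \<in> affine_points I. x i = 1 \<and> mpoly_eval p x \<noteq> 0}"
  let ?X = "ksub (proj_space I) ?A" and ?Y = "ksub (affine_space I) ?B"
  let ?\<phi> = "\<lambda>L j. line_rep L j / line_rep L i"
  have X: "regular_space ?X" and Y: "regular_space ?Y"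
    by (rule ksub_regular[OF proj_space_regular], rule ksub_regular[OF affine_space_regular])
  have ptX: "kpoints ?X = ?A" and ptY: "kpoints ?Y = ?B"
    by auto
  have pA: "mpoly_eval p (?\<phi> L) \<noteq> 0 \<longleftrightarrow> mpoly_eval p (line_rep L) \<noteq> 0" if "line_rep L i \<noteq> 0" for L
    using that homogeneous_eval_scale[OF p, of "inverse (line_rep L i)" "line_rep L"]
    by (simp add: divide_inverse mult.commute)
  have aff: "?\<phi> L \<in> affine_points I" if "L \<in> proj_points I" for L
    using line_rep_point(2)[OF that] by (simp add: affine_points_def)
  have "kmorphism ?X (affine_space I) ?\<phi>"
  proof (rule kmorphism_into_affine_space[OF X])
    show "(\<lambda>L. line_rep L j / line_rep L i) \<in> kreg ?X (kpoints ?X)" for j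
      by (rule kreg_ksub_restrict[OF proj_coordinate_regular proj_coordinate_open]) auto
    show "?\<phi> L \<in> affine_points I" if "L \<in> kpoints ?X" for L
      using that by (auto intro: aff)
  qed
  then have 1: "kmorphism ?X ?Y ?\<phi>"
    by (rule kmorphism_into_ksub[OF _ regular_sheaf[OF X]]) (use aff pA in auto)
  have ne: "x \<noteq> 0" if "x i = 1" for x :: "'i \<Rightarrow> 'k alg_closure"
    using that by (metis zero_fun_apply zero_neq_one)
  have "kmorphism ?Y (proj_space I) (\<lambda>x. line x)"
    by (rule kmorphism_line[OF Y kreg_ksub_points[OF coordinate_regular[OF openin_topspace]]])
       (use ne in auto)
  then have 2: "kmorphism ?Y ?X (\<lambda>x. line x)"
  proof (rule kmorphism_into_ksub[OF _ regular_sheaf[OF Y]])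
    fix x assume "x \<in> kpoints ?Y"
    then have x: "x \<in> affine_points I" "x i = 1" "mpoly_eval p x \<noteq> 0"
      by auto
    obtain c where "c \<noteq> 0" "line_rep (line x) = (\<lambda>i. c * x i)"
      by (rule line_rep_line)
    then show "line x \<in> ?A"
      using x line_in_proj_points[OF x(1) ne[of x, OF x(2)]] by (simp add: homogeneous_eval_scale[OF p])
  qed
  show ?thesis
  proof (rule kisomorphicI[OF 1 2])
    fix L assume "L \<in> kpoints ?X"
    then have L: "L \<in> proj_points I" "line_rep L i \<noteq> 0" by auto
    have "line (\<lambda>j. inverse (line_rep L i) * line_rep L j) = line (line_rep L)"
      by (rule line_scale) (use L in auto)
    then show "line (?\<phi> L) = L"
      using line_rep_point(1)[OF L(1)] by (simp add: divide_inverse mult.commute)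
  next
    fix x assume "x \<in> kpoints ?Y"
    then have x: "x i = 1" by auto
    obtain c where "c \<noteq> 0" "line_rep (line x) = (\<lambda>i. c * x i)"
      by (rule line_rep_line)
    then show "?\<phi> (line x) = x"
      using x by simp
  qed
qed

section \<open>Complements of projective hypersurfaces are varieties\<close>

definition proj_compl :: "'i set \<Rightarrow> ('i, 'k::field) mpoly \<Rightarrow> (('i \<Rightarrow> 'k alg_closure) set, 'k) kspace" where
  "proj_compl I p = ksub (proj_space I) {L \<in> proj_points I. mpoly_eval p (line_rep L) \<noteq> 0}"

lemma proj_compl_sheaf: "function_sheaf (proj_compl I p)"
  unfolding proj_compl_def by (rule ksub_sheaf[OF proj_space_sheaf])

lemma affine_variety_chart:
  fixes p :: "('i, 'k::field) mpoly"
  assumes I: "finite I"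
  shows "affine_variety (ksub (affine_space I) {x \<in> affine_points I. x i = 1 \<and> mpoly_eval p x \<noteq> 0})"
proof -
  note o = openin_topspace[of "ktop (affine_space I :: ('i \<Rightarrow> 'k alg_closure, 'k) kspace)"]
  have "(\<lambda>x. x i - to_ac 1) \<in> kreg (affine_space I :: ('i \<Rightarrow> 'k alg_closure, 'k) kspace) (kpoints (affine_space I))"
    by (rule regular_diff[OF affine_space_regular o coordinate_regular[OF o] regular_const[OF affine_space_regular o]])
  from affine_variety_basic_open[OF I regular_zero_closed[OF affine_space_regular this], of p] show ?thesis
    by (simp add: conj_assoc)
qed

text \<open>
  The coordinate charts give the affine cover. Two distinct lines have a non-vanishing two by two
  minor \<open>x\<^sub>i y\<^sub>j - x\<^sub>j y\<^sub>i\<close>, and after exchanging \<open>i\<close> and \<open>j\<close> the product \<open>x\<^sub>i y\<^sub>j\<close> is non-zero, so that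
  the ratio of the \<open>j\<close>-th to the \<open>i\<close>-th coordinate near \<open>x\<close> and its inverse near \<open>y\<close> are the functions
  required by \<open>separatedI\<close>.
\<close>

lemma proj_compl_is_variety:
  fixes p :: "('i, 'k::field) mpoly"
  assumes I: "finite I" and p: "homogeneous d p"
  shows "is_variety (proj_compl I p)"
  unfolding is_variety_def
proof
  let ?X = "proj_compl I p"
  let ?D = "{L \<in> proj_points I. mpoly_eval p (line_rep L) \<noteq> 0}"
  let ?U = "\<lambda>i. {L \<in> proj_points I. line_rep L i \<noteq> 0}"
  have pt: "kpoints ?X = ?D"
    by (auto simp: proj_compl_def)
  have sh: "function_sheaf ?X"
    by (rule proj_compl_sheaf)
  have ex: "\<exists>i\<in>I. line_rep L i \<noteq> 0" if "L \<in> proj_points I" for L :: "('i \<Rightarrow> 'k alg_closure) set"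
    using line_rep_point(2,3)[OF that] by (auto simp: affine_points_def fun_eq_iff)
  have o: "openin (ktop ?X) (?D \<inter> ?U i)" for i
    unfolding proj_compl_def ktop_ksub
    by (subst Int_commute) (rule openin_subtopology_Int[OF proj_coordinate_open])
  have "affine_variety (ksub ?X (?D \<inter> ?U i))" if "i \<in> I" for i
  proof -
    have eq: "?D \<inter> (?D \<inter> ?U i) = {L \<in> proj_points I. mpoly_eval p (line_rep L) \<noteq> 0 \<and> line_rep L i \<noteq> 0}"
      by auto
    have "kisomorphic (ksub ?X (?D \<inter> ?U i)) (ksub (affine_space I) {x \<in> affine_points I. x i = 1 \<and> mpoly_eval p x \<noteq> 0})"
      unfolding proj_compl_def
      by (rule kisomorphic_trans[OF kisomorphic_ksub_ksub[OF proj_space_sheaf]])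
         (unfold eq, rule kisomorphic_chart[OF that p])
    then show ?thesis
      by (rule affine_variety_iso[OF affine_variety_chart[OF I] kisomorphic_sym])
  qed
  then show "prevariety ?X"
    unfolding prevariety_def using sh I o ex pt
    by (intro conjI exI[of _ "(\<lambda>i. ?D \<inter> ?U i) ` I"]) auto
  show "separated ?X"
  proof (rule separatedI)
    fix L M assume "L \<in> kpoints ?X" "M \<in> kpoints ?X" and ne: "L \<noteq> M"
    then have L: "L \<in> ?D" and M: "M \<in> ?D"
      using pt by auto
    have "\<exists>i j. line_rep L i * line_rep M j \<noteq> line_rep L j * line_rep M i"
    proof (rule ccontr)
      assume "\<nexists>i j. line_rep L i * line_rep M j \<noteq> line_rep L j * line_rep M i"
      then have eq: "line_rep L i * line_rep M j = line_rep L j * line_rep M i" for i j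
        by auto
      obtain i where i: "line_rep L i \<noteq> 0"
        using ex L by blast
      obtain k where k: "line_rep M k \<noteq> 0"
        using ex M by blast
      have "line_rep M i \<noteq> 0"
        using eq[of i k] i k by auto
      moreover have "line_rep M = (\<lambda>j. (line_rep M i / line_rep L i) * line_rep L j)"
        using eq[of i] i by (auto simp: field_simps)
      ultimately have "line (line_rep M) = line (line_rep L)"
        using line_scale[of "line_rep M i / line_rep L i" "line_rep L"] i by simp
      then show False
        using ne line_rep_point(1) L M by auto
    qed
    then obtain i j where ij: "line_rep L i * line_rep M j \<noteq> line_rep L j * line_rep M i" "line_rep L i \<noteq> 0" "line_rep M j \<noteq> 0"
      by (metis mult_eq_0_iff)
    have reg: "(\<lambda>L. line_rep L j / line_rep L i) \<in> kreg ?X (?D \<inter> ?U i)" for i j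
      unfolding proj_compl_def by (rule kreg_ksub_restrict[OF proj_coordinate_regular proj_coordinate_open]) auto
    show "\<exists>U V f g. openin (ktop ?X) U \<and> openin (ktop ?X) V \<and> L \<in> U \<and> M \<in> V \<and> f \<in> kreg ?X U \<and> g \<in> kreg ?X V \<and>
      f L * g M \<noteq> 1 \<and> (\<forall>z\<in>U \<inter> V. f z * g z = 1)"
      by (intro exI[of _ "?D \<inter> ?U i"] exI[of _ "?D \<inter> ?U j"] exI[of _ "\<lambda>L. line_rep L j / line_rep L i"]
          exI[of _ "\<lambda>L. line_rep L i / line_rep L j"] conjI o reg)
         (use L M ij in \<open>auto simp: field_simps\<close>)
  qed
qed

section \<open>Varieties with points of another type\<close>

lemma is_variety_iso:
  fixes X :: "('p, 'k::field) kspace" and Y :: "('q, 'k) kspace"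
  assumes X: "is_variety X" and iso: "kisomorphic X Y" and sh: "function_sheaf Y"
  shows "is_variety Y"
proof -
  obtain \<phi> \<psi> where \<phi>: "kmorphism X Y \<phi>" and \<psi>: "kmorphism Y X \<psi>"
    and inv: "\<forall>x\<in>kpoints X. \<psi> (\<phi> x) = x" "\<forall>y\<in>kpoints Y. \<phi> (\<psi> y) = y"
    using iso unfolding kisomorphic_def by (elim exE conjE)
  have shX: "function_sheaf X"
    using X by (simp add: is_variety_def prevariety_def)
  obtain \<U> where fin: "finite \<U>" and \<U>: "\<Union>\<U> = kpoints X" "\<forall>V\<in>\<U>. openin (ktop X) V \<and> affine_variety (ksub X V)"
    using X unfolding is_variety_def prevariety_def by (elim conjE exE)
  have "affine_variety (ksub Y {y \<in> kpoints Y. \<psi> y \<in> V})" if "V \<in> \<U>" for V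
    by (rule affine_variety_iso[of "ksub X V"], use \<U>(2) that in simp, rule kisomorphic_ksub[OF \<phi> \<psi>])
       (use inv shX sh kmorphism_points[OF \<phi>] in auto)
  moreover have "(\<Union>V\<in>\<U>. {y \<in> kpoints Y. \<psi> y \<in> V}) = kpoints Y"
    using kmorphism_points[OF \<psi>] \<U>(1) by auto
  moreover have "openin (ktop Y) {y \<in> kpoints Y. \<psi> y \<in> V}" if "V \<in> \<U>" for V
    by (rule kmorphism_open[OF \<psi>]) (use \<U>(2) that in simp)
  ultimately have "prevariety Y"
    unfolding prevariety_def using sh fin
    by (intro conjI exI[of _ "(\<lambda>V. {y \<in> kpoints Y. \<psi> y \<in> V}) ` \<U>"]) auto
  moreover have "separated Y"
    unfolding separated_def
  proof (intro allI impI, elim conjE)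
    fix T :: "(nat \<Rightarrow> 'k alg_closure, 'k) kspace" and \<alpha> \<beta>
    assume T: "prevariety T" and \<alpha>: "kmorphism T Y \<alpha>" and \<beta>: "kmorphism T Y \<beta>"
    have "closedin (ktop T) {t \<in> kpoints T. \<psi> (\<alpha> t) = \<psi> (\<beta> t)}"
      using X kmorphism_compose[OF \<alpha> \<psi>] kmorphism_compose[OF \<beta> \<psi>] T
      unfolding is_variety_def separated_def by simp
    moreover have "{t \<in> kpoints T. \<psi> (\<alpha> t) = \<psi> (\<beta> t)} = {t \<in> kpoints T. \<alpha> t = \<beta> t}"
      using kmorphism_points[OF \<alpha>] kmorphism_points[OF \<beta>] inv by metis
    ultimately show "closedin (ktop T) {t \<in> kpoints T. \<alpha> t = \<beta> t}"
      by simp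
  qed
  ultimately show ?thesis
    by (simp add: is_variety_def)
qed

text \<open>
  The generators of the Grothendieck ring have points of a fixed type; structures with other points
  are moved there along an injection.
\<close>

lemma kspace_relabel:
  fixes X :: "('p, 'k::field) kspace" and j :: "'p \<Rightarrow> 'q"
  assumes sh: "function_sheaf X" and inj: "inj_on j (kpoints X)"
  obtains Y :: "('q, 'k) kspace" where "function_sheaf Y" "kisomorphic X Y"
proof -
  define h where "h = inv_into (kpoints X) j"
  have hj: "h (j x) = x" if "x \<in> kpoints X" for x
    using inv_into_f_f[OF inj that] by (simp add: h_def)
  have jh: "j (h y) = y" "h y \<in> kpoints X" if "y \<in> j ` kpoints X" for y
    using that by (auto simp: hj)
  \<comment> \<open>open sets and regular functions of \<open>Y\<close> are those whose pullbacks along \<open>j\<close> are so on \<open>X\<close>\<close>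
  define pre where "pre V = {x \<in> kpoints X. j x \<in> V}" for V
  define Y :: "('q, 'k) kspace" where
    "Y = \<lparr>ktop = pullback_topology (j ` kpoints X) h (ktop X), kreg = \<lambda>V. {f. (\<lambda>x. f (j x)) \<in> kreg X (pre V)}\<rparr>"
  have open_iff: "openin (ktop Y) V \<longleftrightarrow> V \<subseteq> j ` kpoints X \<and> openin (ktop X) (pre V)" for V
  proof
    assume "openin (ktop Y) V"
    then obtain U where U: "openin (ktop X) U" "V = h -` U \<inter> j ` kpoints X"
      by (auto simp: Y_def openin_pullback_topology)
    then have "pre V = U"
      using openin_subset[OF U(1)] hj by (auto simp: pre_def inj_on_eq_iff[OF inj])
    then show "V \<subseteq> j ` kpoints X \<and> openin (ktop X) (pre V)"
      using U by auto
  next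
    assume V: "V \<subseteq> j ` kpoints X \<and> openin (ktop X) (pre V)"
    then have "V = h -` pre V \<inter> j ` kpoints X"
      using jh by (auto simp: pre_def)
    then show "openin (ktop Y) V"
      using V by (auto simp: Y_def openin_pullback_topology)
  qed
  have op: "openin (ktop X) (pre V)" if "openin (ktop Y) V" for V
    using that open_iff by simp
  have reg: "f \<in> kreg Y V \<longleftrightarrow> (\<lambda>x. f (j x)) \<in> kreg X (pre V)" for f V
    by (simp add: Y_def)
  have pts: "kpoints Y = j ` kpoints X"
    by (auto simp: Y_def topspace_pullback_topology hj)
  have shY: "function_sheaf Y"
    unfolding function_sheaf_def
  proof (intro conjI allI impI; elim conjE)
    fix U f g assume U: "openin (ktop Y) U" "f \<in> kreg Y U" "\<forall>x\<in>U. g x = f x"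
    show "g \<in> kreg Y U"
      unfolding reg
      by (rule function_sheaf_cong[OF sh op[OF U(1)] U(2)[unfolded reg]]) (use U(3) in \<open>auto simp: pre_def\<close>)
  next
    fix U V f assume U: "openin (ktop Y) U" "openin (ktop Y) V" "V \<subseteq> U" "f \<in> kreg Y U"
    show "f \<in> kreg Y V"
      unfolding reg
      by (rule function_sheaf_restrict[OF sh op[OF U(1)] U(4)[unfolded reg] op[OF U(2)]])
         (use U(3) in \<open>auto simp: pre_def\<close>)
  next
    fix U f assume U: "openin (ktop Y) U" and loc: "\<forall>x\<in>U. \<exists>V. openin (ktop Y) V \<and> x \<in> V \<and> V \<subseteq> U \<and> f \<in> kreg Y V"
    show "f \<in> kreg Y U"
      unfolding reg
    proof (rule function_sheaf_glue[OF sh])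
      show "openin (ktop X) (pre U)"
        by (rule op[OF U])
      fix x assume x: "x \<in> pre U"
      then have "j x \<in> U" by (simp add: pre_def)
      from bspec[OF loc this] obtain V where V: "openin (ktop Y) V" "j x \<in> V" "V \<subseteq> U" "f \<in> kreg Y V"
        by (elim exE conjE)
      have "x \<in> pre V" "pre V \<subseteq> pre U"
        using x V(2,3) by (auto simp: pre_def)
      then show "\<exists>V. openin (ktop X) V \<and> x \<in> V \<and> V \<subseteq> pre U \<and> (\<lambda>x. f (j x)) \<in> kreg X V"
        using op[OF V(1)] V(4)[unfolded reg] by (intro exI[of _ "pre V"] conjI)
    qed
  qed
  have 1: "kmorphism X Y j"
    unfolding kmorphism_def
  proof (intro conjI allI impI; (elim conjE)?)
    show "continuous_map (ktop X) (ktop Y) j"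
      unfolding continuous_map_def using pts open_iff by (auto simp: pre_def)
    show "f \<circ> j \<in> kreg X {x \<in> kpoints X. j x \<in> V}" if "f \<in> kreg Y V" for V f
      using that unfolding reg pre_def comp_def .
  qed
  have 2: "kmorphism Y X h"
    unfolding kmorphism_def
  proof (intro conjI allI impI; (elim conjE)?)
    have pre: "pre {y \<in> kpoints Y. h y \<in> U} = U" if "openin (ktop X) U" for U
      using openin_subset[OF that] hj pts by (auto simp: pre_def inj_on_eq_iff[OF inj])
    have "openin (ktop Y) {y \<in> kpoints Y. h y \<in> U}" if "openin (ktop X) U" for U
      unfolding open_iff pre[OF that] using that pts by auto
    then show "continuous_map (ktop Y) (ktop X) h"
      unfolding continuous_map_def using pts jh by auto
    fix V f assume V: "openin (ktop X) V" "f \<in> kreg X V"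
    show "f \<circ> h \<in> kreg Y {y \<in> kpoints Y. h y \<in> V}"
      unfolding reg pre[OF V(1)]
      by (rule function_sheaf_cong[OF sh V]) (use openin_subset[OF V(1)] hj in auto)
  qed
  have "kisomorphic X Y"
    by (rule kisomorphicI[OF 1 2]) (use hj jh pts in auto)
  with shY show thesis
    by (rule that)
qed

text \<open>
  For such a space \<open>K0_class\<close> is the class of an actual generator, so that the relations of the
  Grothendieck ring can be applied to it.
\<close>

definition representable :: "('p, 'k::field) kspace \<Rightarrow> bool" where
  "representable X \<longleftrightarrow> (\<exists>v :: 'k variety. kisomorphic X (Rep_variety v))"

lemma representable_iso: "representable X \<Longrightarrow> kisomorphic Y X \<Longrightarrow> representable Y"
  unfolding representable_def using kisomorphic_trans by blast

lemma representable_variety: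
  fixes X :: "(nat \<Rightarrow> 'k::field alg_closure, 'k) kspace"
  assumes "is_variety X"
  shows "representable X"
proof -
  have "Rep_variety (Abs_variety X) = X"
    by (rule Abs_variety_inverse) (use assms in simp)
  moreover have "kisomorphic X X"
    by (rule kisomorphic_refl) (use assms in \<open>simp add: is_variety_def prevariety_def\<close>)
  ultimately show ?thesis
    unfolding representable_def by (intro exI[of _ "Abs_variety X"]) simp
qed

lemma representable_affine:
  assumes "affine_variety X"
  shows "representable X"
proof -
  obtain n :: nat and Z where Z: "closedin (ktop (affine_space {..<n})) Z" "kisomorphic X (ksub (affine_space {..<n}) Z)"
    using assms(1) unfolding affine_variety_def by (elim exE conjE)
  have sh: "function_sheaf (ksub (affine_space {..<n}) Z)"
    by (rule ksub_sheaf[OF affine_space_sheaf])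
  have "affine_variety (ksub (affine_space {..<n}) Z)"
    by (rule affine_variety_iso[OF assms Z(2)])
  then show ?thesis
    by (intro representable_iso[OF representable_variety Z(2)] affine_is_variety sh)
qed

lemma representable_proj_compl:
  fixes p :: "('i, 'k::field) mpoly"
  assumes I: "finite I" and p: "homogeneous d p"
  shows "representable (proj_compl I p)"
proof -
  obtain e where e: "bij_betw e {..<card I} I"
    using ex_bij_betw_nat_finite[OF I] by (auto simp: atLeast0LessThan)
  define j where "j L = (\<lambda>n. if n < card I then line_rep L (e n) else 0)" for L :: "('i \<Rightarrow> 'k alg_closure) set"
  have "inj_on j (kpoints (proj_compl I p))"
  proof (rule inj_onI)
    fix L M assume "L \<in> kpoints (proj_compl I p)" "M \<in> kpoints (proj_compl I p)" and eq: "j L = j M"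
    then have L: "L \<in> proj_points I" and M: "M \<in> proj_points I"
      by (auto simp: proj_compl_def)
    have "line_rep L i = line_rep M i" for i
    proof (cases "i \<in> I")
      case True
      then obtain n where "n < card I" "i = e n"
        using e by (auto simp: bij_betw_def)
      then show ?thesis
        using fun_cong[OF eq, of n] by (simp add: j_def)
    qed (use line_rep_point(2)[OF L] line_rep_point(2)[OF M] in \<open>simp add: affine_points_def\<close>)
    then have "line_rep L = line_rep M"
      by auto
    then show "L = M"
      using line_rep_point(1)[OF L] line_rep_point(1)[OF M] by metis
  qed
  then obtain Y :: "(nat \<Rightarrow> 'k alg_closure, 'k) kspace" where Y: "function_sheaf Y" "kisomorphic (proj_compl I p) Y"
    by (rule kspace_relabel[OF proj_compl_sheaf])
  then show ?thesis
    by (intro representable_iso[OF representable_variety Y(2)] is_variety_iso[OF proj_compl_is_variety[OF I p]])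
qed

section \<open>Relations between classes of varieties\<close>

lemma variety_class_abs: "variety_class v = abs_K0 (variety_symbol v)"
  by (simp add: variety_class_def)

lemma K0_relation:
  assumes "p - q \<in> iso_relations \<union> scissor_relations \<union> product_relations \<union> unit_relations"
  shows "abs_K0 p = abs_K0 q"
  unfolding K0.abs_eq_iff K0_rel_def K0_ideal_def
  by (rule Modules.module.span_base[OF module_mult assms])

lemma variety_class_iso:
  assumes "kisomorphic (Rep_variety v) (Rep_variety w)"
  shows "variety_class v = variety_class w"
  unfolding variety_class_abs
  by (rule K0_relation) (use assms in \<open>auto simp: iso_relations_def\<close>)

lemma Rep_variety_sheaf: "function_sheaf (Rep_variety v)"
  using Rep_variety[of v] by (simp add: is_variety_def prevariety_def)

lemma K0_class_variety:
  assumes "kisomorphic X (Rep_variety v)"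
  shows "K0_class X = variety_class v"
  unfolding K0_class_def
proof (rule variety_class_iso)
  have "kisomorphic X (Rep_variety (SOME v. kisomorphic X (Rep_variety v)))"
    using assms by (rule someI)
  then show "kisomorphic (Rep_variety (SOME v. kisomorphic X (Rep_variety v))) (Rep_variety v)"
    by (rule kisomorphic_trans[OF kisomorphic_sym assms])
qed

lemma K0_class_iso:
  assumes "representable Y" "kisomorphic X Y"
  shows "K0_class X = K0_class Y"
proof -
  obtain v where v: "kisomorphic Y (Rep_variety v)"
    using assms(1) unfolding representable_def by blast
  show ?thesis
    using K0_class_variety[OF v] K0_class_variety[OF kisomorphic_trans[OF assms(2) v]] by simp
qed

lemma K0_class_scissor:
  assumes X: "representable X" and sh: "function_sheaf X" and C: "closedin (ktop X) C"
    and Z: "representable (ksub X C)" and U: "representable (ksub X (kpoints X - C))"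
  shows "K0_class X = K0_class (ksub X C) + K0_class (ksub X (kpoints X - C))"
proof -
  obtain v where v: "kisomorphic X (Rep_variety v)"
    using X unfolding representable_def by blast
  obtain z where z: "kisomorphic (ksub X C) (Rep_variety z)"
    using Z unfolding representable_def by blast
  obtain u where u: "kisomorphic (ksub X (kpoints X - C)) (Rep_variety u)"
    using U unfolding representable_def by blast
  let ?V = "Rep_variety v"
  obtain \<phi> \<psi> where \<phi>: "kmorphism X ?V \<phi>" and \<psi>: "kmorphism ?V X \<psi>"
    and inv: "\<forall>x\<in>kpoints X. \<psi> (\<phi> x) = x" "\<forall>y\<in>kpoints ?V. \<phi> (\<psi> y) = y"
    using v unfolding kisomorphic_def by (elim exE conjE)
  define D where "D = {y \<in> kpoints ?V. \<psi> y \<in> C}"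
  have D: "closedin (ktop ?V) D"
    unfolding D_def by (rule closedin_continuous_map_preimage[OF kmorphism_continuous[OF \<psi>] C])
  have "kisomorphic (ksub ?V D) (ksub X C)"
    by (rule kisomorphic_ksub[OF \<psi> \<phi>]) (use inv sh Rep_variety_sheaf in \<open>auto simp: D_def\<close>)
  then have "kisomorphic (Rep_variety z) (ksub ?V D)"
    using kisomorphic_sym[OF kisomorphic_trans[OF _ z]] by blast
  moreover have "kisomorphic (ksub ?V (kpoints ?V - D)) (ksub X (kpoints X - C))"
    by (rule kisomorphic_ksub[OF \<psi> \<phi>])
       (use inv sh Rep_variety_sheaf kmorphism_points[OF \<psi>] in \<open>auto simp: D_def\<close>)
  then have "kisomorphic (Rep_variety u) (ksub ?V (kpoints ?V - D))"
    using kisomorphic_sym[OF kisomorphic_trans[OF _ u]] by blast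
  ultimately have "abs_K0 (variety_symbol v) = abs_K0 (variety_symbol z + variety_symbol u)"
    using D by (intro K0_relation) (auto simp: scissor_relations_def)
  also have "\<dots> = abs_K0 (variety_symbol z) + abs_K0 (variety_symbol u)"
    by (simp add: plus_K0.abs_eq)
  finally show ?thesis
    using K0_class_variety[OF v] K0_class_variety[OF z] K0_class_variety[OF u]
    by (simp add: variety_class_abs)
qed

text \<open>
  The empty space is the disjoint union of two copies of itself.
\<close>

lemma K0_class_empty:
  assumes X: "representable X" and sh: "function_sheaf X" and empty: "kpoints X = {}"
  shows "K0_class X = 0"
proof -
  have "kisomorphic (ksub X {}) X"
    using kisomorphic_sym[OF kisomorphic_ksub_points[OF sh]] empty by simp
  then have "representable (ksub X {})" "K0_class (ksub X {}) = K0_class X"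
    using X representable_iso K0_class_iso by blast+
  then have "K0_class X = K0_class X + K0_class X"
    using K0_class_scissor[OF X sh, of "{}"] empty by simp
  then show ?thesis
    by simp
qed

text \<open>
  The product relation is imposed on generators only, so the universal property has to be moved
  along isomorphisms to the representing generators.
\<close>

lemma is_product_iso:
  fixes P :: "('p, 'k::field) kspace" and X :: "('q, 'k) kspace" and Y :: "('r, 'k) kspace"
    and P' :: "('p', 'k::field) kspace" and X' :: "('q', 'k) kspace" and Y' :: "('r', 'k) kspace"
  assumes prod: "is_product P X Y" and P: "kisomorphic P P'" and X: "kisomorphic X X'" and Y: "kisomorphic Y Y'"
  shows "is_product P' X' Y'"
proof -
  obtain p p' where p: "kmorphism P P' p" "kmorphism P' P p'" "\<forall>x\<in>kpoints P. p' (p x) = x" "\<forall>x\<in>kpoints P'. p (p' x) = x"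
    using P unfolding kisomorphic_def by (elim exE conjE)
  obtain f f' where f: "kmorphism X X' f" "kmorphism X' X f'" "\<forall>x\<in>kpoints X. f' (f x) = x" "\<forall>x\<in>kpoints X'. f (f' x) = x"
    using X unfolding kisomorphic_def by (elim exE conjE)
  obtain g g' where g: "kmorphism Y Y' g" "kmorphism Y' Y g'" "\<forall>x\<in>kpoints Y. g' (g x) = x" "\<forall>x\<in>kpoints Y'. g (g' x) = x"
    using Y unfolding kisomorphic_def by (elim exE conjE)
  obtain \<pi>\<^sub>1 \<pi>\<^sub>2 where \<pi>: "kmorphism P X \<pi>\<^sub>1" "kmorphism P Y \<pi>\<^sub>2"
    and univ: "\<forall>(T :: (nat \<Rightarrow> 'k alg_closure, 'k) kspace) \<alpha> \<beta>.
        prevariety T \<and> kmorphism T X \<alpha> \<and> kmorphism T Y \<beta> \<longrightarrow>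
        (\<exists>\<phi>. kmorphism T P \<phi> \<and> (\<forall>t\<in>kpoints T. \<pi>\<^sub>1 (\<phi> t) = \<alpha> t \<and> \<pi>\<^sub>2 (\<phi> t) = \<beta> t)) \<and>
        (\<forall>\<phi> \<phi>'. kmorphism T P \<phi> \<and> kmorphism T P \<phi>' \<and>
            (\<forall>t\<in>kpoints T. \<pi>\<^sub>1 (\<phi> t) = \<alpha> t \<and> \<pi>\<^sub>2 (\<phi> t) = \<beta> t) \<and>
            (\<forall>t\<in>kpoints T. \<pi>\<^sub>1 (\<phi>' t) = \<alpha> t \<and> \<pi>\<^sub>2 (\<phi>' t) = \<beta> t) \<longrightarrow>
            (\<forall>t\<in>kpoints T. \<phi> t = \<phi>' t))"
    using prod unfolding is_product_def by (elim exE conjE)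
  show ?thesis
    unfolding is_product_def
  proof (rule exI[of _ "\<lambda>x. f (\<pi>\<^sub>1 (p' x))"], rule exI[of _ "\<lambda>x. g (\<pi>\<^sub>2 (p' x))"],
      intro conjI allI impI ballI; (elim conjE)?)
    show "kmorphism P' X' (\<lambda>x. f (\<pi>\<^sub>1 (p' x)))" "kmorphism P' Y' (\<lambda>x. g (\<pi>\<^sub>2 (p' x)))"
      by (rule kmorphism_compose[OF kmorphism_compose[OF p(2) \<pi>(1)] f(1)],
          rule kmorphism_compose[OF kmorphism_compose[OF p(2) \<pi>(2)] g(1)])
    fix T :: "(nat \<Rightarrow> 'k alg_closure, 'k) kspace" and \<alpha> \<beta>
    assume T: "prevariety T" and \<alpha>: "kmorphism T X' \<alpha>" and \<beta>: "kmorphism T Y' \<beta>"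
    have \<alpha>': "kmorphism T X (\<lambda>t. f' (\<alpha> t))" and \<beta>': "kmorphism T Y (\<lambda>t. g' (\<beta> t))"
      by (rule kmorphism_compose[OF \<alpha> f(2)], rule kmorphism_compose[OF \<beta> g(2)])
    note u = univ[rule_format, OF conjI[OF T conjI[OF \<alpha>' \<beta>']]]
    from conjunct1[OF u] obtain \<phi> where \<phi>: "kmorphism T P \<phi>"
      "\<forall>t\<in>kpoints T. \<pi>\<^sub>1 (\<phi> t) = f' (\<alpha> t) \<and> \<pi>\<^sub>2 (\<phi> t) = g' (\<beta> t)"
      by (elim exE conjE)
    have "f (\<pi>\<^sub>1 (p' (p (\<phi> t)))) = \<alpha> t \<and> g (\<pi>\<^sub>2 (p' (p (\<phi> t)))) = \<beta> t" if "t \<in> kpoints T" for t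
      using \<phi>(2) that p(3) f(4) g(4) kmorphism_points[OF \<phi>(1) that] kmorphism_points[OF \<alpha> that]
        kmorphism_points[OF \<beta> that] by simp
    then show "\<exists>\<phi>. kmorphism T P' \<phi> \<and> (\<forall>t\<in>kpoints T. f (\<pi>\<^sub>1 (p' (\<phi> t))) = \<alpha> t \<and> g (\<pi>\<^sub>2 (p' (\<phi> t))) = \<beta> t)"
      using kmorphism_compose[OF \<phi>(1) p(1)] by (intro exI[of _ "\<lambda>t. p (\<phi> t)"] conjI ballI) auto
    fix \<phi> \<phi>' t assume \<phi>: "kmorphism T P' \<phi>" and \<phi>': "kmorphism T P' \<phi>'"
      and e: "\<forall>t\<in>kpoints T. f (\<pi>\<^sub>1 (p' (\<phi> t))) = \<alpha> t \<and> g (\<pi>\<^sub>2 (p' (\<phi> t))) = \<beta> t"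
      and e': "\<forall>t\<in>kpoints T. f (\<pi>\<^sub>1 (p' (\<phi>' t))) = \<alpha> t \<and> g (\<pi>\<^sub>2 (p' (\<phi>' t))) = \<beta> t"
      and t: "t \<in> kpoints T"
    have lift: "\<forall>t\<in>kpoints T. \<pi>\<^sub>1 (p' (\<gamma> t)) = f' (\<alpha> t) \<and> \<pi>\<^sub>2 (p' (\<gamma> t)) = g' (\<beta> t)"
      if \<gamma>: "kmorphism T P' \<gamma>" and e: "\<forall>t\<in>kpoints T. f (\<pi>\<^sub>1 (p' (\<gamma> t))) = \<alpha> t \<and> g (\<pi>\<^sub>2 (p' (\<gamma> t))) = \<beta> t" for \<gamma>
    proof
      fix t assume t: "t \<in> kpoints T"
      have "p' (\<gamma> t) \<in> kpoints P"
        by (rule kmorphism_points[OF kmorphism_compose[OF \<gamma> p(2)] t])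
      then have "f' (f (\<pi>\<^sub>1 (p' (\<gamma> t)))) = \<pi>\<^sub>1 (p' (\<gamma> t))" "g' (g (\<pi>\<^sub>2 (p' (\<gamma> t)))) = \<pi>\<^sub>2 (p' (\<gamma> t))"
        using f(3) g(3) kmorphism_points[OF \<pi>(1)] kmorphism_points[OF \<pi>(2)] by simp_all
      then show "\<pi>\<^sub>1 (p' (\<gamma> t)) = f' (\<alpha> t) \<and> \<pi>\<^sub>2 (p' (\<gamma> t)) = g' (\<beta> t)"
        using bspec[OF e t] by simp
    qed
    have "p' (\<phi> t) = p' (\<phi>' t)"
      using conjunct2[OF u, rule_format, OF conjI[OF kmorphism_compose[OF \<phi> p(2)] conjI[OF kmorphism_compose[OF \<phi>' p(2)]
        conjI[OF lift[OF \<phi> e] lift[OF \<phi>' e']]]] t] .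
    then show "\<phi> t = \<phi>' t"
      using p(4) kmorphism_points[OF \<phi> t] kmorphism_points[OF \<phi>' t] by metis
  qed
qed

lemma K0_class_product:
  assumes "is_product P X Y" "representable P" "representable X" "representable Y"
  shows "K0_class P = K0_class X * K0_class Y"
proof -
  obtain u v w where uvw: "kisomorphic P (Rep_variety u)" "kisomorphic X (Rep_variety v)" "kisomorphic Y (Rep_variety w)"
    using assms(2-4) unfolding representable_def by blast
  have "abs_K0 (variety_symbol u) = abs_K0 (variety_symbol v * variety_symbol w)"
    using is_product_iso[OF assms(1) uvw] by (intro K0_relation) (auto simp: product_relations_def)
  also have "\<dots> = abs_K0 (variety_symbol v) * abs_K0 (variety_symbol w)"
    by (simp add: times_K0.abs_eq)
  finally show ?thesis
    using K0_class_variety[OF uvw(1)] K0_class_variety[OF uvw(2)] K0_class_variety[OF uvw(3)]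
    by (simp add: variety_class_abs)
qed

section \<open>Stratification by coordinate subspaces\<close>

text \<open>
  Vectors in a smaller coordinate space are extended by zero, so its lines are literally lines of
  the larger space.
\<close>

lemma proj_points_coordinate_subspace:
  assumes "J \<subseteq> I"
  shows "proj_points J = {L \<in> proj_points I. \<forall>i\<in>I - J. line_rep L i = 0}"
proof (intro equalityI subsetI)
  fix L assume L: "L \<in> proj_points J"
  have "line_rep L \<in> affine_points I"
    using line_rep_point(2)[OF L] assms by (auto simp: affine_points_def)
  then have "line (line_rep L) \<in> proj_points I"
    by (rule line_in_proj_points[OF _ line_rep_point(3)[OF L]])
  then show "L \<in> {L \<in> proj_points I. \<forall>i\<in>I - J. line_rep L i = 0}"
    using line_rep_point(1,2)[OF L] by (auto simp: affine_points_def)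
next
  fix L assume "L \<in> {L \<in> proj_points I. \<forall>i\<in>I - J. line_rep L i = 0}"
  then have L: "L \<in> proj_points I" and z: "\<forall>i\<in>I - J. line_rep L i = 0"
    by auto
  have "line_rep L \<in> affine_points J"
    using line_rep_point(2)[OF L] z by (auto simp: affine_points_def)
  then have "line (line_rep L) \<in> proj_points J"
    by (rule line_in_proj_points[OF _ line_rep_point(3)[OF L]])
  then show "L \<in> proj_points J"
    using line_rep_point(1)[OF L] by simp
qed

lemma kisomorphic_coordinate_subspace:
  fixes p :: "('i, 'k::field) mpoly"
  assumes "J \<subseteq> I"
  shows "kisomorphic (ksub (proj_space I) {L \<in> proj_points J. mpoly_eval p (line_rep L) \<noteq> 0}) (proj_compl J p)"
proof -
  let ?A = "{L \<in> proj_points J. mpoly_eval p (line_rep L) \<noteq> 0}"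
  let ?X = "ksub (proj_space I) ?A"
  have JI: "proj_points J \<subseteq> proj_points I"
    using proj_points_coordinate_subspace[OF assms] by blast
  have shX: "function_sheaf ?X"
    by (rule ksub_sheaf[OF proj_space_sheaf])
  have "kmorphism ?X (proj_space J) (\<lambda>L. L)"
  proof (rule kmorphism_into_proj_space[OF shX])
    fix q r :: "('i, 'k) mpoly" and d
    assume q: "homogeneous d q"
    have "{x \<in> kpoints ?X. mpoly_eval q (line_rep x) \<noteq> 0} = {L \<in> proj_points I. mpoly_eval q (line_rep L) \<noteq> 0} \<inter> ?A"
      using JI by auto
    then show "openin (ktop ?X) {x \<in> kpoints ?X. mpoly_eval q (line_rep x) \<noteq> 0}"
      by (simp only: ktop_ksub openin_subtopology_Int[OF proj_fraction_open[OF q]])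
    assume r: "homogeneous d r"
    show "(\<lambda>L. mpoly_eval q (line_rep L) / mpoly_eval r (line_rep L)) \<in> kreg ?X {x \<in> kpoints ?X. mpoly_eval r (line_rep x) \<noteq> 0}"
      by (rule kreg_ksub_restrict[OF proj_fraction_regular[OF q r] proj_fraction_open[OF r]]) auto
  qed auto
  then have 1: "kmorphism ?X (proj_compl J p) (\<lambda>L. L)"
    unfolding proj_compl_def by (rule kmorphism_into_ksub[OF _ shX]) auto
  have "kmorphism (proj_space J :: (('i \<Rightarrow> 'k alg_closure) set, 'k) kspace) (proj_space I) (\<lambda>L. L)"
  proof (rule kmorphism_into_proj_space[OF proj_space_sheaf])
    fix q r :: "('i, 'k) mpoly" and d
    assume q: "homogeneous d q"
    show "openin (ktop (proj_space J)) {x \<in> kpoints (proj_space J). mpoly_eval q (line_rep x) \<noteq> 0}"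
      using proj_fraction_open[OF q] by simp
    assume r: "homogeneous d r"
    show "(\<lambda>L. mpoly_eval q (line_rep L) / mpoly_eval r (line_rep L)) \<in>
        kreg (proj_space J) {x \<in> kpoints (proj_space J). mpoly_eval r (line_rep x) \<noteq> 0}"
      using proj_fraction_regular[OF q r] by simp
  qed (use JI in auto)
  then have 2: "kmorphism (proj_compl J p) ?X (\<lambda>L. L)"
    unfolding proj_compl_def by (rule kmorphism_ksub[OF _ proj_space_sheaf]) auto
  show ?thesis
    by (rule kisomorphicI[OF 1 2]) auto
qed

lemma K0_class_proj_compl_split:
  fixes p :: "('i, 'k::field) mpoly"
  assumes I: "finite I" and p: "homogeneous d p" and e: "e \<in> I"
  shows "K0_class (proj_compl I p) = K0_class (proj_compl (I - {e}) p) + K0_class (proj_compl I (p * mvar e))"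
proof -
  let ?X = "proj_compl I p"
  let ?D = "{L \<in> proj_points I. mpoly_eval p (line_rep L) \<noteq> 0}"
  let ?U = "{L \<in> proj_points I. line_rep L e \<noteq> 0}"
  define C where "C = {L \<in> ?D. line_rep L e = 0}"
  have pt: "kpoints ?X = ?D"
    by (auto simp: proj_compl_def)
  have pe: "homogeneous (d + 1) (p * mvar e)"
    using homogeneous_mult[OF p homogeneous_mvar] by simp
  have "openin (ktop ?X) (?U \<inter> ?D)"
    unfolding proj_compl_def ktop_ksub by (rule openin_subtopology_Int[OF proj_coordinate_open])
  moreover have "?D - C = ?U \<inter> ?D"
    by (auto simp: C_def)
  ultimately have C: "closedin (ktop ?X) C"
    unfolding closedin_def pt by (auto simp: C_def)
  have "?D \<inter> C = {L \<in> proj_points (I - {e}). mpoly_eval p (line_rep L) \<noteq> 0}"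
    using proj_points_coordinate_subspace[of "I - {e}" I] e by (auto simp: C_def)
  then have "kisomorphic (ksub ?X C) (ksub (proj_space I) {L \<in> proj_points (I - {e}). mpoly_eval p (line_rep L) \<noteq> 0})"
    using kisomorphic_ksub_ksub[OF proj_space_sheaf, of I ?D C] by (simp add: proj_compl_def)
  then have 1: "kisomorphic (ksub ?X C) (proj_compl (I - {e}) p)"
    by (rule kisomorphic_trans) (rule kisomorphic_coordinate_subspace, auto)
  have "?D \<inter> (?D - C) = {L \<in> proj_points I. mpoly_eval (p * mvar e) (line_rep L) \<noteq> 0}"
    by (auto simp: C_def)
  then have 2: "kisomorphic (ksub ?X (?D - C)) (proj_compl I (p * mvar e))"
    using kisomorphic_ksub_ksub[OF proj_space_sheaf, of I ?D "?D - C"] by (simp add: proj_compl_def)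
  have r1: "representable (proj_compl (I - {e}) p)"
    by (rule representable_proj_compl[OF _ p]) (use I in simp)
  have r2: "representable (proj_compl I (p * mvar e))"
    by (rule representable_proj_compl[OF I pe])
  have "K0_class ?X = K0_class (ksub ?X C) + K0_class (ksub ?X (?D - C))"
    using K0_class_scissor[OF representable_proj_compl[OF I p] proj_compl_sheaf C] representable_iso[OF r1 1] representable_iso[OF r2 2]
    unfolding pt by blast
  then show ?thesis
    using K0_class_iso[OF r1 1] K0_class_iso[OF r2 2] by simp
qed

text \<open>
  The coordinates in \<open>F\<close> are still to be tested for vanishing, those in \<open>J\<close> are already known to be
  non-zero. Testing one coordinate \<open>e\<close> either removes it or moves it from \<open>F\<close> to \<open>J\<close>, by
  \<open>K0_class_proj_compl_split\<close>.
\<close>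

lemma K0_class_proj_compl_strata_aux:
  fixes p :: "('i, 'k::field) mpoly"
  assumes "finite F" "finite J" "F \<inter> J = {}" "homogeneous d p"
  shows "K0_class (proj_compl (F \<union> J) (p * (\<Prod>j\<in>J. mvar j))) =
    (\<Sum>S\<in>Pow F. K0_class (proj_compl (S \<union> J) (p * (\<Prod>j\<in>S \<union> J. mvar j))))"
  using assms
proof (induction F arbitrary: J rule: finite_induct)
  case (insert e F)
  let ?m = "\<lambda>J. p * (\<Prod>j\<in>J. mvar j)"
  let ?c = "\<lambda>I J. K0_class (proj_compl I (?m J))"
  have hom: "homogeneous (d + (\<Sum>j\<in>J. Suc 0)) (?m J)"
    by (intro homogeneous_mult homogeneous_prod insert.prems(3) homogeneous_mvar)
  have "?c (insert e F \<union> J) J = ?c (F \<union> J) J + K0_class (proj_compl (insert e F \<union> J) (?m J * mvar e))"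
  proof -
    have "insert e F \<union> J - {e} = F \<union> J"
      using insert.hyps insert.prems by auto
    then show ?thesis
      using K0_class_proj_compl_split[OF _ hom, of "insert e F \<union> J" e] insert.hyps(1) insert.prems(1) by simp
  qed
  also have "K0_class (proj_compl (insert e F \<union> J) (?m J * mvar e)) = ?c (F \<union> insert e J) (insert e J)"
  proof -
    have "?m (insert e J) = ?m J * mvar e"
      using insert.prems by (simp add: mult_ac)
    then show ?thesis
      by simp
  qed
  also have "?c (F \<union> J) J = (\<Sum>S\<in>Pow F. ?c (S \<union> J) (S \<union> J))"
    by (rule insert.IH) (use insert.prems in auto)
  also have "?c (F \<union> insert e J) (insert e J) = (\<Sum>S\<in>Pow F. ?c (S \<union> insert e J) (S \<union> insert e J))"
    by (rule insert.IH) (use insert.prems insert.hyps in auto)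
  also have "\<dots> = (\<Sum>S\<in>insert e ` Pow F. ?c (S \<union> J) (S \<union> J))"
  proof (subst sum.reindex)
    show "inj_on (insert e) (Pow F)"
      using insert.hyps(2) by (auto simp: inj_on_def)
  qed simp
  also have "(\<Sum>S\<in>Pow F. ?c (S \<union> J) (S \<union> J)) + (\<Sum>S\<in>insert e ` Pow F. ?c (S \<union> J) (S \<union> J)) =
      (\<Sum>S\<in>Pow (insert e F). ?c (S \<union> J) (S \<union> J))"
    unfolding Pow_insert by (rule sum.union_disjoint[symmetric]) (use insert.hyps in auto)
  finally show ?case .
qed simp

lemma K0_class_proj_compl_strata:
  fixes p :: "('i, 'k::field) mpoly"
  assumes "finite I" "homogeneous d p"
  shows "K0_class (proj_compl I p) = (\<Sum>S\<in>Pow I. K0_class (proj_compl S (p * (\<Prod>j\<in>S. mvar j))))"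
  using K0_class_proj_compl_strata_aux[OF assms(1), of "{}" d p] assms by simp

lemma proj_compl_cong:
  assumes "\<And>x. x \<in> affine_points I \<Longrightarrow> mpoly_eval p x \<noteq> 0 \<longleftrightarrow> mpoly_eval q x \<noteq> 0"
  shows "proj_compl I p = proj_compl I q"
proof -
  have "{L \<in> proj_points I. mpoly_eval p (line_rep L) \<noteq> 0} = {L \<in> proj_points I. mpoly_eval q (line_rep L) \<noteq> 0}"
    using assms line_rep_point(2) by blast
  then show ?thesis
    by (simp add: proj_compl_def)
qed

lemma K0_class_proj_compl_zero:
  fixes p :: "('i, 'k::field) mpoly"
  assumes I: "finite I" and p: "homogeneous d p" and zero: "\<And>x. x \<in> affine_points I \<Longrightarrow> mpoly_eval p x = 0"
  shows "K0_class (proj_compl I p) = 0"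
proof (rule K0_class_empty[OF representable_proj_compl[OF I p] proj_compl_sheaf])
  show "kpoints (proj_compl I p) = {}"
    using zero line_rep_point(2) by (auto simp: proj_compl_def)
qed

section \<open>Splitting off a torus factor\<close>

lemma kmorphism_coordinate:
  fixes X :: "('p, 'k::field) kspace" and \<alpha> :: "'p \<Rightarrow> 'i \<Rightarrow> 'k alg_closure"
  assumes \<alpha>: "kmorphism X (ksub (affine_space I) A) \<alpha>"
  shows "(\<lambda>t. \<alpha> t i) \<in> kreg X (kpoints X)"
proof -
  have "{t \<in> kpoints X. \<alpha> t \<in> kpoints (ksub (affine_space I) A)} = kpoints X"
    using kmorphism_points[OF \<alpha>] by auto
  then show ?thesis
    using kmorphism_pullback[OF \<alpha> openin_topspace kreg_ksub_points[OF coordinate_regular[OF openin_topspace, of i]]]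
    by simp
qed

lemma kisomorphic_ksub_cong:
  assumes "function_sheaf X" "\<And>x. x \<in> kpoints X \<Longrightarrow> x \<in> A \<longleftrightarrow> x \<in> B"
  shows "kisomorphic (ksub X A) (ksub X B)"
  by (rule kisomorphic_ksub[OF kmorphism_id kmorphism_id]) (use assms in auto)

lemma representable_G_m: "representable (G_m :: (nat \<Rightarrow> 'k::field alg_closure, 'k) kspace)"
proof (rule representable_iso)
  let ?A = "affine_space {0} :: (nat \<Rightarrow> 'k alg_closure, 'k) kspace"
  show "representable (ksub ?A {x \<in> kpoints ?A. mpoly_eval (mvar 0) x \<noteq> 0})"
    by (rule representable_affine[OF affine_variety_basic_open[OF _ closedin_topspace]]) simp
  show "kisomorphic G_m (ksub ?A {x \<in> kpoints ?A. mpoly_eval (mvar 0) x \<noteq> 0})"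
    unfolding G_m_def by (rule kisomorphic_ksub_cong[OF affine_space_sheaf]) auto
qed

text \<open>
  The chart \<open>x\<^sub>a = 1\<close> is all of the space. Inside it, the slice \<open>Z\<close> given by \<open>x\<^sub>b = 1\<close> meets each orbit
  of the scaling of the coordinates in \<open>B\<close> exactly once, and the coordinate \<open>x\<^sub>b\<close> records the
  position in the orbit.
\<close>

lemma K0_class_torus_factor:
  fixes p :: "('i, 'k::field) mpoly"
  assumes I: "finite I" and p: "homogeneous d p" and B: "B \<subseteq> I" and a: "a \<in> I" "a \<notin> B" and b: "b \<in> B"
    and nz: "\<And>x. x \<in> affine_points I \<Longrightarrow> mpoly_eval p x \<noteq> 0 \<Longrightarrow> x a \<noteq> 0 \<and> x b \<noteq> 0"
    and scale: "\<And>x t. x \<in> affine_points I \<Longrightarrow> t \<noteq> 0 \<Longrightarrow> mpoly_eval p x \<noteq> 0 \<Longrightarrow>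
      mpoly_eval p (\<lambda>i. if i \<in> B then t * x i else x i) \<noteq> 0"
  shows "\<exists>c. K0_class (proj_compl I p) = torus_class * c"
proof -
  let ?A = "affine_space I :: ('i \<Rightarrow> 'k alg_closure, 'k) kspace"
  let ?PP = "{x \<in> affine_points I. x a = 1 \<and> mpoly_eval p x \<noteq> 0}"
  let ?ZZ = "{x \<in> affine_points I. x a = 1 \<and> x b = 1 \<and> mpoly_eval p x \<noteq> 0}"
  define P where "P = ksub ?A ?PP"
  define Z where "Z = ksub ?A ?ZZ"
  let ?G = "G_m :: (nat \<Rightarrow> 'k alg_closure, 'k) kspace"
  have ptP: "kpoints P = ?PP" and ptZ: "kpoints Z = ?ZZ"
    by (auto simp: P_def Z_def)
  have ptG: "kpoints ?G = {x \<in> affine_points {0}. x 0 \<noteq> 0}"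
    by (auto simp: G_m_def)
  have P: "regular_space P"
    unfolding P_def by (rule ksub_regular[OF affine_space_regular])
  have coordP: "(\<lambda>x. x i) \<in> kreg P (kpoints P)" for i
    unfolding P_def by (rule kreg_ksub_points[OF coordinate_regular[OF openin_topspace]])
  have "{L \<in> proj_points I. mpoly_eval p (line_rep L) \<noteq> 0 \<and> line_rep L a \<noteq> 0} =
      {L \<in> proj_points I. mpoly_eval p (line_rep L) \<noteq> 0}"
    using nz line_rep_point(2) by blast
  then have isoP: "kisomorphic (proj_compl I p) P"
    using kisomorphic_chart[OF a(1) p] by (simp add: proj_compl_def P_def)
  have repP: "representable P"
    unfolding P_def by (rule representable_affine[OF affine_variety_chart[OF I]])
  have repZ: "representable Z"
  proof -
    note o = openin_topspace[of "ktop ?A"]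
    have c: "closedin (ktop ?A) {x \<in> affine_points I. x i = 1}" for i
      using regular_zero_closed[OF affine_space_regular regular_diff[OF affine_space_regular o coordinate_regular[OF o, of i]
        regular_const[OF affine_space_regular o, of 1]]] by simp
    have "{x \<in> {x \<in> affine_points I. x a = 1} \<inter> {x \<in> affine_points I. x b = 1}. mpoly_eval p x \<noteq> 0} = ?ZZ"
      by auto
    then show ?thesis
      unfolding Z_def using representable_affine[OF affine_variety_basic_open[OF I closedin_Int[OF c c], of a b p]] by simp
  qed
  define \<pi>\<^sub>1 where "\<pi>\<^sub>1 x = (\<lambda>i. if i \<in> B then x i / x b else x i)" for x :: "'i \<Rightarrow> 'k alg_closure"
  define \<pi>\<^sub>2 where "\<pi>\<^sub>2 x = (\<lambda>k::nat. if k = 0 then x b else 0)" for x :: "'i \<Rightarrow> 'k alg_closure"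
  have \<pi>\<^sub>1_scale: "\<pi>\<^sub>1 x = (\<lambda>i. if i \<in> B then inverse (x b) * x i else x i)" for x
    by (auto simp: \<pi>\<^sub>1_def divide_inverse)
  have aff: "(\<lambda>i. if i \<in> B then t * x i else x i) \<in> affine_points I" if "x \<in> affine_points I" for t and x :: "'i \<Rightarrow> 'k alg_closure"
    using that by (auto simp: affine_points_def)
  have \<pi>\<^sub>1Z: "\<pi>\<^sub>1 x \<in> ?ZZ" if x: "x \<in> ?PP" for x
  proof -
    have "x b \<noteq> 0"
      using nz x by auto
    then show ?thesis
      using x a b scale[of x "inverse (x b)"] aff[of x "inverse (x b)"] by (simp add: \<pi>\<^sub>1_scale)
  qed
  have "kmorphism P ?A \<pi>\<^sub>1"
  proof (rule kmorphism_into_affine_space[OF P])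
    fix i
    have "{x \<in> kpoints P. x b \<noteq> 0} = kpoints P"
      using nz ptP by auto
    then show "(\<lambda>x. \<pi>\<^sub>1 x i) \<in> kreg P (kpoints P)"
      using regular_divide[OF P openin_topspace coordP coordP, of i b] coordP
      by (cases "i \<in> B") (simp_all add: \<pi>\<^sub>1_def)
  qed (use \<pi>\<^sub>1Z ptP in auto)
  then have 1: "kmorphism P Z \<pi>\<^sub>1"
    unfolding Z_def by (rule kmorphism_into_ksub[OF _ regular_sheaf[OF P]]) (use \<pi>\<^sub>1Z ptP in auto)
  have "kmorphism P (affine_space {0}) \<pi>\<^sub>2"
  proof (rule kmorphism_into_affine_space[OF P])
    show "(\<lambda>x. \<pi>\<^sub>2 x i) \<in> kreg P (kpoints P)" for i
      using coordP regular_const[OF P openin_topspace, of 0] by (cases "i = 0") (simp_all add: \<pi>\<^sub>2_def)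
  qed (auto simp: \<pi>\<^sub>2_def affine_points_def)
  then have 2: "kmorphism P ?G \<pi>\<^sub>2"
    unfolding G_m_def by (rule kmorphism_into_ksub[OF _ regular_sheaf[OF P]]) (use nz ptP in \<open>auto simp: \<pi>\<^sub>2_def\<close>)
  have "is_product P Z ?G"
    unfolding is_product_def
  proof (rule exI[of _ \<pi>\<^sub>1], rule exI[of _ \<pi>\<^sub>2], intro conjI allI impI ballI; (elim conjE)?)
    show "kmorphism P Z \<pi>\<^sub>1" "kmorphism P ?G \<pi>\<^sub>2"
      by (rule 1, rule 2)
    fix T :: "(nat \<Rightarrow> 'k alg_closure, 'k) kspace" and \<alpha> \<beta>
    assume T: "prevariety T" and \<alpha>: "kmorphism T Z \<alpha>" and \<beta>: "kmorphism T ?G \<beta>"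
    have reg: "regular_space T"
      by (rule prevariety_regular[OF T])
    have \<alpha>c: "(\<lambda>t. \<alpha> t i) \<in> kreg T (kpoints T)" for i
      using \<alpha> unfolding Z_def by (rule kmorphism_coordinate)
    have \<beta>c: "(\<lambda>t. \<beta> t i) \<in> kreg T (kpoints T)" for i
      using \<beta> unfolding G_m_def by (rule kmorphism_coordinate)
    have \<alpha>Z: "\<alpha> t \<in> ?ZZ" if "t \<in> kpoints T" for t
      using kmorphism_points[OF \<alpha> that] ptZ by simp
    have \<beta>G: "\<beta> t \<in> affine_points {0} \<and> \<beta> t 0 \<noteq> 0" if "t \<in> kpoints T" for t
      using kmorphism_points[OF \<beta> that] ptG by simp
    \<comment> \<open>the coordinates in \<open>B\<close> of a point of \<open>Z\<close>, scaled by the point of the torus\<close>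
    define \<phi> where "\<phi> t = (\<lambda>i. if i \<in> B then \<beta> t 0 * \<alpha> t i else \<alpha> t i)" for t
    have \<phi>P: "\<phi> t \<in> ?PP" if "t \<in> kpoints T" for t
      using \<alpha>Z[OF that] \<beta>G[OF that] a scale[of "\<alpha> t" "\<beta> t 0"] aff[of "\<alpha> t" "\<beta> t 0"] by (simp add: \<phi>_def)
    have "kmorphism T ?A \<phi>"
    proof (rule kmorphism_into_affine_space[OF reg])
      show "(\<lambda>t. \<phi> t i) \<in> kreg T (kpoints T)" for i
        using \<alpha>c[of i] regular_mult[OF reg openin_topspace \<beta>c[of 0] \<alpha>c[of i]]
        by (cases "i \<in> B") (simp_all add: \<phi>_def)
    qed (use \<phi>P in auto)
    then have "kmorphism T P \<phi>"
      unfolding P_def by (rule kmorphism_into_ksub[OF _ regular_sheaf[OF reg]]) (use \<phi>P in auto)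
    moreover have "\<pi>\<^sub>1 (\<phi> t) = \<alpha> t \<and> \<pi>\<^sub>2 (\<phi> t) = \<beta> t" if "t \<in> kpoints T" for t
      using \<alpha>Z[OF that] \<beta>G[OF that] b by (auto simp: \<pi>\<^sub>1_def \<pi>\<^sub>2_def \<phi>_def affine_points_def fun_eq_iff)
    ultimately show "\<exists>\<phi>. kmorphism T P \<phi> \<and> (\<forall>t\<in>kpoints T. \<pi>\<^sub>1 (\<phi> t) = \<alpha> t \<and> \<pi>\<^sub>2 (\<phi> t) = \<beta> t)"
      by (intro exI[of _ \<phi>] conjI ballI) auto
    fix \<gamma> \<gamma>' t assume \<gamma>: "kmorphism T P \<gamma>" and \<gamma>': "kmorphism T P \<gamma>'"
      and e: "\<forall>t\<in>kpoints T. \<pi>\<^sub>1 (\<gamma> t) = \<alpha> t \<and> \<pi>\<^sub>2 (\<gamma> t) = \<beta> t"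
      and e': "\<forall>t\<in>kpoints T. \<pi>\<^sub>1 (\<gamma>' t) = \<alpha> t \<and> \<pi>\<^sub>2 (\<gamma>' t) = \<beta> t"
      and t: "t \<in> kpoints T"
    have "\<gamma> t \<in> ?PP"
      using kmorphism_points[OF \<gamma> t] ptP by simp
    then have nzb: "\<gamma> t b \<noteq> 0"
      using nz by auto
    have 1: "\<pi>\<^sub>1 (\<gamma> t) = \<pi>\<^sub>1 (\<gamma>' t)" and 2: "\<pi>\<^sub>2 (\<gamma> t) = \<pi>\<^sub>2 (\<gamma>' t)"
      using bspec[OF e t] bspec[OF e' t] by simp_all
    have b': "\<gamma> t b = \<gamma>' t b"
      using fun_cong[OF 2, of 0] by (simp add: \<pi>\<^sub>2_def)
    show "\<gamma> t = \<gamma>' t"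
    proof
      fix i
      show "\<gamma> t i = \<gamma>' t i"
        using fun_cong[OF 1, of i] b' nzb by (cases "i \<in> B") (simp_all add: \<pi>\<^sub>1_def)
    qed
  qed
  then have "K0_class P = K0_class Z * K0_class ?G"
    by (rule K0_class_product[OF _ repP repZ representable_G_m])
  moreover have "K0_class (proj_compl I p) = K0_class P"
    by (rule K0_class_iso[OF repP isoP])
  ultimately show ?thesis
    by (intro exI[of _ "K0_class Z"]) (simp add: torus_class_def mult.commute)
qed

lemma sum_fun_apply: "(\<Sum>a\<in>A. f a) x = (\<Sum>a\<in>A. f a x)"
  by (induction A rule: infinite_finite_induct) simp_all

lemma fun_scale_apply: "fun_scale c v e = c * v e"
  by (simp add: fun_scale_def)

section \<open>Gram matrices of configurations\<close>

text \<open>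
  The matrix of the form \<open>Q\<^sub>W\<close> with respect to \<open>bs\<close>, at a point of affine space over the algebraic
  closure.
\<close>

definition gram_matrix :: "'e set \<Rightarrow> ('e \<Rightarrow> 'k::field) list \<Rightarrow> ('e \<Rightarrow> 'k alg_closure) \<Rightarrow> 'k alg_closure mat" where
  "gram_matrix E bs x = mat (length bs) (length bs) (\<lambda>(i, j). \<Sum>e\<in>E. to_ac ((bs ! i) e * (bs ! j) e) * x e)"

lemma gram_matrix_carrier [simp]: "gram_matrix E bs x \<in> carrier_mat (length bs) (length bs)"
  by (simp add: gram_matrix_def)

lemma mpoly_eval_config_form: "mpoly_eval (det (config_form E bs)) x = det (gram_matrix E bs x)"
proof -
  interpret comm_ring_hom "\<lambda>p. mpoly_eval p x"
    by unfold_locales simp_all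
  have "map_mat (\<lambda>p. mpoly_eval p x) (config_form E bs) = gram_matrix E bs x"
    by (rule eq_matI) (simp_all add: config_form_def gram_matrix_def monomial_value_def)
  then show ?thesis
    using hom_det[of "config_form E bs"] by simp
qed

lemma homogeneous_config_form: "homogeneous (length bs) (det (config_form E bs))"
proof -
  let ?A = "config_form E bs" and ?n = "length bs"
  have ent: "homogeneous (Suc 0) (?A $$ (i, j))" if "i < ?n" "j < ?n" for i j
    using that by (auto simp: config_form_def intro!: homogeneous_sum) (simp add: homogeneous_def)
  have prod: "homogeneous ?n (\<Prod>i = 0..<?n. ?A $$ (i, q i))" if q: "q permutes {0..<?n}" for q
    using homogeneous_prod[of "{0..<?n}" "\<lambda>_. Suc 0" "\<lambda>i. ?A $$ (i, q i)"] ent permutes_in_image[OF q]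
    by simp
  have "homogeneous ?n (signof q * (\<Prod>i = 0..<?n. ?A $$ (i, q i)))" if q: "q permutes {0..<?n}" for q
    using prod[OF q] homogeneous_uminus[OF prod[OF q]] signof_pm_one[of q, where 'a = "('a, 'b) mpoly"]
    by auto
  then show ?thesis
    unfolding det_def by (auto simp: config_form_def intro!: homogeneous_sum)
qed

lemma homogeneous_config_poly:
  obtains d where "homogeneous d (config_poly E W)"
  using homogeneous_config_form that unfolding config_poly_def by blast

text \<open>
  The two matrices are related by \<open>G' = P G P\<^sup>T\<close>, where the rows of \<open>P\<close> express \<open>bs\<close> through \<open>cs\<close>.
\<close>

lemma gram_matrix_base_change:
  assumes len: "length bs = length cs" and cs: "distinct cs" and span: "set bs \<subseteq> fun_space.span (set cs)"
    and zero: "det (gram_matrix E cs x) = 0"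
  shows "det (gram_matrix E bs x) = 0"
proof -
  let ?n = "length cs"
  have "\<exists>u. \<forall>e. (bs ! i) e = (\<Sum>k<?n. u k * (cs ! k) e)" if i: "i < ?n" for i
  proof -
    have "bs ! i \<in> fun_space.span (set cs)"
      using span i len by auto
    then obtain u where "bs ! i = (\<Sum>v\<in>set cs. fun_scale (u v) v)"
      unfolding fun_space.span_finite[OF finite_set] by blast
    also have "\<dots> = (\<Sum>k<?n. fun_scale (u (cs ! k)) (cs ! k))"
      using sum.reindex_bij_betw[OF bij_betw_nth[OF cs refl refl], of "\<lambda>v. fun_scale (u v) v"] by simp
    finally have "(bs ! i) e = (\<Sum>k<?n. u (cs ! k) * (cs ! k) e)" for e
      by (simp add: fun_scale_def sum_fun_apply)
    then show ?thesis
      by (intro exI[of _ "\<lambda>k. u (cs ! k)"]) simp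
  qed
  then obtain u where u: "\<And>i e. i < ?n \<Longrightarrow> (bs ! i) e = (\<Sum>k<?n. u i k * (cs ! k) e)"
    by metis
  let ?G = "gram_matrix E cs x"
  define P where "P = mat ?n ?n (\<lambda>(i, k). to_ac (u i k))"
  define Q where "Q = mat ?n ?n (\<lambda>(k, i). to_ac (u i k))"
  have P: "P \<in> carrier_mat ?n ?n" and Q: "Q \<in> carrier_mat ?n ?n"
    by (simp_all add: P_def Q_def)
  have "gram_matrix E bs x = P * ?G * Q"
  proof (rule eq_matI)
    fix i j assume "i < dim_row (P * ?G * Q)" "j < dim_col (P * ?G * Q)"
    then have i: "i < ?n" and j: "j < ?n"
      by (simp_all add: P_def Q_def)
    have "(P * ?G * Q) $$ (i, j) = (\<Sum>l<?n. (\<Sum>k<?n. to_ac (u i k) * (\<Sum>e\<in>E. to_ac ((cs ! k) e * (cs ! l) e) * x e)) * to_ac (u j l))"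
      using i j by (simp add: P_def Q_def gram_matrix_def scalar_prod_def atLeast0LessThan)
    also have "\<dots> = (\<Sum>l<?n. \<Sum>k<?n. \<Sum>e\<in>E. to_ac (u i k) * (to_ac ((cs ! k) e) * to_ac ((cs ! l) e) * x e) * to_ac (u j l))"
      by (simp add: sum_distrib_left sum_distrib_right)
    also have "\<dots> = (\<Sum>l<?n. \<Sum>e\<in>E. \<Sum>k<?n. to_ac (u i k) * (to_ac ((cs ! k) e) * to_ac ((cs ! l) e) * x e) * to_ac (u j l))"
      by (intro sum.cong refl sum.swap)
    also have "\<dots> = (\<Sum>e\<in>E. \<Sum>l<?n. \<Sum>k<?n. to_ac (u i k) * (to_ac ((cs ! k) e) * to_ac ((cs ! l) e) * x e) * to_ac (u j l))"
      by (rule sum.swap)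
    also have "\<dots> = (\<Sum>e\<in>E. to_ac ((bs ! i) e * (bs ! j) e) * x e)"
    proof (rule sum.cong[OF refl])
      fix e
      have "to_ac ((bs ! i) e * (bs ! j) e) * x e =
          (\<Sum>k<?n. to_ac (u i k) * to_ac ((cs ! k) e)) * (\<Sum>l<?n. to_ac (u j l) * to_ac ((cs ! l) e)) * x e"
        by (simp add: u[OF i] u[OF j] to_ac_sum)
      also have "\<dots> = (\<Sum>l<?n. \<Sum>k<?n. to_ac (u i k) * (to_ac ((cs ! k) e) * to_ac ((cs ! l) e) * x e) * to_ac (u j l))"
        by (subst sum_product, subst sum.swap) (simp add: sum_distrib_left sum_distrib_right mult_ac)
      finally show "(\<Sum>l<?n. \<Sum>k<?n. to_ac (u i k) * (to_ac ((cs ! k) e) * to_ac ((cs ! l) e) * x e) * to_ac (u j l)) =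
          to_ac ((bs ! i) e * (bs ! j) e) * x e" by simp
    qed
    finally show "gram_matrix E bs x $$ (i, j) = (P * ?G * Q) $$ (i, j)"
      using i j len by (simp add: gram_matrix_def)
  qed (simp_all add: P_def Q_def gram_matrix_def len)
  then show ?thesis
    using zero det_mult[OF mult_carrier_mat[OF P gram_matrix_carrier] Q] det_mult[OF P gram_matrix_carrier] by simp
qed

section \<open>Bases of configurations\<close>

lemma configuration_subspace: "configuration E W \<Longrightarrow> fun_space.subspace W"
  by (simp add: configuration_def)

lemma configuration_support: "configuration E W \<Longrightarrow> w \<in> W \<Longrightarrow> e \<notin> E \<Longrightarrow> w e = 0"
  by (auto simp: configuration_def)

lemma configuration_span_units:
  assumes E: "finite E" and W: "configuration E W"
  shows "W \<subseteq> fun_space.span ((\<lambda>e e'. if e' = e then 1 else 0) ` E)"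
proof
  fix w assume w: "w \<in> W"
  let ?u = "\<lambda>e e'. if e' = e then 1 else 0"
  have "w = (\<Sum>e\<in>E. fun_scale (w e) (?u e))"
  proof
    fix e
    show "w e = (\<Sum>e\<in>E. fun_scale (w e) (?u e)) e"
      using configuration_support[OF W w, of e] E by (cases "e \<in> E") (simp_all add: fun_scale_def sum_fun_apply if_distrib cong: if_cong)
  qed
  moreover have "(\<Sum>e\<in>E. fun_scale (w e) (?u e)) \<in> fun_space.span (?u ` E)"
    by (intro fun_space.span_sum fun_space.span_scale fun_space.span_base) auto
  ultimately show "w \<in> fun_space.span (?u ` E)"
    by metis
qed

lemma config_basis_exists:
  assumes E: "finite E" and W: "configuration E W" and V: "V \<subseteq> W" "W \<subseteq> fun_space.span V"
  obtains bs where "config_basis W bs" "set bs \<subseteq> V"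
proof -
  obtain B where B: "B \<subseteq> V" "fun_space.independent B" "V \<subseteq> fun_space.span B"
    by (rule fun_space.maximal_independent_subset)
  have "finite B"
    using fun_space.independent_span_bound[OF _ B(2), of "(\<lambda>e e'. if e' = e then 1 else 0) ` E"]
      configuration_span_units[OF E W] B(1) V(1) E by blast
  then obtain bs where bs: "set bs = B" "distinct bs"
    using finite_distinct_list by blast
  have "fun_space.span B \<subseteq> W"
    by (rule fun_space.span_minimal[OF _ configuration_subspace[OF W]]) (use B V in auto)
  moreover have "W \<subseteq> fun_space.span B"
    using V(2) fun_space.span_minimal[OF B(3) fun_space.subspace_span] by auto
  ultimately have "config_basis W bs"
    using bs B(2) by (simp add: config_basis_def)
  then show thesis
    using that bs B(1) by simp
qed

text \<open>
  The configuration polynomial is defined by an unspecified basis; its non-vanishing can be tested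
  on any other one.
\<close>

lemma config_poly_nonzero_iff:
  assumes bs: "config_basis W bs"
  shows "mpoly_eval (config_poly E W) x \<noteq> 0 \<longleftrightarrow> det (gram_matrix E bs x) \<noteq> 0"
proof -
  define cs where "cs = (SOME bs. config_basis W bs)"
  have cs: "config_basis W cs"
    unfolding cs_def using bs by (rule someI)
  have "card (set bs) = card (set cs)"
    using bs cs fun_space.dim_span_eq_card_independent unfolding config_basis_def by metis
  then have len: "length bs = length cs"
    using bs cs by (simp add: config_basis_def distinct_card)
  have "det (gram_matrix E cs x) = 0 \<longleftrightarrow> det (gram_matrix E bs x) = 0"
  proof
    assume 0: "det (gram_matrix E cs x) = 0"
    show "det (gram_matrix E bs x) = 0"
      by (rule gram_matrix_base_change[OF len _ _ 0]) (use bs cs fun_space.span_superset in \<open>auto simp: config_basis_def\<close>)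
  next
    assume 0: "det (gram_matrix E bs x) = 0"
    show "det (gram_matrix E cs x) = 0"
      by (rule gram_matrix_base_change[OF len[symmetric] _ _ 0]) (use bs cs fun_space.span_superset in \<open>auto simp: config_basis_def\<close>)
  qed
  then show ?thesis
    by (simp add: config_poly_def mpoly_eval_config_form cs_def)
qed

section \<open>Restriction of configurations to spanning sets\<close>

definition restrict_coords :: "'e set \<Rightarrow> ('e \<Rightarrow> 'k::field) \<Rightarrow> 'e \<Rightarrow> 'k" where
  "restrict_coords S w = (\<lambda>e. if e \<in> S then w e else 0)"

lemma config_restrict_image: "config_restrict W S = restrict_coords S ` W"
  by (simp add: config_restrict_def restrict_coords_def)

lemma linear_restrict_coords: "Vector_Spaces.linear fun_scale fun_scale (restrict_coords S)"
  by (simp add: Vector_Spaces.linear_iff fun_space.vector_space_axioms restrict_coords_def fun_scale_def fun_eq_iff)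

lemma configuration_restrict:
  assumes "configuration E W"
  shows "configuration S (config_restrict W S)"
proof -
  interpret Vector_Spaces.linear fun_scale fun_scale "restrict_coords S :: ('a \<Rightarrow> 'b) \<Rightarrow> _"
    by (rule linear_restrict_coords)
  show ?thesis
    unfolding configuration_def config_restrict_image
    using subspace_image[OF configuration_subspace[OF assms]] by (auto simp: restrict_coords_def)
qed

text \<open>
  Dually, the coordinate functions from \<open>S\<close> span the dual space of \<open>W\<close>. For subsets of the ground set
  this is the matroid notion, by \<open>mat_closure_spanning\<close>.
\<close>

definition spanning :: "('e \<Rightarrow> 'k::field) set \<Rightarrow> 'e set \<Rightarrow> bool" where
  "spanning W S \<longleftrightarrow> (\<forall>w\<in>W. (\<forall>e\<in>S. w e = 0) \<longrightarrow> w = 0)"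

text \<open>
  Restriction to \<open>S\<close> is injective on \<open>W\<close> and carries a basis to a basis with the same Gram matrix,
  because the other coordinates of \<open>x\<close> are zero.
\<close>

lemma config_poly_restrict_spanning:
  assumes E: "finite E" and W: "configuration E W" and S: "S \<subseteq> E" and sp: "spanning W S"
    and x: "x \<in> affine_points S"
  shows "mpoly_eval (config_poly S (config_restrict W S)) x \<noteq> 0 \<longleftrightarrow> mpoly_eval (config_poly E W) x \<noteq> 0"
proof -
  interpret Vector_Spaces.linear fun_scale fun_scale "restrict_coords S :: ('a \<Rightarrow> 'b) \<Rightarrow> _"
    by (rule linear_restrict_coords)
  obtain bs where bs: "config_basis W bs"
    by (rule config_basis_exists[OF E W order_refl fun_space.span_superset])
  let ?cs = "map (restrict_coords S) bs"
  have inj: "inj_on (restrict_coords S) W"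
  proof (rule inj_onI)
    fix v w assume vw: "v \<in> W" "w \<in> W" and eq: "restrict_coords S v = restrict_coords S w"
    have "v - w \<in> W"
      by (rule fun_space.subspace_diff[OF configuration_subspace[OF W] vw])
    moreover have "\<forall>e\<in>S. (v - w) e = 0"
      using fun_cong[OF eq] by (auto simp: restrict_coords_def) metis
    ultimately show "v = w"
      using sp by (auto simp: spanning_def)
  qed
  have "set bs \<subseteq> W"
    using bs fun_space.span_superset by (auto simp: config_basis_def)
  then have "distinct ?cs"
    using bs inj by (simp add: distinct_map config_basis_def inj_on_subset)
  moreover have "fun_space.independent (set ?cs)"
    using bs inj independent_injective_image[of "set bs"] by (simp add: config_basis_def)
  moreover have "fun_space.span (set ?cs) = config_restrict W S"
    using bs span_image[of "set bs"] by (simp add: config_basis_def config_restrict_image)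
  ultimately have cs: "config_basis (config_restrict W S) ?cs"
    by (simp add: config_basis_def)
  have "gram_matrix S ?cs x = gram_matrix E bs x"
  proof (rule eq_matI)
    fix i j assume ij: "i < dim_row (gram_matrix E bs x)" "j < dim_col (gram_matrix E bs x)"
    have "(\<Sum>e\<in>S. to_ac ((?cs ! i) e * (?cs ! j) e) * x e) = (\<Sum>e\<in>E. to_ac ((bs ! i) e * (bs ! j) e) * x e)"
      by (rule sum.mono_neutral_cong_left) (use E S x ij in \<open>auto simp: affine_points_def restrict_coords_def gram_matrix_def\<close>)
    then show "gram_matrix S ?cs x $$ (i, j) = gram_matrix E bs x $$ (i, j)"
      using ij by (simp add: gram_matrix_def)
  qed (simp_all add: gram_matrix_def)
  then show ?thesis
    using config_poly_nonzero_iff[OF cs] config_poly_nonzero_iff[OF bs] by simp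
qed

text \<open>
  The coefficients of a non-zero vector \<open>w\<close> of \<open>W\<close> that vanishes on \<open>S\<close> are a kernel vector of the
  Gram matrix, since each \<open>x\<^sub>e w\<^sub>e\<close> is zero.
\<close>

lemma config_poly_restrict_nonspanning:
  assumes E: "finite E" and W: "configuration E W" and sp: "\<not> spanning W S"
    and x: "x \<in> affine_points S"
  shows "mpoly_eval (config_poly E W) x = 0"
proof -
  obtain w where w: "w \<in> W" "\<forall>e\<in>S. w e = 0" "w \<noteq> 0"
    using sp by (auto simp: spanning_def)
  obtain bs where bs: "config_basis W bs"
    by (rule config_basis_exists[OF E W order_refl fun_space.span_superset])
  let ?n = "length bs"
  have "w \<in> fun_space.span (set bs)"
    using bs w(1) by (simp add: config_basis_def)
  then obtain u where "w = (\<Sum>v\<in>set bs. fun_scale (u v) v)"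
    unfolding fun_space.span_finite[OF finite_set] by blast
  also have "\<dots> = (\<Sum>k<?n. fun_scale (u (bs ! k)) (bs ! k))"
    using sum.reindex_bij_betw[OF bij_betw_nth[OF _ refl refl], of bs "\<lambda>v. fun_scale (u v) v"] bs
    by (simp add: config_basis_def)
  finally have we: "w e = (\<Sum>k<?n. u (bs ! k) * (bs ! k) e)" for e
    by (simp add: fun_scale_def sum_fun_apply)
  define v where "v = vec ?n (\<lambda>k. to_ac (u (bs ! k)))"
  have "v \<noteq> 0\<^sub>v ?n"
  proof
    assume "v = 0\<^sub>v ?n"
    then have "v $ k = 0" if "k < ?n" for k
      using that by simp
    then have "u (bs ! k) = 0" if "k < ?n" for k
      using that by (simp add: v_def)
    then have "w = 0"
      using we by (auto simp: fun_eq_iff)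
    then show False
      using w(3) by simp
  qed
  moreover have "gram_matrix E bs x *\<^sub>v v = 0\<^sub>v ?n"
  proof (rule eq_vecI)
    fix i assume i: "i < dim_vec (0\<^sub>v ?n :: 'b alg_closure vec)"
    then have "(gram_matrix E bs x *\<^sub>v v) $ i =
        (\<Sum>k<?n. (\<Sum>e\<in>E. to_ac ((bs ! i) e * (bs ! k) e) * x e) * to_ac (u (bs ! k)))"
      by (simp add: gram_matrix_def v_def scalar_prod_def atLeast0LessThan)
    also have "\<dots> = (\<Sum>k<?n. \<Sum>e\<in>E. to_ac ((bs ! i) e) * x e * to_ac (u (bs ! k) * (bs ! k) e))"
      unfolding sum_distrib_right by (simp add: mult_ac)
    also have "\<dots> = (\<Sum>e\<in>E. \<Sum>k<?n. to_ac ((bs ! i) e) * x e * to_ac (u (bs ! k) * (bs ! k) e))"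
      by (rule sum.swap)
    also have "\<dots> = (\<Sum>e\<in>E. to_ac ((bs ! i) e) * x e * to_ac (w e))"
      by (simp add: we to_ac_sum sum_distrib_left)
    also have "\<dots> = 0"
      by (rule sum.neutral) (use w(2) x in \<open>auto simp: affine_points_def\<close>)
    finally show "(gram_matrix E bs x *\<^sub>v v) $ i = 0\<^sub>v ?n $ i"
      using i by simp
  qed (simp add: gram_matrix_def)
  moreover have "v \<in> carrier_vec ?n"
    by (simp add: v_def)
  ultimately have "det (gram_matrix E bs x) = 0"
    using det_0_iff_vec_prod_zero[OF gram_matrix_carrier, of E bs x] by blast
  then show ?thesis
    using config_poly_nonzero_iff[OF bs] by blast
qed

section \<open>Scaling a direct summand\<close>

text \<open>
  In a basis of vectors supported on \<open>A\<close> or on \<open>B\<close>, scaling the coordinates in \<open>B\<close> multiplies the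
  rows of the latter vectors by \<open>t \<noteq> 0\<close> and leaves the other rows unchanged, so the kernel of the Gram
  matrix stays the same.
\<close>

lemma config_poly_scale_summand:
  assumes E: "finite E" and W: "configuration E W" and AB: "A \<union> B = E" "A \<inter> B = {}"
    and split: "\<And>w. w \<in> W \<Longrightarrow> \<exists>w'\<in>W. (\<forall>e\<in>A. w' e = w e) \<and> (\<forall>e\<in>B. w' e = 0)"
    and t: "t \<noteq> 0" and nz: "mpoly_eval (config_poly E W) x \<noteq> 0"
  shows "mpoly_eval (config_poly E W) (\<lambda>e. if e \<in> B then t * x e else x e) \<noteq> 0"
proof -
  let ?y = "\<lambda>e. if e \<in> B then t * x e else x e"
  let ?V = "{w \<in> W. \<forall>e\<in>B. w e = 0} \<union> {w \<in> W. \<forall>e\<in>A. w e = 0}"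
  have VW: "?V \<subseteq> W"
    by auto
  have sp: "W \<subseteq> fun_space.span ?V"
  proof
    fix w assume w: "w \<in> W"
    from split[OF w] obtain w' where w': "w' \<in> W" "\<forall>e\<in>A. w' e = w e" "\<forall>e\<in>B. w' e = 0"
      by blast
    have "w - w' \<in> W"
      by (rule fun_space.subspace_diff[OF configuration_subspace[OF W] w w'(1)])
    then have "w' \<in> fun_space.span ?V" "w - w' \<in> fun_space.span ?V"
      using w' by (auto intro!: fun_space.span_base)
    from fun_space.span_add[OF this] show "w \<in> fun_space.span ?V"
      by simp
  qed
  obtain bs where bs: "config_basis W bs" "set bs \<subseteq> ?V"
    by (rule config_basis_exists[OF E W VW sp])
  let ?n = "length bs"
  have row: "\<exists>c. c \<noteq> 0 \<and> (\<forall>j<?n. gram_matrix E bs ?y $$ (i, j) = c * gram_matrix E bs x $$ (i, j))" if i: "i < ?n" for i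
  proof -
    have "bs ! i \<in> ?V"
      by (rule subsetD[OF bs(2) nth_mem[OF i]])
    then consider "\<forall>e\<in>B. (bs ! i) e = 0" | "\<forall>e\<in>A. (bs ! i) e = 0"
      by auto
    then show ?thesis
    proof cases
      case 1
      then have "(\<Sum>e\<in>E. to_ac ((bs ! i) e * (bs ! j) e) * ?y e) = (\<Sum>e\<in>E. to_ac ((bs ! i) e * (bs ! j) e) * x e)" for j
        by (intro sum.cong) auto
      then show ?thesis
        using i by (intro exI[of _ 1]) (simp add: gram_matrix_def del: to_ac_mult)
    next
      case 2
      then have "(\<Sum>e\<in>E. to_ac ((bs ! i) e * (bs ! j) e) * ?y e) = t * (\<Sum>e\<in>E. to_ac ((bs ! i) e * (bs ! j) e) * x e)" for j
        unfolding sum_distrib_left by (intro sum.cong) (use AB in auto)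
      then show ?thesis
        using i t by (intro exI[of _ t]) (simp add: gram_matrix_def del: to_ac_mult)
    qed
  qed
  have "det (gram_matrix E bs ?y) \<noteq> 0"
  proof
    assume "det (gram_matrix E bs ?y) = 0"
    then obtain v where v: "v \<in> carrier_vec ?n" "v \<noteq> 0\<^sub>v ?n" "gram_matrix E bs ?y *\<^sub>v v = 0\<^sub>v ?n"
      using det_0_iff_vec_prod_zero[OF gram_matrix_carrier, of E bs ?y] by auto
    have "gram_matrix E bs x *\<^sub>v v = 0\<^sub>v ?n"
    proof (rule eq_vecI)
      fix i assume "i < dim_vec (0\<^sub>v ?n :: 'b alg_closure vec)"
      then have i: "i < ?n" by simp
      obtain c where c: "c \<noteq> 0" "\<And>j. j < ?n \<Longrightarrow> gram_matrix E bs ?y $$ (i, j) = c * gram_matrix E bs x $$ (i, j)"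
        using row[OF i] by blast
      have mv: "(gram_matrix E bs z *\<^sub>v v) $ i = (\<Sum>j<?n. gram_matrix E bs z $$ (i, j) * v $ j)" for z
        using i v(1) by (simp add: gram_matrix_def scalar_prod_def atLeast0LessThan)
      have "0 = (gram_matrix E bs ?y *\<^sub>v v) $ i"
        using v(3) i by simp
      also have "\<dots> = c * (gram_matrix E bs x *\<^sub>v v) $ i"
        unfolding mv sum_distrib_left by (rule sum.cong) (use c(2) in auto)
      finally show "(gram_matrix E bs x *\<^sub>v v) $ i = 0\<^sub>v ?n $ i"
        using c(1) i by simp
    qed (simp add: gram_matrix_def)
    then have "det (gram_matrix E bs x) = 0"
      using v det_0_iff_vec_prod_zero[OF gram_matrix_carrier, of E bs x] by auto
    then show False
      using nz config_poly_nonzero_iff[OF bs(1)] by blast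
  qed
  then show ?thesis
    using config_poly_nonzero_iff[OF bs(1)] by blast
qed

section \<open>The matroid of a configuration\<close>

definition config_independent :: "('e \<Rightarrow> 'k::field) set \<Rightarrow> 'e set \<Rightarrow> bool" where
  "config_independent W I \<longleftrightarrow> (\<forall>c. (\<forall>w\<in>W. (\<Sum>e\<in>I. c e * w e) = 0) \<longrightarrow> (\<forall>e\<in>I. c e = 0))"

text \<open>
  The closure operator of the matroid, described dually: the coordinates that vanish on the
  vectors of \<open>W\<close> that vanish on \<open>S\<close>. See \<open>mat_closure_config\<close>.
\<close>

definition vanishing_closure :: "('e \<Rightarrow> 'k::field) set \<Rightarrow> 'e set \<Rightarrow> 'e set" where
  "vanishing_closure W S = {e. \<forall>w\<in>W. (\<forall>f\<in>S. w f = 0) \<longrightarrow> w e = 0}"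

lemma config_matroid_independent:
  "config_matroid E W = (E, \<lambda>I. I \<subseteq> E \<and> config_independent W I)"
  by (simp add: config_matroid_def config_independent_def)

lemma config_independentD:
  "\<lbrakk>config_independent W I; \<And>w. w \<in> W \<Longrightarrow> (\<Sum>e\<in>I. c e * w e) = 0; e \<in> I\<rbrakk> \<Longrightarrow> c e = 0"
  by (simp add: config_independent_def)

lemma config_independent_empty [simp]: "config_independent W {}"
  by (simp add: config_independent_def)

text \<open>
  Linear duality: a functional that vanishes on the common kernel of finitely many others is a
  linear combination of them. In the induction step \<open>W\<close> is replaced by the kernel of the functional
  that is added.
\<close>

lemma vanishing_closure_linear_combination:
  assumes "finite F" "fun_space.subspace W" "e \<in> vanishing_closure W F"
  shows "\<exists>c. \<forall>w\<in>W. w e = (\<Sum>f\<in>F. c f * w f)"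
  using assms
proof (induction F arbitrary: W rule: finite_induct)
  case empty
  then show ?case
    by (auto simp: vanishing_closure_def)
next
  case (insert g F)
  let ?W = "{w \<in> W. w g = 0}"
  have "fun_space.subspace ?W"
  proof (rule fun_space.subspaceI)
    note W = insert.prems(1)
    show "0 \<in> ?W"
      using fun_space.subspace_0[OF W] by simp
    show "v + w \<in> ?W" if "v \<in> ?W" "w \<in> ?W" for v w
      using fun_space.subspace_add[OF W] that by simp
    show "fun_scale c v \<in> ?W" if "v \<in> ?W" for c v
      using fun_space.subspace_scale[OF W, of v c] that by (simp add: fun_scale_apply)
  qed
  moreover have "e \<in> vanishing_closure ?W F"
    using insert.prems(2) by (auto simp: vanishing_closure_def)
  ultimately obtain c where c: "\<forall>w\<in>?W. w e = (\<Sum>f\<in>F. c f * w f)"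
    using insert.IH by blast
  have upd: "(\<Sum>f\<in>insert g F. (c(g := a)) f * w f) = a * w g + (\<Sum>f\<in>F. c f * w f)" for a w
  proof -
    have "(\<Sum>f\<in>F. (c(g := a)) f * w f) = (\<Sum>f\<in>F. c f * w f)"
      by (rule sum.cong) (use insert.hyps in auto)
    then show ?thesis
      using insert.hyps by simp
  qed
  show ?case
  proof (cases "\<forall>w\<in>W. w g = 0")
    case True
    then show ?thesis
      using c upd[of 0] by (intro exI[of _ "c(g := 0)"]) auto
  next
    case False
    then obtain v where v: "v \<in> W" "v g \<noteq> 0"
      by blast
    \<comment> \<open>the value for which the claimed identity holds at \<open>v\<close>, which together with \<open>?W\<close> spans \<open>W\<close>\<close>
    define a where "a = (v e - (\<Sum>f\<in>F. c f * v f)) / v g"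
    have "w e = a * w g + (\<Sum>f\<in>F. c f * w f)" if w: "w \<in> W" for w
    proof -
      let ?u = "w - fun_scale (w g / v g) v"
      have "?u \<in> W"
        using insert.prems(1) w v(1) by (intro fun_space.subspace_diff fun_space.subspace_scale)
      then have "?u \<in> ?W"
        using v(2) by (simp add: fun_scale_apply)
      then have "?u e = (\<Sum>f\<in>F. c f * ?u f)"
        using c by blast
      then have "w e = (w g / v g) * v e + (\<Sum>f\<in>F. c f * w f) - (w g / v g) * (\<Sum>f\<in>F. c f * v f)"
        by (simp add: fun_scale_apply algebra_simps sum_subtractf sum_distrib_left)
      then show ?thesis
        by (simp add: a_def diff_divide_distrib algebra_simps)
    qed
    then show ?thesis
      using upd[of a] by (intro exI[of _ "c(g := a)"]) auto
  qed
qed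

lemma config_independent_insert:
  assumes I: "finite I" and e: "e \<notin> I" and ind: "config_independent W I" and dep: "\<not> config_independent W (insert e I)"
  shows "e \<in> vanishing_closure W I"
proof -
  obtain c f where c: "\<forall>w\<in>W. (\<Sum>e\<in>insert e I. c e * w e) = 0" "f \<in> insert e I" "c f \<noteq> 0"
    using dep by (auto simp: config_independent_def)
  have eq: "c e * w e + (\<Sum>e\<in>I. c e * w e) = 0" if "w \<in> W" for w
    using c(1) that I e by auto
  have "c e \<noteq> 0"
  proof
    assume "c e = 0"
    then have "\<forall>w\<in>W. (\<Sum>e\<in>I. c e * w e) = 0"
      using eq by auto
    then have "\<forall>e\<in>I. c e = 0"
      using ind by (auto simp: config_independent_def)
    then show False
      using c(2,3) \<open>c e = 0\<close> by auto
  qed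
  then show ?thesis
    using eq unfolding vanishing_closure_def by fastforce
qed

lemma config_independent_not_closure:
  assumes I: "finite I" and W: "fun_space.subspace W" and ind: "config_independent W I" and e: "e \<in> I"
  shows "e \<notin> vanishing_closure W (I - {e})"
proof
  assume "e \<in> vanishing_closure W (I - {e})"
  then obtain c where c: "\<forall>w\<in>W. w e = (\<Sum>f\<in>I - {e}. c f * w f)"
    using vanishing_closure_linear_combination[OF _ W] I by blast
  \<comment> \<open>moving \<open>w e\<close> to the other side gives a relation with coefficient \<open>- 1\<close> at \<open>e\<close>\<close>
  have "(\<Sum>f\<in>I. (c(e := - 1)) f * w f) = 0" if "w \<in> W" for w
  proof -
    have "(\<Sum>f\<in>I - {e}. (c(e := - 1)) f * w f) = (\<Sum>f\<in>I - {e}. c f * w f)"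
      by (rule sum.cong) auto
    then show ?thesis
      using c that sum.remove[OF I e, of "\<lambda>f. (c(e := - 1)) f * w f"] by simp
  qed
  from config_independentD[OF ind this e] have "(c(e := - 1)) e = 0" .
  then show False
    by simp
qed

text \<open>
  Independent coordinate functions admit a dual family of vectors in \<open>W\<close>.
\<close>

lemma config_independent_interpolation:
  assumes I: "finite I" and W: "fun_space.subspace W" and ind: "config_independent W I"
  obtains w where "w \<in> W" "\<And>e. e \<in> I \<Longrightarrow> w e = g e"
proof -
  have "\<forall>e\<in>I. \<exists>u\<in>W. u e \<noteq> 0 \<and> (\<forall>f\<in>I - {e}. u f = 0)"
    using config_independent_not_closure[OF I W ind] by (auto simp: vanishing_closure_def)
  then obtain u where u: "\<And>e. e \<in> I \<Longrightarrow> u e \<in> W" "\<And>e. e \<in> I \<Longrightarrow> u e e \<noteq> 0"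
    "\<And>e f. e \<in> I \<Longrightarrow> f \<in> I \<Longrightarrow> f \<noteq> e \<Longrightarrow> u e f = 0"
    by (metis Diff_iff singletonD)
  let ?w = "\<Sum>e\<in>I. fun_scale (g e / u e e) (u e)"
  show thesis
  proof (rule that)
    show "?w \<in> W"
      using u(1) W by (intro fun_space.subspace_sum fun_space.subspace_scale)
    fix e assume e: "e \<in> I"
    have "?w e = (\<Sum>f\<in>I. if f = e then g e else 0)"
      unfolding sum_fun_apply by (rule sum.cong) (use u e in \<open>auto simp: fun_scale_apply\<close>)
    then show "?w e = g e"
      using I e by simp
  qed
qed

lemma vanishing_closure_superset: "S \<subseteq> vanishing_closure W S"
  by (auto simp: vanishing_closure_def)

lemma vanishing_closure_trans: "S \<subseteq> vanishing_closure W T \<Longrightarrow> vanishing_closure W S \<subseteq> vanishing_closure W T"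
  by (fastforce simp: vanishing_closure_def)

lemma vanishing_closure_mono: "S \<subseteq> T \<Longrightarrow> vanishing_closure W S \<subseteq> vanishing_closure W T"
  by (auto simp: vanishing_closure_def)

text \<open>
  This is the Steinitz bound for the coordinate functions, viewed as vectors in the space of
  functions on \<open>W\<close>.
\<close>

lemma config_independent_card_le:
  fixes W :: "('e \<Rightarrow> 'k::field) set"
  assumes I: "finite I" and J: "finite J" and W: "fun_space.subspace W"
    and ind: "config_independent W J" and sub: "J \<subseteq> vanishing_closure W I"
  shows "card J \<le> card I"
proof -
  \<comment> \<open>coordinate functions on \<open>W\<close>, extended by zero so that they become vectors of a function space\<close>
  define ev :: "'e \<Rightarrow> ('e \<Rightarrow> 'k) \<Rightarrow> 'k" where "ev e = (\<lambda>w. if w \<in> W then w e else 0)" for e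
  have sum_ev: "(\<Sum>e\<in>A. fun_scale (c e) (ev e)) w = (if w \<in> W then \<Sum>e\<in>A. c e * w e else 0)" for A c w
    by (simp add: sum_fun_apply fun_scale_apply ev_def)
  \<comment> \<open>two equal coordinate functions would satisfy the relation with coefficients \<open>1\<close> and \<open>- 1\<close>\<close>
  have inj: "inj_on ev J"
  proof (rule inj_onI, rule ccontr)
    fix e f assume e: "e \<in> J" "f \<in> J" "ev e = ev f" "e \<noteq> f"
    have "(\<Sum>g\<in>J. (if g = e then 1 else if g = f then - 1 else 0) * w g) = 0" if w: "w \<in> W" for w
    proof -
      have "w e = w f"
        using fun_cong[OF e(3), of w] w by (simp add: ev_def)
      moreover have "(\<Sum>g\<in>J. (if g = e then 1 else if g = f then - 1 else 0) * w g) =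
          (\<Sum>g\<in>J. (if g = e then w e else 0) - (if g = f then w f else 0))"
        by (rule sum.cong) (use e(4) in auto)
      ultimately show ?thesis
        using e(1,2) J by (simp add: sum_subtractf)
    qed
    from config_independentD[OF ind this e(1)] show False
      by simp
  qed
  have "fun_space.independent (ev ` J)"
  proof
    assume "fun_space.dependent (ev ` J)"
    then obtain c e where e: "e \<in> J" "c (ev e) \<noteq> 0" and 0: "(\<Sum>x\<in>ev ` J. fun_scale (c x) x) = 0"
      using fun_space.dependent_finite[OF finite_imageI[OF J], of ev] by blast
    have "(\<Sum>e\<in>J. fun_scale (c (ev e)) (ev e)) = 0"
      using 0 by (simp add: sum.reindex[OF inj])
    then have "(\<Sum>e\<in>J. c (ev e) * w e) = 0" if "w \<in> W" for w
      using sum_ev[of "\<lambda>e. c (ev e)" J w] that by simp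
    with config_independentD[OF ind, of "\<lambda>e. c (ev e)" e] e show False
      by simp
  qed
  moreover have "ev ` J \<subseteq> fun_space.span (ev ` I)"
  proof
    fix x assume "x \<in> ev ` J"
    then obtain e where e: "e \<in> J" "x = ev e"
      by blast
    then obtain c where c: "\<forall>w\<in>W. w e = (\<Sum>f\<in>I. c f * w f)"
      using vanishing_closure_linear_combination[OF I W] sub by blast
    have "x = (\<Sum>f\<in>I. fun_scale (c f) (ev f))"
      using c by (auto simp: fun_eq_iff sum_ev e(2)) (simp_all add: ev_def)
    also have "\<dots> \<in> fun_space.span (ev ` I)"
      by (intro fun_space.span_sum fun_space.span_scale fun_space.span_base) simp
    finally show "x \<in> fun_space.span (ev ` I)" .
  qed
  ultimately have "card (ev ` J) \<le> card (ev ` I)"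
    using fun_space.independent_span_bound I by blast
  then show ?thesis
    using card_image[OF inj] card_image_le[OF I, of ev] by simp
qed

lemma config_independent_basis:
  assumes S: "finite S"
  obtains I where "I \<subseteq> S" "config_independent W I" "S \<subseteq> vanishing_closure W I"
proof -
  let ?F = "{I. I \<subseteq> S \<and> config_independent W I}"
  have "finite ?F" "{} \<in> ?F"
    using S by simp_all
  then have "\<exists>I\<in>?F. \<forall>J\<in>?F. I \<subseteq> J \<longrightarrow> I = J"
    by (intro finite_has_maximal) auto
  then obtain I where I: "I \<subseteq> S" "config_independent W I"
    and max: "\<forall>J\<in>?F. I \<subseteq> J \<longrightarrow> I = J"
    by auto
  have "e \<in> vanishing_closure W I" if e: "e \<in> S" for e
  proof (cases "e \<in> I")
    case True
    then show ?thesis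
      by (rule subsetD[OF vanishing_closure_superset])
  next
    case False
    then have "\<not> config_independent W (insert e I)"
      using bspec[OF max, of "insert e I"] I e by auto
    then show ?thesis
      by (rule config_independent_insert[OF finite_subset[OF I(1) S] False I(2)])
  qed
  then show thesis
    using that[OF I] by auto
qed

lemma mat_rank_config:
  assumes E: "finite E" and W: "configuration E W" and S: "S \<subseteq> E"
    and I: "I \<subseteq> S" "config_independent W I" "S \<subseteq> vanishing_closure W I"
  shows "mat_rank (config_matroid E W) S = card I"
proof -
  have fin: "finite S"
    by (rule finite_subset[OF S E])
  show ?thesis
    unfolding mat_rank_def config_matroid_independent
  proof (rule Max_eqI)
    show "finite (card ` {I. I \<subseteq> S \<inter> fst (E, \<lambda>I. I \<subseteq> E \<and> config_independent W I) \<and> snd (E, \<lambda>I. I \<subseteq> E \<and> config_independent W I) I})"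
      using fin by simp
    show "card I \<in> card ` {I. I \<subseteq> S \<inter> fst (E, \<lambda>I. I \<subseteq> E \<and> config_independent W I) \<and> snd (E, \<lambda>I. I \<subseteq> E \<and> config_independent W I) I}"
      using I S by auto
    fix n assume "n \<in> card ` {I. I \<subseteq> S \<inter> fst (E, \<lambda>I. I \<subseteq> E \<and> config_independent W I) \<and> snd (E, \<lambda>I. I \<subseteq> E \<and> config_independent W I) I}"
    then obtain J where J: "n = card J" "J \<subseteq> S" "config_independent W J"
      by auto
    show "n \<le> card I"
      unfolding J(1)
      by (rule config_independent_card_le[OF _ _ configuration_subspace[OF W] J(3)])
         (use I J fin finite_subset in auto)
  qed
qed

lemma mat_closure_config:
  assumes E: "finite E" and W: "configuration E W" and S: "S \<subseteq> E"
  shows "mat_closure (config_matroid E W) S = E \<inter> vanishing_closure W S"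
proof -
  obtain I where I: "I \<subseteq> S" "config_independent W I" "S \<subseteq> vanishing_closure W I"
    by (rule config_independent_basis[OF finite_subset[OF S E]])
  have fin: "finite I"
    by (rule finite_subset[OF I(1) finite_subset[OF S E]])
  note rS = mat_rank_config[OF E W S I]
  have eq: "vanishing_closure W S = vanishing_closure W I"
    by (rule equalityI[OF vanishing_closure_trans[OF I(3)] vanishing_closure_mono[OF I(1)]])
  have "mat_rank (config_matroid E W) (insert e S) = mat_rank (config_matroid E W) S \<longleftrightarrow> e \<in> vanishing_closure W S"
    if e: "e \<in> E" for e
  proof (cases "e \<in> vanishing_closure W I")
    case True
    then show ?thesis
      using mat_rank_config[OF E W _ _ I(2), of "insert e S"] I(1,3) S e rS eq by auto
  next
    case False
    then have "e \<notin> I"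
      using vanishing_closure_superset[of I W] by auto
    moreover have "config_independent W (insert e I)"
      using config_independent_insert[OF fin \<open>e \<notin> I\<close> I(2)] False by auto
    moreover have "insert e S \<subseteq> vanishing_closure W (insert e I)"
      using I(3) vanishing_closure_mono[of I "insert e I" W] vanishing_closure_superset[of "insert e I" W] by blast
    ultimately have "mat_rank (config_matroid E W) (insert e S) = card (insert e I)"
      by (intro mat_rank_config[OF E W]) (use I(1) S e in auto)
    then show ?thesis
      using rS eq False fin \<open>e \<notin> I\<close> by simp
  qed
  then show ?thesis
    by (auto simp: mat_closure_def config_matroid_def)
qed

lemma mat_closure_spanning:
  assumes E: "finite E" and W: "configuration E W" and S: "S \<subseteq> E"
  shows "mat_closure (config_matroid E W) S = E \<longleftrightarrow> spanning W S"
proof -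
  have "E \<subseteq> vanishing_closure W S \<longleftrightarrow> spanning W S"
    using configuration_support[OF W] by (fastforce simp: vanishing_closure_def spanning_def fun_eq_iff)
  then show ?thesis
    unfolding mat_closure_config[OF assms] by auto
qed

lemma config_matroid_restrict:
  assumes "S \<subseteq> E"
  shows "config_matroid S (config_restrict W S) = mat_restrict (config_matroid E W) S"
proof -
  have "(\<Sum>e\<in>I. c e * restrict_coords S w e) = (\<Sum>e\<in>I. c e * w e)" if "I \<subseteq> S" for I c and w :: "'a \<Rightarrow> 'b"
    by (rule sum.cong) (use that in \<open>auto simp: restrict_coords_def\<close>)
  then show ?thesis
    using assms by (auto simp: config_matroid_def mat_restrict_def config_restrict_image fun_eq_iff)
qed

section \<open>Disconnected matroids\<close>

text \<open>
  Bases \<open>I\<close> of \<open>A\<close> and \<open>J\<close> of \<open>B\<close> form an independent set together, so some vector of \<open>W\<close> agrees with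
  \<open>w\<close> on \<open>I\<close> and vanishes on \<open>J\<close>; since \<open>I\<close> and \<open>J\<close> determine the vectors on \<open>A\<close> and \<open>B\<close>, it does so
  on all of \<open>A\<close> and \<open>B\<close>.
\<close>

lemma config_split_summand:
  assumes A: "finite A" and B: "finite B" and W: "fun_space.subspace W" and disj: "A \<inter> B = {}"
    and sum: "\<And>I. I \<subseteq> A \<union> B \<Longrightarrow> config_independent W (I \<inter> A) \<Longrightarrow> config_independent W (I \<inter> B) \<Longrightarrow> config_independent W I"
    and w: "w \<in> W"
  shows "\<exists>w'\<in>W. (\<forall>e\<in>A. w' e = w e) \<and> (\<forall>e\<in>B. w' e = 0)"
proof -
  obtain I where I: "I \<subseteq> A" "config_independent W I" "A \<subseteq> vanishing_closure W I"
    by (rule config_independent_basis[OF A])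
  obtain J where J: "J \<subseteq> B" "config_independent W J" "B \<subseteq> vanishing_closure W J"
    by (rule config_independent_basis[OF B])
  have "(I \<union> J) \<inter> A = I" "(I \<union> J) \<inter> B = J"
    using I(1) J(1) disj by auto
  then have "config_independent W (I \<union> J)"
    using sum[of "I \<union> J"] I J by auto
  moreover have "finite (I \<union> J)"
    using I(1) J(1) A B finite_subset by auto
  ultimately obtain w' where w': "w' \<in> W" "\<And>e. e \<in> I \<union> J \<Longrightarrow> w' e = (if e \<in> I then w e else 0)"
    using config_independent_interpolation[OF _ W, of "I \<union> J" "\<lambda>e. if e \<in> I then w e else 0"] by metis
  have diff: "w' - w \<in> W"
    by (rule fun_space.subspace_diff[OF W w'(1) w])
  have "w' e = w e" if "e \<in> A" for e
  proof -
    have "e \<in> vanishing_closure W I"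
      using I(3) that by blast
    moreover have "\<forall>f\<in>I. (w' - w) f = 0"
      using w'(2) by simp
    ultimately have "(w' - w) e = 0"
      using diff unfolding vanishing_closure_def by blast
    then show ?thesis
      by simp
  qed
  moreover have "w' e = 0" if "e \<in> B" for e
  proof -
    have "e \<in> vanishing_closure W J"
      using J(3) that by blast
    moreover have "\<forall>f\<in>J. w' f = 0"
      using w'(2) I(1) J(1) disj by auto
    ultimately show ?thesis
      using w'(1) unfolding vanishing_closure_def by blast
  qed
  ultimately show ?thesis
    using w'(1) by blast
qed

lemma config_disconnectedE:
  assumes E: "finite E" and W: "configuration E W" and dis: "\<not> mat_connected (config_matroid E W)"
  obtains A B where "A \<noteq> {}" "B \<noteq> {}" "A \<inter> B = {}" "A \<union> B = E"
    "\<forall>I\<subseteq>E. config_independent W I \<longleftrightarrow> config_independent W (I \<inter> A) \<and> config_independent W (I \<inter> B)"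
    "\<forall>w\<in>W. \<exists>w'\<in>W. (\<forall>e\<in>A. w' e = w e) \<and> (\<forall>e\<in>B. w' e = 0)"
proof -
  have "\<exists>A B. A \<noteq> {} \<and> B \<noteq> {} \<and> A \<inter> B = {} \<and> A \<union> B = E \<and>
     (\<forall>I\<subseteq>E. I \<subseteq> E \<and> config_independent W I \<longleftrightarrow>
       (I \<inter> A \<subseteq> E \<and> config_independent W (I \<inter> A)) \<and> (I \<inter> B \<subseteq> E \<and> config_independent W (I \<inter> B)))"
    using dis by (simp only: mat_connected_def config_matroid_independent not_not fst_conv snd_conv)
  then obtain A B where AB: "A \<noteq> {}" "B \<noteq> {}" "A \<inter> B = {}" "A \<union> B = E"
    and *: "\<forall>I\<subseteq>E. I \<subseteq> E \<and> config_independent W I \<longleftrightarrow>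
      (I \<inter> A \<subseteq> E \<and> config_independent W (I \<inter> A)) \<and> (I \<inter> B \<subseteq> E \<and> config_independent W (I \<inter> B))"
    by (elim exE conjE)
  have ind: "\<forall>I\<subseteq>E. config_independent W I \<longleftrightarrow> config_independent W (I \<inter> A) \<and> config_independent W (I \<inter> B)"
  proof (intro allI impI)
    fix I assume "I \<subseteq> E"
    moreover from this have "I \<inter> A \<subseteq> E" "I \<inter> B \<subseteq> E"
      by auto
    ultimately show "config_independent W I \<longleftrightarrow> config_independent W (I \<inter> A) \<and> config_independent W (I \<inter> B)"
      using mp[OF spec[OF *, of I]] by simp
  qed
  have "finite A" "finite B"
    using AB(4) E finite_subset by auto
  have "\<forall>w\<in>W. \<exists>w'\<in>W. (\<forall>e\<in>A. w' e = w e) \<and> (\<forall>e\<in>B. w' e = 0)"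
  proof
    fix w assume w: "w \<in> W"
    show "\<exists>w'\<in>W. (\<forall>e\<in>A. w' e = w e) \<and> (\<forall>e\<in>B. w' e = 0)"
      by (rule config_split_summand[OF \<open>finite A\<close> \<open>finite B\<close> configuration_subspace[OF W] AB(3) _ w])
         (use mp[OF spec[OF ind]] AB(4) in simp)
  qed
  with AB ind show thesis
    by (rule that)
qed

text \<open>
  If \<open>S\<close> missed a summand, then the part of a vector of \<open>W\<close> on that summand would be a non-zero
  vector vanishing on \<open>S\<close>. Such vectors exist because there are no loops.
\<close>

lemma spanning_disconnected:
  assumes E: "finite E" and W: "configuration E W" and loopless: "mat_loopless (config_matroid E W)"
    and dis: "\<not> mat_connected (config_matroid E W)" and S: "S \<subseteq> E" "spanning W S"
  shows "\<not> mat_connected (mat_restrict (config_matroid E W) S)"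
proof -
  obtain A B where AB: "A \<noteq> {}" "B \<noteq> {}" "A \<inter> B = {}" "A \<union> B = E"
    and ind: "\<forall>I\<subseteq>E. config_independent W I \<longleftrightarrow> config_independent W (I \<inter> A) \<and> config_independent W (I \<inter> B)"
    and split: "\<forall>w\<in>W. \<exists>w'\<in>W. (\<forall>e\<in>A. w' e = w e) \<and> (\<forall>e\<in>B. w' e = 0)"
    by (rule config_disconnectedE[OF E W dis])
  have nonzero: "\<exists>w\<in>W. w e \<noteq> 0" if "e \<in> E" for e
  proof -
    have "config_independent W {e}"
      using loopless that by (auto simp: mat_loopless_def config_matroid_independent)
    from config_independentD[OF this, of "\<lambda>_. 1" e] show ?thesis
      by auto
  qed
  have zero: "w = 0" if "w \<in> W" "\<forall>e\<in>S. w e = 0" for w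
    using S(2) that by (auto simp: spanning_def)
  have "S \<inter> A \<noteq> {}"
  proof
    assume "S \<inter> A = {}"
    then have "S \<subseteq> B"
      using S(1) AB(4) by auto
    obtain a where a: "a \<in> A"
      using AB(1) by blast
    obtain w where w: "w \<in> W" "w a \<noteq> 0"
      using nonzero[of a] a AB(4) by blast
    obtain w' where w': "w' \<in> W" "\<forall>e\<in>A. w' e = w e" "\<forall>e\<in>B. w' e = 0"
      using bspec[OF split w(1)] by auto
    then have "w' = 0"
      using zero \<open>S \<subseteq> B\<close> by blast
    then show False
      using w'(2) a w(2) by auto
  qed
  moreover have "S \<inter> B \<noteq> {}"
  proof
    assume "S \<inter> B = {}"
    then have SA: "S \<subseteq> A"
      using S(1) AB(4) by auto
    obtain b where b: "b \<in> B"
      using AB(2) by blast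
    obtain w where w: "w \<in> W" "w b \<noteq> 0"
      using nonzero[of b] b AB(4) by blast
    obtain w' where w': "w' \<in> W" "\<forall>e\<in>A. w' e = w e" "\<forall>e\<in>B. w' e = 0"
      using bspec[OF split w(1)] by auto
    have "w - w' \<in> W"
      by (rule fun_space.subspace_diff[OF configuration_subspace[OF W] w(1) w'(1)])
    moreover have "\<forall>e\<in>S. (w - w') e = 0"
      using SA w'(2) by auto
    ultimately have "w - w' = 0"
      by (rule zero)
    then show False
      using w'(3) b w(2) fun_cong[of "w - w'" 0 b] by auto
  qed
  moreover have "\<forall>I\<subseteq>S. (I \<subseteq> S \<and> I \<subseteq> E \<and> config_independent W I) \<longleftrightarrow>
      (I \<inter> (S \<inter> A) \<subseteq> S \<and> I \<inter> (S \<inter> A) \<subseteq> E \<and> config_independent W (I \<inter> (S \<inter> A))) \<and>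
      (I \<inter> (S \<inter> B) \<subseteq> S \<and> I \<inter> (S \<inter> B) \<subseteq> E \<and> config_independent W (I \<inter> (S \<inter> B)))"
  proof (intro allI impI)
    fix I assume I: "I \<subseteq> S"
    then have "I \<inter> (S \<inter> A) = I \<inter> A" "I \<inter> (S \<inter> B) = I \<inter> B" "I \<subseteq> E" "I \<inter> A \<subseteq> S" "I \<inter> B \<subseteq> S" "I \<inter> A \<subseteq> E" "I \<inter> B \<subseteq> E"
      using S(1) by auto
    then show "(I \<subseteq> S \<and> I \<subseteq> E \<and> config_independent W I) \<longleftrightarrow>
      (I \<inter> (S \<inter> A) \<subseteq> S \<and> I \<inter> (S \<inter> A) \<subseteq> E \<and> config_independent W (I \<inter> (S \<inter> A))) \<and>
      (I \<inter> (S \<inter> B) \<subseteq> S \<and> I \<inter> (S \<inter> B) \<subseteq> E \<and> config_independent W (I \<inter> (S \<inter> B)))"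
      using mp[OF spec[OF ind, of I]] I by simp
  qed
  moreover have "(S \<inter> A) \<inter> (S \<inter> B) = {}" "(S \<inter> A) \<union> (S \<inter> B) = S"
    using AB(3,4) S(1) by auto
  ultimately show ?thesis
    by (simp only: mat_connected_def mat_restrict_def config_matroid_independent not_not fst_conv snd_conv)
       (intro exI[of _ "S \<inter> A"] exI[of _ "S \<inter> B"] conjI)
qed

section \<open>Classes of configuration hypersurface complements\<close>

lemma Y_compl_proj_compl: "Y_compl E W = proj_compl E (config_poly E W)"
proof -
  obtain d where "homogeneous d (config_poly E W)"
    by (rule homogeneous_config_poly)
  then have "proj_points E - config_hypersurface E W = {L \<in> proj_points E. mpoly_eval (config_poly E W) (line_rep L) \<noteq> 0}"
    by (auto simp: config_hypersurface_def proj_zeros_rep)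
  then show ?thesis
    by (simp add: Y_compl_def proj_compl_def)
qed

lemma torus_orbit_rep:
  assumes "finite E"
  shows "torus_orbit E = {L \<in> proj_points E. (\<Prod>e\<in>E. line_rep L e) \<noteq> 0}"
proof -
  have "(\<forall>x\<in>L. \<forall>e\<in>E. x e \<noteq> 0) \<longleftrightarrow> (\<forall>e\<in>E. line_rep L e \<noteq> 0)" if L: "L \<in> proj_points E" for L
  proof
    assume nz: "\<forall>e\<in>E. line_rep L e \<noteq> 0"
    show "\<forall>x\<in>L. \<forall>e\<in>E. x e \<noteq> 0"
    proof
      fix x assume "x \<in> L"
      then have "x \<in> line (line_rep L)"
        using line_rep_point(1)[OF L] by simp
      then show "\<forall>e\<in>E. x e \<noteq> 0"
        using nz by (auto simp: line_def)
    qed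
  qed (use line_rep_point(4)[OF L] in blast)
  then show ?thesis
    using assms by (auto simp: torus_orbit_def)
qed

lemma Y_torus_proj_compl:
  assumes "finite E"
  shows "Y_torus E W = proj_compl E (config_poly E W * (\<Prod>e\<in>E. mvar e))"
proof -
  obtain d where "homogeneous d (config_poly E W)"
    by (rule homogeneous_config_poly)
  then have "(proj_points E - config_hypersurface E W) \<inter> torus_orbit E =
      {L \<in> proj_points E. mpoly_eval (config_poly E W * (\<Prod>e\<in>E. mvar e)) (line_rep L) \<noteq> 0}"
    by (auto simp: config_hypersurface_def proj_zeros_rep torus_orbit_rep[OF assms])
  then show ?thesis
    by (simp add: Y_torus_def proj_compl_def)
qed

lemma K0_class_Y_compl_strata:
  assumes E: "finite E" and W: "configuration E W"
  shows "K0_class (Y_compl E W) = (\<Sum>S | S \<subseteq> E \<and> spanning W S. K0_class (Y_torus S (config_restrict W S)))"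
proof -
  obtain d where hom: "homogeneous d (config_poly E W)"
    by (rule homogeneous_config_poly)
  have "K0_class (Y_compl E W) = (\<Sum>S\<in>Pow E. K0_class (proj_compl S (config_poly E W * (\<Prod>e\<in>S. mvar e))))"
    unfolding Y_compl_proj_compl by (rule K0_class_proj_compl_strata[OF E hom])
  also have "\<dots> = (\<Sum>S | S \<subseteq> E \<and> spanning W S. K0_class (Y_torus S (config_restrict W S)))"
  proof (rule sum.mono_neutral_cong_right)
    show "\<forall>S\<in>Pow E - {S. S \<subseteq> E \<and> spanning W S}. K0_class (proj_compl S (config_poly E W * (\<Prod>e\<in>S. mvar e))) = 0"
    proof
      fix S assume "S \<in> Pow E - {S. S \<subseteq> E \<and> spanning W S}"
      then have S: "S \<subseteq> E" "\<not> spanning W S"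
        by auto
      have "homogeneous (d + (\<Sum>e\<in>S. Suc 0)) (config_poly E W * (\<Prod>e\<in>S. mvar e))"
        by (intro homogeneous_mult homogeneous_prod hom homogeneous_mvar)
      then show "K0_class (proj_compl S (config_poly E W * (\<Prod>e\<in>S. mvar e))) = 0"
        by (rule K0_class_proj_compl_zero[OF finite_subset[OF S(1) E]])
           (simp add: config_poly_restrict_nonspanning[OF E W S(2)])
    qed
    fix S assume "S \<in> {S. S \<subseteq> E \<and> spanning W S}"
    then have S: "S \<subseteq> E" "spanning W S"
      by auto
    have "proj_compl S (config_poly E W * (\<Prod>e\<in>S. mvar e)) =
        proj_compl S (config_poly S (config_restrict W S) * (\<Prod>e\<in>S. mvar e))"
      by (rule proj_compl_cong) (use config_poly_restrict_spanning[OF E W S] in auto)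
    then show "K0_class (proj_compl S (config_poly E W * (\<Prod>e\<in>S. mvar e))) = K0_class (Y_torus S (config_restrict W S))"
      by (simp add: Y_torus_proj_compl[OF finite_subset[OF S(1) E]])
  qed (use E in auto)
  finally show ?thesis .
qed

lemma K0_class_Y_torus_disconnected:
  assumes E: "finite E" and W: "configuration E W" and dis: "\<not> mat_connected (config_matroid E W)"
  shows "\<exists>c. K0_class (Y_torus E W) = torus_class * c"
proof -
  obtain A B where AB: "A \<noteq> {}" "B \<noteq> {}" "A \<inter> B = {}" "A \<union> B = E"
    and split: "\<forall>w\<in>W. \<exists>w'\<in>W. (\<forall>e\<in>A. w' e = w e) \<and> (\<forall>e\<in>B. w' e = 0)"
    by (rule config_disconnectedE[OF E W dis])
  obtain d where hom: "homogeneous d (config_poly E W)"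
    by (rule homogeneous_config_poly)
  obtain a b where ab: "a \<in> A" "b \<in> B"
    using AB(1,2) by blast
  have "homogeneous (d + (\<Sum>e\<in>E. Suc 0)) (config_poly E W * (\<Prod>e\<in>E. mvar e))"
    by (intro homogeneous_mult homogeneous_prod hom homogeneous_mvar)
  then show ?thesis
    unfolding Y_torus_proj_compl[OF E]
  proof (rule K0_class_torus_factor[OF E, where a = a and b = b and B = B])
    fix x :: "'a \<Rightarrow> 'b alg_closure" and t :: "'b alg_closure"
    assume "mpoly_eval (config_poly E W * (\<Prod>e\<in>E. mvar e)) x \<noteq> 0"
    then have nz: "mpoly_eval (config_poly E W) x \<noteq> 0" "\<forall>e\<in>E. x e \<noteq> 0"
      using E by auto
    then show "x a \<noteq> 0 \<and> x b \<noteq> 0"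
      using ab AB(4) by auto
    assume "t \<noteq> 0"
    then show "mpoly_eval (config_poly E W * (\<Prod>e\<in>E. mvar e)) (\<lambda>i. if i \<in> B then t * x i else x i) \<noteq> 0"
      using config_poly_scale_summand[OF E W AB(4,3) bspec[OF split] _ nz(1), of t] nz(2) E by auto
  qed (use ab AB in auto)
qed

section \<open>Moebius inversion over spanning sets\<close>

text \<open>
  Moebius inversion on a Boolean lattice. In the induction step the subsets with and without \<open>e\<close> have
  opposite signs, and their difference is the same kind of sum for \<open>T \<mapsto> F (insert e T)\<close>.
\<close>

lemma alternating_subset_sum:
  fixes F :: "'e set \<Rightarrow> 'r::{comm_ring, comm_monoid_mult}"
  assumes "finite E"
  shows "(\<Sum>S\<in>Pow E. (- 1) ^ card (E - S) * (\<Sum>T\<in>Pow S. F T)) = F E"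
  using assms
proof (induction E arbitrary: F rule: finite_induct)
  case (insert e E)
  let ?G = "\<lambda>S. \<Sum>T\<in>Pow S. F T"
  have e: "e \<notin> S" "finite S" if "S \<in> Pow E" for S
    using that insert.hyps finite_subset by auto
  have inj: "inj_on (insert e) (Pow S)" if "S \<in> Pow E" for S
    using e[OF that] by (auto simp: inj_on_def)
  have G: "?G (insert e S) = ?G S + (\<Sum>T\<in>Pow S. F (insert e T))" if S: "S \<in> Pow E" for S
    unfolding Pow_insert by (subst sum.union_disjoint) (use e[OF S] inj[OF S] in \<open>auto simp: sum.reindex\<close>)
  have "(\<Sum>S\<in>Pow (insert e E). (- 1) ^ card (insert e E - S) * ?G S) =
      (\<Sum>S\<in>Pow E. (- 1) ^ card (insert e E - S) * ?G S) +
      (\<Sum>S\<in>insert e ` Pow E. (- 1) ^ card (insert e E - S) * ?G S)"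
    unfolding Pow_insert by (rule sum.union_disjoint) (use insert.hyps in auto)
  also have "(\<Sum>S\<in>insert e ` Pow E. (- 1) ^ card (insert e E - S) * ?G S) =
      (\<Sum>S\<in>Pow E. (- 1) ^ card (E - S) * ?G (insert e S))"
  proof -
    have "insert e E - insert e S = E - S" if "S \<in> Pow E" for S
      using insert.hyps by auto
    then show ?thesis
      by (subst sum.reindex[OF inj]) (auto intro!: sum.cong)
  qed
  also have "(\<Sum>S\<in>Pow E. (- 1) ^ card (insert e E - S) * ?G S) = (\<Sum>S\<in>Pow E. - ((- 1) ^ card (E - S) * ?G S))"
  proof (rule sum.cong[OF refl])
    fix S assume S: "S \<in> Pow E"
    have "insert e E - S = insert e (E - S)"
      using e[OF S] by auto
    then show "(- 1) ^ card (insert e E - S) * ?G S = - ((- 1) ^ card (E - S) * ?G S)"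
      using insert.hyps by simp
  qed
  also have "(\<Sum>S\<in>Pow E. - ((- 1) ^ card (E - S) * ?G S)) + (\<Sum>S\<in>Pow E. (- 1) ^ card (E - S) * ?G (insert e S)) =
      (\<Sum>S\<in>Pow E. (- 1) ^ card (E - S) * (\<Sum>T\<in>Pow S. F (insert e T)))"
    unfolding sum.distrib[symmetric] by (rule sum.cong[OF refl]) (simp add: G distrib_left)
  also have "\<dots> = F (insert e E)"
    by (rule insert.IH)
  finally show ?case .
qed simp

lemma config_restrict_restrict:
  assumes "T \<subseteq> S"
  shows "config_restrict (config_restrict W S) T = config_restrict W T"
proof -
  have "restrict_coords T (restrict_coords S w) = restrict_coords T w" for w :: "'a \<Rightarrow> 'b"
    using assms by (auto simp: restrict_coords_def fun_eq_iff)
  then show ?thesis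
    by (simp add: config_restrict_image image_image)
qed

lemma config_restrict_self:
  assumes "configuration E W"
  shows "config_restrict W E = W"
proof -
  have "restrict_coords E w = w" if "w \<in> W" for w
    using configuration_support[OF assms that] by (auto simp: restrict_coords_def fun_eq_iff)
  then show ?thesis
    by (simp add: config_restrict_image)
qed

lemma spanning_mono: "spanning W T \<Longrightarrow> T \<subseteq> S \<Longrightarrow> spanning W S"
  by (auto simp: spanning_def)

lemma spanning_restrict:
  assumes "T \<subseteq> S" "spanning W S"
  shows "spanning (config_restrict W S) T \<longleftrightarrow> spanning W T"
proof -
  have 1: "(\<forall>e\<in>T. restrict_coords S w e = 0) \<longleftrightarrow> (\<forall>e\<in>T. w e = 0)" for w :: "'a \<Rightarrow> 'b"
    using assms(1) by (auto simp: restrict_coords_def)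
  have 2: "restrict_coords S w = 0 \<longleftrightarrow> w = 0" if "w \<in> W" for w
    using assms(2) that by (auto simp: spanning_def restrict_coords_def fun_eq_iff)
  show ?thesis
    unfolding spanning_def config_restrict_image using 1 2 by simp
qed

text \<open>
  Spanning sets are closed under enlargement, so extending the terms of
  \<open>K0_class_Y_compl_strata\<close> by zero to all subsets turns the identity into a sum over a full Boolean lattice.
\<close>

lemma K0_class_Y_torus_moebius:
  assumes E: "finite E" and W: "configuration E W"
  shows "K0_class (Y_torus E W) =
    (\<Sum>S | S \<subseteq> E \<and> spanning W S. (- 1) ^ card (E - S) * K0_class (Y_compl S (config_restrict W S)))"
proof -
  \<comment> \<open>extension by zero to the subsets that do not span\<close>
  define F where "F T = (if spanning W T then K0_class (Y_torus T (config_restrict W T)) else 0)" for T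
  have G: "K0_class (Y_compl S (config_restrict W S)) = (\<Sum>T\<in>Pow S. F T)" if S: "S \<subseteq> E" "spanning W S" for S
  proof -
    have fin: "finite S"
      by (rule finite_subset[OF S(1) E])
    have "K0_class (Y_compl S (config_restrict W S)) =
        (\<Sum>T | T \<subseteq> S \<and> spanning (config_restrict W S) T. K0_class (Y_torus T (config_restrict (config_restrict W S) T)))"
      by (rule K0_class_Y_compl_strata[OF fin configuration_restrict[OF W]])
    also have "\<dots> = (\<Sum>T\<in>Pow S. F T)"
      by (rule sum.mono_neutral_cong_left)
         (use fin S spanning_restrict[OF _ S(2)] config_restrict_restrict[of _ S W] in \<open>auto simp: F_def\<close>)
    finally show ?thesis .
  qed
  have zero: "(\<Sum>T\<in>Pow S. F T) = 0" if "\<not> spanning W S" for S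
    by (rule sum.neutral) (use that spanning_mono in \<open>auto simp: F_def\<close>)
  have "spanning W E"
    using configuration_support[OF W] by (auto simp: spanning_def fun_eq_iff)
  then have "K0_class (Y_torus E W) = F E"
    by (simp add: F_def config_restrict_self[OF W])
  also have "\<dots> = (\<Sum>S\<in>Pow E. (- 1) ^ card (E - S) * (\<Sum>T\<in>Pow S. F T))"
    by (rule alternating_subset_sum[OF E, symmetric])
  also have "\<dots> = (\<Sum>S | S \<subseteq> E \<and> spanning W S. (- 1) ^ card (E - S) * K0_class (Y_compl S (config_restrict W S)))"
    by (rule sum.mono_neutral_cong_right) (use E zero G in auto)
  finally show ?thesis .
qed

lemma torus_multiple_sum:
  assumes "\<And>a. a \<in> A \<Longrightarrow> \<exists>c. f a = torus_class * c"
  shows "\<exists>c. (\<Sum>a\<in>A. f a) = torus_class * c"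
proof -
  obtain c where "\<And>a. a \<in> A \<Longrightarrow> f a = torus_class * c a"
    using assms by metis
  then have "(\<Sum>a\<in>A. f a) = torus_class * (\<Sum>a\<in>A. c a)"
    by (simp add: sum_distrib_left)
  then show ?thesis
    by blast
qed

lemma cong_mod_torus_sum:
  assumes A: "finite A" and "B \<subseteq> A" and "\<And>a. a \<in> A - B \<Longrightarrow> \<exists>c. f a = torus_class * c"
  shows "cong_mod_torus (\<Sum>a\<in>A. f a) (\<Sum>a\<in>B. f a)"
proof -
  have "(\<Sum>a\<in>A. f a) - (\<Sum>a\<in>B. f a) = (\<Sum>a\<in>A - B. f a)"
    using sum.subset_diff[OF assms(2,1), of f] by simp
  then show ?thesis
    using torus_multiple_sum[of "A - B" f] assms(3) by (auto simp: cong_mod_torus_def)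
qed

text \<open>
  Every stratum comes from a disconnected restriction and hence is a multiple of the torus class.
\<close>

lemma K0_class_Y_compl_disconnected:
  assumes E: "finite E" and W: "configuration E W" and loopless: "mat_loopless (config_matroid E W)"
    and dis: "\<not> mat_connected (config_matroid E W)"
  shows "\<exists>c. K0_class (Y_compl E W) = torus_class * c"
  unfolding K0_class_Y_compl_strata[OF E W]
proof (rule torus_multiple_sum)
  fix S assume "S \<in> {S. S \<subseteq> E \<and> spanning W S}"
  then have S: "S \<subseteq> E" "spanning W S"
    by auto
  show "\<exists>c. K0_class (Y_torus S (config_restrict W S)) = torus_class * c"
    by (rule K0_class_Y_torus_disconnected[OF finite_subset[OF S(1) E] configuration_restrict[OF W]])
       (use spanning_disconnected[OF E W loopless dis S] config_matroid_restrict[OF S(1), of W] in simp)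
qed

theorem proposition7p5:
  fixes E :: "'e set" and W :: "('e \<Rightarrow> 'k::field) set" and M :: "'e matroid"
  assumes "finite E" and "E \<noteq> {}"
    and "configuration E W"
    and "M = config_matroid E W"
    and "mat_rank M E > 0"
  shows "K0_class (Y_compl E W) =
           (\<Sum>S | S \<subseteq> E \<and> mat_closure M S = E. K0_class (Y_torus S (config_restrict W S)))
    \<and> cong_mod_torus (K0_class (Y_compl E W))
           (\<Sum>S | S \<subseteq> E \<and> mat_closure M S = E \<and> mat_connected (mat_restrict M S).
              K0_class (Y_torus S (config_restrict W S)))
    \<and> (mat_loopless M \<longrightarrow>
         cong_mod_torus (K0_class (Y_torus E W))
           (\<Sum>S | S \<subseteq> E \<and> mat_closure M S = E \<and> mat_connected (mat_restrict M S).
              (-1) ^ card (E - S) * K0_class (Y_compl S (config_restrict W S))))"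
proof -
  note E = \<open>finite E\<close> and W = \<open>configuration E W\<close> and M = \<open>M = config_matroid E W\<close>
  let ?sp = "{S. S \<subseteq> E \<and> mat_closure M S = E}"
  let ?con = "{S. S \<subseteq> E \<and> mat_closure M S = E \<and> mat_connected (mat_restrict M S)}"
  have sp: "{S. S \<subseteq> E \<and> spanning W S} = ?sp"
    using mat_closure_spanning[OF E W] M by auto
  have fin: "finite ?sp" and sub: "?con \<subseteq> ?sp"
    using E by auto
  have S: "S \<subseteq> E" "finite S" "spanning W S" "\<not> mat_connected (config_matroid S (config_restrict W S))"
    if "S \<in> ?sp - ?con" for S
    using that sp E finite_subset config_matroid_restrict[of S E W] M by auto
  have a: "K0_class (Y_compl E W) = (\<Sum>S\<in>?sp. K0_class (Y_torus S (config_restrict W S)))"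
    using K0_class_Y_compl_strata[OF E W] sp by simp
  have b: "cong_mod_torus (K0_class (Y_compl E W)) (\<Sum>S\<in>?con. K0_class (Y_torus S (config_restrict W S)))"
    unfolding a
    by (rule cong_mod_torus_sum[OF fin sub], rule K0_class_Y_torus_disconnected[OF S(2) configuration_restrict[OF W] S(4)])
  have c: "cong_mod_torus (K0_class (Y_torus E W))
      (\<Sum>S\<in>?con. (-1) ^ card (E - S) * K0_class (Y_compl S (config_restrict W S)))" if loopless: "mat_loopless M"
  proof -
    have eq: "K0_class (Y_torus E W) = (\<Sum>S\<in>?sp. (-1) ^ card (E - S) * K0_class (Y_compl S (config_restrict W S)))"
      using K0_class_Y_torus_moebius[OF E W] sp by simp
    have "\<exists>c. (-1) ^ card (E - S) * K0_class (Y_compl S (config_restrict W S)) = torus_class * c"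
      if S': "S \<in> ?sp - ?con" for S
    proof -
      have "mat_loopless (config_matroid S (config_restrict W S))"
        using loopless S(1)[OF S'] M unfolding config_matroid_restrict[OF S(1)[OF S']]
        by (auto simp: mat_loopless_def mat_restrict_def config_matroid_def)
      then obtain c where "K0_class (Y_compl S (config_restrict W S)) = torus_class * c"
        using K0_class_Y_compl_disconnected[OF S(2)[OF S'] configuration_restrict[OF W] _ S(4)[OF S']] by blast
      then show ?thesis
        by (intro exI[of _ "(-1) ^ card (E - S) * c"]) (simp add: mult.left_commute)
    qed
    from cong_mod_torus_sum[OF fin sub this] show ?thesis
      unfolding eq .
  qed
  show ?thesis
    using a b c by blast
qed

end
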